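(* Let $u$ be the optimal control of the optimal control problem described in the context, with optimal state $y(u)$. Then the exact upper bound of the minorant $\mathcal{J}^\ominus$ coincides with the optimal value of the cost functional (equivalently, with the value of $\mathcal{J}$ at the solution of the optimality system): $$\sup_{\eta,\zeta\in V,\ \boldsymbol{\tau},\boldsymbol{\rho}\in H(\mathrm{div},\Omega)} \mathcal{J}^\ominus(\eta,\zeta,\boldsymbol{\tau},\boldsymbol{\rho},v_\zeta)=\mathcal{J}(y(u),u),$$ where for each $\zeta\in V$ the control $v_\zeta$ is given by $v_\zeta(\boldsymbol{x})=\min\{u_b(\boldsymbol{x}),\max\{u_a(\boldsymbol{x}),u_d(\boldsymbol{x})-\tfrac1\lambda\zeta(\boldsymbol{x})\}\}$ for a.e. $\boldsymbol{x}\in\Omega$.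
   Context: Let $\Omega\subset\mathbb{R}^d$, $d\in\{1,2,3\}$, be a bounded Lipschitz domain, $V=H^1_0(\Omega)$, $y_d,u_d,f\in L^2(\Omega)$, $\lambda>0$. Let $\nu:\Omega\to\mathbb{R}$ be measurable with $0<\underline{\nu}\le\nu(\boldsymbol{x})\le\overline{\nu}$ for constants $\underline\nu,\overline\nu$. All functions are real valued; $\|\cdot\|$ is the $L^2(\Omega)$-norm (also for vector fields). $H(\mathrm{div},\Omega)=\{\boldsymbol{\tau}\in[L^2(\Omega)]^d:\mathrm{div}\,\boldsymbol{\tau}\in L^2(\Omega)\}$. $C_F>0$ is a Friedrichs constant: $\|w\|\le C_F\|\nabla w\|$ for all $w\in V$. For $v\in L^2(\Omega)$, $y(v)\in V$ is the weak solution of $\int_\Omega\nu\nabla y(v)\cdot\nabla w\,d\boldsymbol{x}=\int_\Omega(f+v)w\,d\boldsymbol{x}$ for all $w\in V$. The cost functional is $\mathcal{J}(y(v),v)=\frac12\|y(v)-y_d\|^2+\frac\lambda2\|v-u_d\|^2$. Admissible controls: $U_{\mathrm{ad}}=\{v\in L^2(\Omega):u_a\le v\le u_b\text{ a.e. in }\Omega\}$, where $u_a,u_b\in L^2(\Omega)$, $u_a\le u_b$ a.e. The optimal control $u$ is the unique minimizer of $v\mapsto\mathcal{J}(y(v),v)$ over $U_{\mathrm{ad}}$; equivalently, with $y=y(u)$ and the adjoint state $p=p(u)\in V$, the triple $(y,u,p)$ solves the optimality system consisting of the state equation for $y$ with control $u$, $\int_\Omega\nu\nabla p\cdot\nabla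 w\,d\boldsymbol{x}=\int_\Omega(y-y_d)w\,d\boldsymbol{x}$ for all $w\in V$, and $\int_\Omega(p+\lambda(u-u_d))(w-u)\,d\boldsymbol{x}\ge0$ for all $w\in U_{\mathrm{ad}}$. The minorant is $$\mathcal{J}^\ominus(\eta,\zeta,\boldsymbol{\tau},\boldsymbol{\rho},v_\zeta)=\tfrac12\|\eta-y_d\|^2+\tfrac\lambda2\|v_\zeta-u_d\|^2+\int_\Omega(f+v_\zeta+\mathrm{div}\,\boldsymbol{\tau})\zeta\,d\boldsymbol{x}+\int_\Omega(\boldsymbol{\tau}-\nu\nabla\eta)\cdot\nabla\zeta\,d\boldsymbol{x}$$ $$-\tfrac1{\underline\nu}\big(C_F\|\eta-y_d+\mathrm{div}\,\boldsymbol{\rho}\|+\|\boldsymbol{\rho}-\nu\nabla\zeta\|\big)\Big(\tfrac{C_F^3}{\lambda\underline\nu}\|\eta-y_d+\mathrm{div}\,\boldsymbol{\rho}\|+\tfrac{C_F^2}{\lambda\underline\nu}\|\boldsymbol{\rho}-\nu\nabla\zeta\|+C_F\|f+v_\zeta+\mathrm{div}\,\boldsymbol{\tau}\|+\|\boldsymbol{\tau}-\nu\nabla\eta\|\Big).$$ *)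

theory Defs
  imports "HOL-Analysis.Analysis"
begin

text \<open>Functions on \<open>\<Omega>\<close> are total functions on the ambient space, of which only the restriction
  to \<open>\<Omega>\<close> up to null sets matters: every integral below is over \<open>lebesgue_on \<Omega>\<close>.\<close>

definition L2_space :: "'a::euclidean_space set \<Rightarrow> ('a \<Rightarrow> 'b::euclidean_space) set" where
  "L2_space \<Omega> = {w \<in> borel_measurable (lebesgue_on \<Omega>).
     integrable (lebesgue_on \<Omega>) (\<lambda>x. (norm (w x))\<^sup>2)}"

definition L2_norm :: "'a::euclidean_space set \<Rightarrow> ('a \<Rightarrow> 'b::euclidean_space) \<Rightarrow> real" where
  "L2_norm \<Omega> w = sqrt (LINT x|lebesgue_on \<Omega>. (norm (w x))\<^sup>2)"

text \<open>Near each boundary point, \<open>\<Omega>\<close> is the region strictly above the graph of a Lipschitz function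
  over a hyperplane. In dimension one the hyperplane is \<open>{0}\<close>, and the domains are exactly the
  bounded nonempty open intervals.\<close>

definition bounded_lipschitz_domain :: "'a::euclidean_space set \<Rightarrow> bool" where
  "bounded_lipschitz_domain \<Omega> \<longleftrightarrow>
     open \<Omega> \<and> connected \<Omega> \<and> \<Omega> \<noteq> {} \<and> bounded \<Omega> \<and>
     (\<forall>x\<in>frontier \<Omega>. \<exists>r>0. \<exists>e L. \<exists>\<gamma> :: 'a \<Rightarrow> real.
        norm e = 1 \<and> L-lipschitz_on {z. z \<bullet> e = 0} \<gamma> \<and>
        (\<forall>z\<in>ball x r. z \<in> \<Omega> \<longleftrightarrow> \<gamma> (z - (z \<bullet> e) *\<^sub>R e) < z \<bullet> e))"

text \<open>\<open>C_diff k\<close> is the class $C^k(\mathbb{R}^d)$, by recursion on partial derivatives.\<close>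

primrec C_diff :: "nat \<Rightarrow> ('a::euclidean_space \<Rightarrow> real) \<Rightarrow> bool" where
  "C_diff 0 \<phi> \<longleftrightarrow> continuous_on UNIV \<phi>"
| "C_diff (Suc k) \<phi> \<longleftrightarrow> \<phi> differentiable_on UNIV \<and>
     (\<forall>i\<in>Basis. C_diff k (\<lambda>x. frechet_derivative \<phi> (at x) i))"

definition test_functions :: "'a::euclidean_space set \<Rightarrow> ('a \<Rightarrow> real) set" where
  "test_functions \<Omega> =
     {\<phi>. (\<forall>k. C_diff k \<phi>) \<and> compact (closure {x. \<phi> x \<noteq> 0}) \<and> closure {x. \<phi> x \<noteq> 0} \<subseteq> \<Omega>}"

definition classical_grad :: "('a::euclidean_space \<Rightarrow> real) \<Rightarrow> 'a \<Rightarrow> 'a" where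
  "classical_grad \<phi> x = (\<Sum>i\<in>Basis. frechet_derivative \<phi> (at x) i *\<^sub>R i)"

definition is_weak_grad :: "'a::euclidean_space set \<Rightarrow> ('a \<Rightarrow> real) \<Rightarrow> ('a \<Rightarrow> 'a) \<Rightarrow> bool" where
  "is_weak_grad \<Omega> w g \<longleftrightarrow> g \<in> L2_space \<Omega> \<and>
     (\<forall>\<phi>\<in>test_functions \<Omega>. \<forall>i\<in>Basis.
        (LINT x|lebesgue_on \<Omega>. w x * (classical_grad \<phi> x \<bullet> i)) =
        - (LINT x|lebesgue_on \<Omega>. (g x \<bullet> i) * \<phi> x))"

definition is_weak_div :: "'a::euclidean_space set \<Rightarrow> ('a \<Rightarrow> 'a) \<Rightarrow> ('a \<Rightarrow> real) \<Rightarrow> bool" where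
  "is_weak_div \<Omega> \<tau> h \<longleftrightarrow> h \<in> L2_space \<Omega> \<and>
     (\<forall>\<phi>\<in>test_functions \<Omega>.
        (LINT x|lebesgue_on \<Omega>. \<tau> x \<bullet> classical_grad \<phi> x) = - (LINT x|lebesgue_on \<Omega>. h x * \<phi> x))"

text \<open>Weak gradients, weak divergences and weak solutions are unique only up to null sets; the
  operators \<open>wgrad\<close>, \<open>wdiv\<close> and \<open>state\<close> select some representative.\<close>

definition wgrad :: "'a::euclidean_space set \<Rightarrow> ('a \<Rightarrow> real) \<Rightarrow> 'a \<Rightarrow> 'a" where
  "wgrad \<Omega> w = (SOME g. is_weak_grad \<Omega> w g)"

definition wdiv :: "'a::euclidean_space set \<Rightarrow> ('a \<Rightarrow> 'a) \<Rightarrow> 'a \<Rightarrow> real" where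
  "wdiv \<Omega> \<tau> = (SOME h. is_weak_div \<Omega> \<tau> h)"

definition H1_space :: "'a::euclidean_space set \<Rightarrow> ('a \<Rightarrow> real) set" where
  "H1_space \<Omega> = {w \<in> L2_space \<Omega>. \<exists>g. is_weak_grad \<Omega> w g}"

text \<open>The closure of the test functions in the $H^1$ norm.\<close>

definition H10_space :: "'a::euclidean_space set \<Rightarrow> ('a \<Rightarrow> real) set" where
  "H10_space \<Omega> = {w \<in> H1_space \<Omega>. \<exists>\<phi> :: nat \<Rightarrow> 'a \<Rightarrow> real.
     (\<forall>n. \<phi> n \<in> test_functions \<Omega>) \<and>
     (\<lambda>n. L2_norm \<Omega> (\<lambda>x. \<phi> n x - w x)) \<longlonglongrightarrow> 0 \<and>
     (\<lambda>n. L2_norm \<Omega> (\<lambda>x. classical_grad (\<phi> n) x - wgrad \<Omega> w x)) \<longlonglongrightarrow> 0}"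

definition Hdiv_space :: "'a::euclidean_space set \<Rightarrow> ('a \<Rightarrow> 'a) set" where
  "Hdiv_space \<Omega> = {\<tau> \<in> L2_space \<Omega>. \<exists>h. is_weak_div \<Omega> \<tau> h}"

definition is_weak_solution ::
  "'a::euclidean_space set \<Rightarrow> ('a \<Rightarrow> real) \<Rightarrow> ('a \<Rightarrow> real) \<Rightarrow> ('a \<Rightarrow> real) \<Rightarrow> bool" where
  "is_weak_solution \<Omega> \<nu> g z \<longleftrightarrow> z \<in> H10_space \<Omega> \<and>
     (\<forall>w\<in>H10_space \<Omega>.
        (LINT x|lebesgue_on \<Omega>. \<nu> x * (wgrad \<Omega> z x \<bullet> wgrad \<Omega> w x)) =
        (LINT x|lebesgue_on \<Omega>. g x * w x))"

definition state ::
  "'a::euclidean_space set \<Rightarrow> ('a \<Rightarrow> real) \<Rightarrow> ('a \<Rightarrow> real) \<Rightarrow> ('a \<Rightarrow> real) \<Rightarrow> 'a \<Rightarrow> real" where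
  "state \<Omega> \<nu> f v = (SOME z. is_weak_solution \<Omega> \<nu> (\<lambda>x. f x + v x) z)"

definition cost ::
  "'a::euclidean_space set \<Rightarrow> real \<Rightarrow> ('a \<Rightarrow> real) \<Rightarrow> ('a \<Rightarrow> real) \<Rightarrow>
   ('a \<Rightarrow> real) \<Rightarrow> ('a \<Rightarrow> real) \<Rightarrow> real" where
  "cost \<Omega> lam yd ud y v =
     1 / 2 * (L2_norm \<Omega> (\<lambda>x. y x - yd x))\<^sup>2 + lam / 2 * (L2_norm \<Omega> (\<lambda>x. v x - ud x))\<^sup>2"

definition admissible_controls ::
  "'a::euclidean_space set \<Rightarrow> ('a \<Rightarrow> real) \<Rightarrow> ('a \<Rightarrow> real) \<Rightarrow> ('a \<Rightarrow> real) set" where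
  "admissible_controls \<Omega> ua ub =
     {v \<in> L2_space \<Omega>. AE x in lebesgue_on \<Omega>. ua x \<le> v x \<and> v x \<le> ub x}"

definition is_optimal_control ::
  "'a::euclidean_space set \<Rightarrow> ('a \<Rightarrow> real) \<Rightarrow> real \<Rightarrow> ('a \<Rightarrow> real) \<Rightarrow> ('a \<Rightarrow> real) \<Rightarrow>
   ('a \<Rightarrow> real) \<Rightarrow> ('a \<Rightarrow> real) \<Rightarrow> ('a \<Rightarrow> real) \<Rightarrow> ('a \<Rightarrow> real) \<Rightarrow> bool" where
  "is_optimal_control \<Omega> \<nu> lam f yd ud ua ub u \<longleftrightarrow>
     is_arg_min (\<lambda>v. cost \<Omega> lam yd ud (state \<Omega> \<nu> f v) v) (\<lambda>v. v \<in> admissible_controls \<Omega> ua ub) u"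

definition optimality_system ::
  "'a::euclidean_space set \<Rightarrow> ('a \<Rightarrow> real) \<Rightarrow> real \<Rightarrow> ('a \<Rightarrow> real) \<Rightarrow> ('a \<Rightarrow> real) \<Rightarrow>
   ('a \<Rightarrow> real) \<Rightarrow> ('a \<Rightarrow> real) \<Rightarrow> ('a \<Rightarrow> real) \<Rightarrow>
   ('a \<Rightarrow> real) \<Rightarrow> ('a \<Rightarrow> real) \<Rightarrow> ('a \<Rightarrow> real) \<Rightarrow> bool" where
  "optimality_system \<Omega> \<nu> lam f yd ud ua ub y u p \<longleftrightarrow>
     u \<in> admissible_controls \<Omega> ua ub \<and>
     is_weak_solution \<Omega> \<nu> (\<lambda>x. f x + u x) y \<and>
     is_weak_solution \<Omega> \<nu> (\<lambda>x. y x - yd x) p \<and>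
     (\<forall>w\<in>admissible_controls \<Omega> ua ub.
        (LINT x|lebesgue_on \<Omega>. (p x + lam * (u x - ud x)) * (w x - u x)) \<ge> 0)"

definition projected_control ::
  "real \<Rightarrow> ('a \<Rightarrow> real) \<Rightarrow> ('a \<Rightarrow> real) \<Rightarrow> ('a \<Rightarrow> real) \<Rightarrow> ('a \<Rightarrow> real) \<Rightarrow> 'a \<Rightarrow> real" where
  "projected_control lam ud ua ub \<zeta> x = min (ub x) (max (ua x) (ud x - 1 / lam * \<zeta> x))"

text \<open>The parameter \<open>\<nu>l\<close> is the lower bound of \<open>\<nu>\<close>, and \<open>CF\<close> the Friedrichs constant.\<close>

definition minorant ::
  "'a::euclidean_space set \<Rightarrow> ('a \<Rightarrow> real) \<Rightarrow> real \<Rightarrow> real \<Rightarrow> real \<Rightarrow>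
   ('a \<Rightarrow> real) \<Rightarrow> ('a \<Rightarrow> real) \<Rightarrow> ('a \<Rightarrow> real) \<Rightarrow>
   ('a \<Rightarrow> real) \<Rightarrow> ('a \<Rightarrow> real) \<Rightarrow> ('a \<Rightarrow> 'a) \<Rightarrow> ('a \<Rightarrow> 'a) \<Rightarrow> ('a \<Rightarrow> real) \<Rightarrow> real" where
  "minorant \<Omega> \<nu> \<nu>l CF lam f yd ud \<eta> \<zeta> \<tau> \<rho> v =
     (let r1 = L2_norm \<Omega> (\<lambda>x. \<eta> x - yd x + wdiv \<Omega> \<rho> x);
          r2 = L2_norm \<Omega> (\<lambda>x. \<rho> x - \<nu> x *\<^sub>R wgrad \<Omega> \<zeta> x);
          r3 = L2_norm \<Omega> (\<lambda>x. f x + v x + wdiv \<Omega> \<tau> x);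
          r4 = L2_norm \<Omega> (\<lambda>x. \<tau> x - \<nu> x *\<^sub>R wgrad \<Omega> \<eta> x)
      in 1 / 2 * (L2_norm \<Omega> (\<lambda>x. \<eta> x - yd x))\<^sup>2 + lam / 2 * (L2_norm \<Omega> (\<lambda>x. v x - ud x))\<^sup>2
         + (LINT x|lebesgue_on \<Omega>. (f x + v x + wdiv \<Omega> \<tau> x) * \<zeta> x)
         + (LINT x|lebesgue_on \<Omega>. (\<tau> x - \<nu> x *\<^sub>R wgrad \<Omega> \<eta> x) \<bullet> wgrad \<Omega> \<zeta> x)
         - 1 / \<nu>l * (CF * r1 + r2) *
           (CF ^ 3 / (lam * \<nu>l) * r1 + CF\<^sup>2 / (lam * \<nu>l) * r2 + CF * r3 + r4))"

end

theory Submission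
  imports Defs
begin

text \<open>Fix \<open>\<zeta>\<close> and write the cost at an admissible control \<open>v\<close> with state \<open>y\<close> as the Lagrangian
  at \<open>(y, v, \<zeta>)\<close>. Replacing \<open>v\<close> by \<open>v\<^sub>\<zeta>\<close> costs at least \<open>lam/2 \<parallel>v - v\<^sub>\<zeta>\<parallel>\<^sup>2\<close>, because \<open>v\<^sub>\<zeta>\<close> minimizes
  the strongly convex control part pointwise. Replacing \<open>y\<close> by \<open>\<eta>\<close> costs at most the adjoint residual of \<open>\<zeta>\<close>
  times the norm of \<open>\<nabla>(y - \<eta>)\<close>, and this norm is controlled by \<open>\<parallel>v - v\<^sub>\<zeta>\<parallel>\<close> and the state residual of \<open>\<eta>\<close>.
  The term in \<open>\<parallel>v - v\<^sub>\<zeta>\<parallel>\<close> is absorbed by the quadratic gain, so the minorant lies below the cost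
  of every admissible control. At a solution \<open>(y, u, p)\<close> of the optimality system the
  choice \<open>\<eta> = y\<close>, \<open>\<zeta> = p\<close>, \<open>\<tau> = \<nu>\<nabla>y\<close>, \<open>\<rho> = \<nu>\<nabla>p\<close> annihilates all residuals and gives
  \<open>v\<^sub>\<zeta> = u\<close>, so the minorant equals the cost there.\<close>

subsection \<open>Smooth bump functions\<close>

text \<open>Two facts about existence and uniqueness shape the proof. First, \<open>wgrad\<close>
  and \<open>wdiv\<close> are choices, so computing with them requires that weak derivatives be
  unique up to null sets. This is the fundamental lemma of the calculus of variations, for which the
  smooth bumps are built. Second, optimality of \<open>u\<close> compares costs at the states chosen
  by \<open>state\<close>, and nothing in the hypotheses provides these states or an adjoint state.
  Both are weak solutions, and these are constructed by minimizing the energy over test functions,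
  which rests on the completeness of L2 and on the Friedrichs inequality. The first-order condition
  at \<open>u\<close> then turns minimality into the optimality system.

  No uniqueness theorem for that system is used. The equality of costs at two solutions follows from
  comparing the minorant at one of them with the cost at the other, in both directions.\<close>

lemma C_diff_const [simp]: "C_diff k (\<lambda>x. c)"
proof (induction k arbitrary: c)
  case (Suc k)
  have "(\<lambda>x. frechet_derivative (\<lambda>x::'a. c) (at x) i) = (\<lambda>x. 0)" for i
    by (simp add: frechet_derivative_const)
  then show ?case using Suc by (simp add: differentiable_on_def)
qed auto

text \<open>Derivatives are unique, so any exhibited derivative \<open>D\<close> may stand in for
  the \<open>frechet_derivative\<close> in the recursion of \<open>C_diff\<close>.\<close>

lemma C_diff_SucI:
  assumes "\<And>x. (\<phi> has_derivative D x) (at x)"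
    and "\<And>i. i \<in> Basis \<Longrightarrow> C_diff k (\<lambda>x. D x i)"
  shows "C_diff (Suc k) \<phi>"
proof -
  have "frechet_derivative \<phi> (at x) = D x" for x
    using assms(1) frechet_derivative_at by metis
  then show ?thesis
    using assms by (auto simp: differentiable_on_def differentiable_def)
qed

lemma C_diff_has_derivative:
  assumes "C_diff (Suc k) \<phi>"
  shows "(\<phi> has_derivative frechet_derivative \<phi> (at x)) (at x)"
  using assms by (auto simp: differentiable_on_def frechet_derivative_works)

lemma C_diff_Suc_imp: "C_diff (Suc k) \<phi> \<Longrightarrow> C_diff k \<phi>"
proof (induction k arbitrary: \<phi>)
  case 0
  then show ?case by (simp add: differentiable_imp_continuous_on)
next
  case (Suc k)
  then show ?case by (metis C_diff.simps(2))
qed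

lemma C_diff_add: "C_diff k \<phi> \<Longrightarrow> C_diff k \<psi> \<Longrightarrow> C_diff k (\<lambda>x. \<phi> x + \<psi> x)"
proof (induction k arbitrary: \<phi> \<psi>)
  case 0
  then show ?case by (simp add: continuous_on_add)
next
  case (Suc k)
  show ?case
  proof (rule C_diff_SucI)
    show "((\<lambda>x. \<phi> x + \<psi> x) has_derivative
        (\<lambda>h. frechet_derivative \<phi> (at x) h + frechet_derivative \<psi> (at x) h)) (at x)" for x
      by (intro has_derivative_add C_diff_has_derivative[OF Suc.prems(1)]
          C_diff_has_derivative[OF Suc.prems(2)])
    show "C_diff k (\<lambda>x. frechet_derivative \<phi> (at x) i + frechet_derivative \<psi> (at x) i)"
      if "i \<in> Basis" for i
      using Suc that by simp
  qed
qed

lemma C_diff_mult: "C_diff k \<phi> \<Longrightarrow> C_diff k \<psi> \<Longrightarrow> C_diff k (\<lambda>x. \<phi> x * \<psi> x)"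
proof (induction k arbitrary: \<phi> \<psi>)
  case 0
  then show ?case by (simp add: continuous_on_mult)
next
  case (Suc k)
  show ?case
  proof (rule C_diff_SucI)
    show "((\<lambda>x. \<phi> x * \<psi> x) has_derivative
        (\<lambda>h. \<phi> x * frechet_derivative \<psi> (at x) h + frechet_derivative \<phi> (at x) h * \<psi> x)) (at x)" for x
      by (intro has_derivative_mult C_diff_has_derivative[OF Suc.prems(1)]
          C_diff_has_derivative[OF Suc.prems(2)])
    show "C_diff k (\<lambda>x. \<phi> x * frechet_derivative \<psi> (at x) i + frechet_derivative \<phi> (at x) i * \<psi> x)"
      if "i \<in> Basis" for i
      \<comment> \<open>The product rule also leaves \<open>\<phi>\<close> and \<open>\<psi>\<close>
        undifferentiated; for these one order of smoothness is given up.\<close>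
      using Suc that by (intro C_diff_add Suc.IH) (auto intro: C_diff_Suc_imp)
  qed
qed

lemma C_diff_prod:
  "finite A \<Longrightarrow> (\<And>i. i \<in> A \<Longrightarrow> C_diff k (\<phi> i)) \<Longrightarrow> C_diff k (\<lambda>x. \<Prod>i\<in>A. \<phi> i x)"
  by (induction A rule: finite_induct) (auto intro: C_diff_mult)

text \<open>The functions below are closed under differentiation, which makes
  \<open>flat_exp 1\<close>, that is \<open>exp (-1/t)\<close> for \<open>t > 0\<close>, infinitely differentiable.\<close>

definition flat_exp :: "real poly \<Rightarrow> real \<Rightarrow> real" where
  "flat_exp P t = (if t \<le> 0 then 0 else poly P (1 / t) * exp (- 1 / t))"

text \<open>With s = 1/t this governs \<open>flat_exp P\<close> as t tends to 0 from the
  right.\<close>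

lemma poly_exp_tendsto_0:
  "((\<lambda>s. poly P s * exp (- s)) \<longlongrightarrow> 0) at_top" for P :: "real poly"
proof -
  have "((\<lambda>s. \<Sum>i\<le>degree P. coeff P i * (s ^ i / exp s)) \<longlongrightarrow> (\<Sum>i\<le>degree P. coeff P i * 0)) at_top"
    by (intro tendsto_intros tendsto_power_div_exp_0)
  moreover have "(\<lambda>s. \<Sum>i\<le>degree P. coeff P i * (s ^ i / exp s)) = (\<lambda>s. poly P s * exp (- s))"
    by (simp add: poly_altdef sum_distrib_right exp_minus divide_inverse mult.assoc)
  ultimately show ?thesis by simp
qed

text \<open>For t > 0 and s = 1/t, both P(s) and exp(-s) contribute a factor s^2 when differentiated
  in t, with opposite signs; this is the polynomial X^2 (P - P'). The only delicate point is t = 0,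
  where the difference quotients from both sides must tend to 0.\<close>

lemma flat_exp_has_derivative:
  "(flat_exp P has_real_derivative flat_exp ([:0, 0, 1:] * (P - pderiv P)) t) (at t)"
proof -
  consider "t < 0" | "t = 0" | "t > 0" by linarith
  then show ?thesis
  proof cases
    case 1
    have "((\<lambda>_. 0) has_real_derivative 0) (at t)" by simp
    then have "(flat_exp P has_real_derivative 0) (at t)"
      by (rule has_field_derivative_transform_within_open[where S = "{..<0}"])
        (use 1 in \<open>auto simp: flat_exp_def\<close>)
    then show ?thesis using 1 by (simp add: flat_exp_def)
  next
    case 2
    \<comment> \<open>Dividing \<open>flat_exp P h\<close> by h multiplies P(s) by s = 1/h, and s
      P(s) is \<open>pCons 0 P\<close>.\<close>
    have "((\<lambda>s. poly (pCons 0 P) s * exp (- s)) \<longlongrightarrow> 0) at_top"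
      by (rule poly_exp_tendsto_0)
    then have "((\<lambda>h. poly (pCons 0 P) (inverse h) * exp (- inverse h)) \<longlongrightarrow> 0) (at_right (0::real))"
      by (rule filterlim_compose[OF _ filterlim_inverse_at_top_right])
    then have r: "((\<lambda>h. flat_exp P h / h) \<longlongrightarrow> 0) (at_right 0)"
      by (rule Lim_transform_eventually)
        (auto simp: eventually_at_filter flat_exp_def field_simps)
    have l: "((\<lambda>h. flat_exp P h / h) \<longlongrightarrow> 0) (at_left 0)"
      by (rule Lim_transform_eventually[OF tendsto_const])
        (auto simp: eventually_at_filter flat_exp_def)
    have "((\<lambda>h. flat_exp P h / h) \<longlongrightarrow> 0) (at 0)"
      using l r filterlim_split_at by blast
    then show ?thesis using 2 by (simp add: DERIV_def flat_exp_def)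
  next
    case 3
    have "((\<lambda>t. poly P (1 / t) * exp (- 1 / t)) has_real_derivative
        flat_exp ([:0, 0, 1:] * (P - pderiv P)) t) (at t)"
      using 3 by (auto intro!: derivative_eq_intros poly_DERIV[THEN DERIV_chain2]
          simp: flat_exp_def field_simps power2_eq_square)
    then show ?thesis
      by (rule has_field_derivative_transform_within_open[where S = "{0<..}"])
        (use 3 in \<open>auto simp: flat_exp_def\<close>)
  qed
qed

text \<open>The induction has to range over all \<open>P\<close>, since every partial derivative
  changes the polynomial. The affine argument is that of the factors of
  \<open>box_bump\<close>.\<close>

lemma C_diff_flat_exp: "C_diff k (\<lambda>x. flat_exp P (a * (x \<bullet> b) + c))"
proof (induction k arbitrary: P)
  case 0
  have "continuous_on UNIV (flat_exp P)"
    using flat_exp_has_derivative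
    by (meson DERIV_continuous continuous_at_imp_continuous_on)
  then have "continuous_on UNIV (\<lambda>x. flat_exp P (a * (x \<bullet> b) + c))"
    by (rule continuous_on_compose2) (auto intro!: continuous_intros)
  then show ?case by simp
next
  case (Suc k)
  show ?case
  proof (rule C_diff_SucI)
    let ?Q = "[:0, 0, 1:] * (P - pderiv P)"
    show "((\<lambda>x. flat_exp P (a * (x \<bullet> b) + c)) has_derivative
        (\<lambda>h. a * (h \<bullet> b) * flat_exp ?Q (a * (x \<bullet> b) + c))) (at x)" for x
    proof -
      have "((\<lambda>x. a * (x \<bullet> b) + c) has_derivative (\<lambda>h. a * (h \<bullet> b))) (at x)"
        by (auto intro!: derivative_eq_intros)
      from has_derivative_compose[OF this
          flat_exp_has_derivative[unfolded has_field_derivative_def]]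
      show ?thesis by (simp add: mult.commute)
    qed
    show "C_diff k (\<lambda>x. a * (i \<bullet> b) * flat_exp ?Q (a * (x \<bullet> b) + c))" for i
      by (intro C_diff_mult C_diff_const Suc)
  qed
qed

section \<open>Test functions that approximate indicators of boxes\<close>

lemma test_functions_zero:
  assumes "\<phi> \<in> test_functions \<Omega>" "x \<notin> \<Omega>"
  shows "\<phi> x = 0"
proof (rule ccontr)
  assume "\<phi> x \<noteq> 0"
  then have "x \<in> closure {x. \<phi> x \<noteq> 0}"
    using closure_subset[of "{x. \<phi> x \<noteq> 0}"] by (simp add: subset_eq)
  then show False using assms by (auto simp: test_functions_def)
qed

lemma test_functionsI:
  assumes "\<And>k. C_diff k \<phi>" "compact K" "K \<subseteq> \<Omega>" "\<And>x. x \<notin> K \<Longrightarrow> \<phi> x = 0"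
  shows "\<phi> \<in> test_functions \<Omega>"
proof -
  have sub: "closure {x. \<phi> x \<noteq> 0} \<subseteq> K"
  proof (rule closure_minimal)
    show "{x. \<phi> x \<noteq> 0} \<subseteq> K" using assms(4) by (auto intro: ccontr)
  qed (use assms(2) in \<open>rule compact_imp_closed\<close>)
  moreover have "compact (closure {x. \<phi> x \<noteq> 0})"
    using compact_Int_closed[OF assms(2) closed_closure] sub by (metis inf.absorb_iff2)
  ultimately show ?thesis
    using assms(1,3) unfolding test_functions_def by blast
qed

text \<open>Scaling the argument by \<open>n\<close> keeps the support inside
  \<open>cbox a b\<close> and steepens the rise at the faces, so that the pointwise limit is the
  indicator of the open box.\<close>

definition box_bump :: "'a::euclidean_space \<Rightarrow> 'a \<Rightarrow> nat \<Rightarrow> 'a \<Rightarrow> real" where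
  "box_bump a b n x = (\<Prod>i\<in>Basis.
     flat_exp 1 (real n * (x \<bullet> i) + - (real n * (a \<bullet> i))) *
     flat_exp 1 (- real n * (x \<bullet> i) + real n * (b \<bullet> i)))"

lemma box_bump_eq_0: "x \<notin> cbox a b \<Longrightarrow> box_bump a b n x = 0"
  unfolding box_bump_def
proof (rule prod_zero)
  assume "x \<notin> cbox a b"
  then obtain i where i: "i \<in> Basis" "x \<bullet> i < a \<bullet> i \<or> b \<bullet> i < x \<bullet> i"
    by (auto simp: mem_box not_le)
  then have "real n * (x \<bullet> i) \<le> real n * (a \<bullet> i) \<or> real n * (b \<bullet> i) \<le> real n * (x \<bullet> i)"
    by (meson less_imp_le mult_left_mono of_nat_0_le_iff)
  then show "\<exists>i\<in>Basis. flat_exp 1 (real n * (x \<bullet> i) + - (real n * (a \<bullet> i))) *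
     flat_exp 1 (- real n * (x \<bullet> i) + real n * (b \<bullet> i)) = 0"
    using i(1) by (intro bexI[of _ i]) (simp_all add: flat_exp_def, linarith)
qed auto

lemma box_bump_test_function: "cbox a b \<subseteq> \<Omega> \<Longrightarrow> box_bump a b n \<in> test_functions \<Omega>"
proof (rule test_functionsI)
  show "C_diff k (box_bump a b n)" for k
    unfolding box_bump_def by (intro C_diff_prod C_diff_mult C_diff_flat_exp) auto
qed (auto intro: box_bump_eq_0)

lemma flat_exp_1_bounds: "0 \<le> flat_exp 1 t" "flat_exp 1 t \<le> 1"
  by (simp_all add: flat_exp_def)

lemma box_bump_bounds: "0 \<le> box_bump a b n x" "box_bump a b n x \<le> 1"
  unfolding box_bump_def
  by (intro prod_nonneg ballI mult_nonneg_nonneg flat_exp_1_bounds)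
    (intro prod_le_1 conjI mult_le_one mult_nonneg_nonneg flat_exp_1_bounds)

lemma flat_exp_1_scaled_tendsto:
  "(\<lambda>n. flat_exp 1 (real n * t)) \<longlonglongrightarrow> (if t > 0 then 1 else 0)"
proof (cases "t > 0")
  case True
  have "(\<lambda>n. exp (- (1 / t) * (1 / real n))) \<longlonglongrightarrow> exp (- (1 / t) * 0)"
    by (intro tendsto_intros lim_1_over_n)
  moreover have "\<forall>\<^sub>F n in sequentially. exp (- (1 / t) * (1 / real n)) = flat_exp 1 (real n * t)"
    using eventually_gt_at_top[of 0]
  proof eventually_elim
    case (elim n)
    then have "0 < real n * t" using True by simp
    then show ?case by (simp add: flat_exp_def mult.commute)
  qed
  ultimately show ?thesis
    using True by (simp add: tendsto_cong)
next
  case False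
  then have "real n * t \<le> 0" for n
    by (simp add: mult_nonneg_nonpos)
  then have "flat_exp 1 (real n * t) = 0" for n
    by (simp add: flat_exp_def)
  then show ?thesis using False by simp
qed

lemma box_bump_tendsto_indicator: "(\<lambda>n. box_bump a b n x) \<longlonglongrightarrow> indicator (box a b) x"
proof -
  have "(\<lambda>n. box_bump a b n x) =
      (\<lambda>n. \<Prod>i\<in>Basis. flat_exp 1 (real n * (x \<bullet> i - a \<bullet> i)) * flat_exp 1 (real n * (b \<bullet> i - x \<bullet> i)))"
    by (simp add: box_bump_def algebra_simps)
  moreover have "\<dots> \<longlonglongrightarrow> (\<Prod>i\<in>Basis.
      (if x \<bullet> i - a \<bullet> i > 0 then 1 else 0) * (if b \<bullet> i - x \<bullet> i > 0 then 1 else 0))"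
    by (intro tendsto_intros flat_exp_1_scaled_tendsto)
  moreover have "(\<Prod>i\<in>Basis. (if x \<bullet> i - a \<bullet> i > 0 then 1 else 0) *
      (if b \<bullet> i - x \<bullet> i > 0 then 1 else 0 :: real)) = indicator (box a b) x"
  proof (cases "x \<in> box a b")
    case False
    then obtain i where "i \<in> Basis" "\<not> (a \<bullet> i < x \<bullet> i \<and> x \<bullet> i < b \<bullet> i)"
      by (auto simp: mem_box)
    then have "\<exists>i\<in>Basis. (if x \<bullet> i - a \<bullet> i > 0 then 1 else 0) *
        (if b \<bullet> i - x \<bullet> i > 0 then 1 else 0 :: real) = 0"
      by (intro bexI[of _ i]) auto
    then show ?thesis using False by (subst prod_zero) simp_all
  qed (auto simp: mem_box intro!: prod.neutral)
  ultimately show ?thesis by simp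
qed

section \<open>Fundamental lemma of the calculus of variations\<close>

lemma AE_zero_if_box_integrals_zero:
  fixes f :: "'a::euclidean_space \<Rightarrow> real"
  assumes f: "integrable lborel f" "\<And>a b. (LINT x:box a b|lborel. f x) = 0"
    and supp: "\<And>x. x \<notin> cbox c d \<Longrightarrow> f x = 0"
  shows "AE x in lborel. f x = 0"
proof (rule sigma_finite_measure.density_zero[OF sigma_finite_lborel f(1)])
  fix A :: "'a set" assume "A \<in> sets lborel"
  \<comment> \<open>Passing to complements below needs the integral over the whole space. Since the
    support is bounded, that is the integral over one large box.\<close>
  have UNIV: "(LINT x|lborel. f x) = 0"
  proof -
    obtain e where e: "cbox c d \<subseteq> box (- e) e"
      using bounded_subset_box_symmetric[OF bounded_cbox] by metis
    then have "(\<lambda>x. indicator (box (-e) e) x *\<^sub>R f x) = f"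
      using supp by (fastforce simp: fun_eq_iff indicator_def)
    then show ?thesis using f(2)[of "-e" e] unfolding set_lebesgue_integral_def by metis
  qed
  have int: "set_integrable lborel A f" if "A \<in> sets borel" for A
    unfolding set_integrable_def using that f(1) by (intro integrable_mult_indicator) auto
  \<comment> \<open>The Borel sets over which \<open>f\<close> integrates to 0 are closed under
    complements and countable disjoint unions, and the open boxes are a generator of the Borel sets
    that is stable under intersection: Dynkin's argument.\<close>
  have "Int_stable (range (\<lambda>(a, b). box a b :: 'a set))"
    by (auto simp: Int_stable_def box_Int_box)
  moreover have "(range (\<lambda>(a, b). box a b)) \<subseteq> Pow (UNIV :: 'a set)"
    by auto
  moreover have "A \<in> sigma_sets UNIV (range (\<lambda>(a, b). box a b))"
    using \<open>A \<in> sets lborel\<close> unfolding borel_eq_box by (simp add: borel_eq_box)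
  ultimately show "(LINT x:A|lborel. f x) = 0"
  proof (induction rule: sigma_sets_induct_disjoint)
    case (basic A)
    then show ?case using f(2) by auto
  next
    case empty
    then show ?case by (simp add: set_lebesgue_integral_def)
  next
    case (compl A)
    then have A: "A \<in> sets borel" by (simp add: borel_eq_box)
    have "(LINT x:A \<union> (UNIV - A)|lborel. f x) = (LINT x:A|lborel. f x) + (LINT x:UNIV - A|lborel. f x)"
      using A int by (intro set_integral_Un) auto
    then show ?case using compl UNIV by (simp add: set_lebesgue_integral_def)
  next
    case (union F)
    then have F: "\<And>i. F i \<in> sets borel" by (simp add: borel_eq_box subset_eq)
    have "(\<Union>i. F i) \<in> sets borel" using F by auto
    then have "(LINT x:(\<Union>i. F i)|lborel. f x) = (\<Sum>i. LINT x:F i|lborel. f x)"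
      using union(1) F int
      by (intro lebesgue_integral_countable_add) (auto simp: disjoint_family_on_def)
    then show ?case using union by simp
  qed
qed

text \<open>Integrable functions on \<Omega> are only Lebesgue measurable, while the argument with
  boxes reaches Borel sets. The zero extension is therefore replaced by a Borel version.\<close>

lemma lebesgue_on_open_eq_lborel_extension:
  fixes d :: "'a::euclidean_space \<Rightarrow> real"
  assumes "open \<Omega>" "integrable (lebesgue_on \<Omega>) d"
  obtains g where "integrable lborel g" "AE x in lebesgue. indicator \<Omega> x * d x = g x"
proof -
  have "integrable lebesgue (\<lambda>x. indicator \<Omega> x * d x)"
    using assms by (simp add: integrable_restrict_space borel_open)
  moreover obtain g where g: "g \<in> borel_measurable lborel" "AE x in lborel. indicator \<Omega> x * d x = g x"
    using completion_ex_borel_measurable_real[OF borel_measurable_integrable[OF calculation]] by blast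
  have gl: "AE x in lebesgue. indicator \<Omega> x * d x = g x"
    using g(2) by (rule AE_completion)
  have "integrable lebesgue g"
    using calculation measurable_completion[OF g(1)] gl
    by (subst integrable_cong_AE[OF _ _ AE_symmetric[OF gl]]) auto
  then have "integrable lborel g" using g(1) integrable_completion by blast
  then show thesis using gl that by blast
qed

lemma C_diff_imp_continuous: "C_diff k \<phi> \<Longrightarrow> continuous_on UNIV \<phi>"
  by (induction k arbitrary: \<phi>) (metis C_diff.simps(1), metis C_diff_Suc_imp)

lemma test_functions_continuous: "\<phi> \<in> test_functions \<Omega> \<Longrightarrow> continuous_on UNIV \<phi>"
  using C_diff_imp_continuous by (auto simp: test_functions_def)

text \<open>Testing with bumps and dominated convergence give integral 0 over each box whose closed
  box lies in \<Omega>. Hence \<open>d\<close> vanishes almost everywhere on each closed box in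
  \<Omega>, and countably many of these cover the open set.\<close>

lemma fundamental_lemma_calculus_of_variations:
  fixes d :: "'a::euclidean_space \<Rightarrow> real"
  assumes \<Omega>: "open \<Omega>" and d: "integrable (lebesgue_on \<Omega>) d"
    and zero: "\<And>\<phi>. \<phi> \<in> test_functions \<Omega> \<Longrightarrow> (LINT x|lebesgue_on \<Omega>. d x * \<phi> x) = 0"
  shows "AE x in lebesgue_on \<Omega>. d x = 0"
proof -
  obtain g where g: "integrable lborel g" and dg: "AE x in lebesgue. indicator \<Omega> x * d x = g x"
    using lebesgue_on_open_eq_lborel_extension[OF \<Omega> d] .
  have gm [measurable]: "g \<in> borel_measurable borel" using g by auto
  have \<phi>0: "(LINT x|lborel. g x * \<phi> x) = 0" if \<phi>: "\<phi> \<in> test_functions \<Omega>" for \<phi>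
  proof -
    have \<phi>m [measurable]: "\<phi> \<in> borel_measurable borel"
      by (intro borel_measurable_continuous_onI test_functions_continuous[OF \<phi>])
    have [measurable]: "g \<in> borel_measurable lebesgue" "\<phi> \<in> borel_measurable lebesgue"
      using gm \<phi>m by (auto intro!: measurable_completion)
    have [measurable]: "(\<lambda>x. indicator \<Omega> x * d x) \<in> borel_measurable lebesgue"
      using d \<Omega> by (auto simp: integrable_restrict_space borel_open dest!: borel_measurable_integrable)
    have "(LINT x|lborel. g x * \<phi> x) = (LINT x|lebesgue. g x * \<phi> x)"
      by (intro integral_completion[symmetric]) measurable
    also have "\<dots> = (LINT x|lebesgue. (indicator \<Omega> x * d x) * \<phi> x)"
      using dg by (intro integral_cong_AE) (measurable, auto)
    also have "\<dots> = (LINT x|lebesgue_on \<Omega>. d x * \<phi> x)"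
      using \<Omega> by (simp add: integral_restrict_space borel_open mult.assoc)
    finally show ?thesis using zero[OF \<phi>] by simp
  qed
  have box0: "(LINT x:box a b|lborel. g x) = 0" if "cbox a b \<subseteq> \<Omega>" for a b
  proof -
    have [measurable]: "box_bump a b n \<in> borel_measurable borel" for n
      by (rule borel_measurable_continuous_onI)
        (rule test_functions_continuous[OF box_bump_test_function[OF that]])
    have "(\<lambda>n. LINT x|lborel. g x * box_bump a b n x) \<longlonglongrightarrow> (LINT x|lborel. g x * indicator (box a b) x)"
    proof (rule integral_dominated_convergence[where w = "\<lambda>x. norm (g x)"])
      show "AE x in lborel. (\<lambda>n. g x * box_bump a b n x) \<longlonglongrightarrow> g x * indicator (box a b) x"
        by (intro AE_I2 tendsto_mult tendsto_const box_bump_tendsto_indicator)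
      show "AE x in lborel. norm (g x * box_bump a b n x) \<le> norm (g x)" for n
        using box_bump_bounds[of a b n] by (intro AE_I2) (simp add: abs_mult mult_left_le)
    qed (use g in simp_all)
    then have "(LINT x|lborel. g x * indicator (box a b) x) = 0"
      by (simp add: \<phi>0[OF box_bump_test_function[OF that]] LIMSEQ_const_iff)
    then show ?thesis by (simp add: set_lebesgue_integral_def mult.commute)
  qed
  have cbox0: "AE x in lebesgue. x \<in> cbox a b \<longrightarrow> g x = 0" if "cbox a b \<subseteq> \<Omega>" for a b
  proof -
    \<comment> \<open>Integrals over all boxes are required, also over those that leave \<Omega>.
      After cutting off by \<open>box a b\<close>, an arbitrary box only contributes through its
      intersection with it, again a box, whose closed box stays in \<Omega>.\<close>
    have "AE x in lborel. indicator (box a b) x * g x = 0"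
    proof (rule AE_zero_if_box_integrals_zero[of _ a b])
      have "integrable lborel (\<lambda>x. indicator (box a b) x *\<^sub>R g x)"
        by (rule integrable_mult_indicator[OF _ g]) simp
      then show "integrable lborel (\<lambda>x. indicator (box a b) x * g x)" by simp
      show "indicator (box a b) x * g x = 0" if "x \<notin> cbox a b" for x
      proof -
        have "x \<notin> box a b" using that box_subset_cbox by blast
        then show ?thesis by simp
      qed
      fix a' b'
      obtain p q where pq: "box a' b' \<inter> box a b = box p q" "cbox a' b' \<inter> cbox a b = cbox p q"
        unfolding box_Int_box Int_interval by blast
      from pq(2) that have "cbox p q \<subseteq> \<Omega>" by blast
      with pq(1) show "(LINT x:box a' b'|lborel. indicator (box a b) x * g x) = 0"
        using box0[of p q]
        by (simp add: set_lebesgue_integral_def indicator_inter_arith[symmetric] mult.assoc[symmetric])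
    qed
    then have "AE x in lebesgue. indicator (box a b) x * g x = 0"
      by (rule AE_completion)
    moreover have "AE x in lebesgue. x \<notin> cbox a b - box a b"
      using negligible_frontier_interval[of a b] by (intro AE_not_in) (simp add: negligible_iff_null_sets)
    ultimately show ?thesis
      by eventually_elim (auto simp: indicator_def)
  qed
  obtain D where D: "countable D" "D \<subseteq> Pow \<Omega>" "\<And>X. X \<in> D \<Longrightarrow> \<exists>a b. X = cbox a b" "\<Union>D = \<Omega>"
    using open_countable_Union_open_cbox[OF \<Omega>] by metis
  have "AE x in lebesgue. \<forall>X\<in>D. x \<in> X \<longrightarrow> g x = 0"
    unfolding AE_ball_countable[OF D(1)]
  proof
    fix X assume "X \<in> D"
    then obtain a b where X: "X = cbox a b" using D(3) by blast
    then have "cbox a b \<subseteq> \<Omega>" using \<open>X \<in> D\<close> D(2) by auto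
    then show "AE x in lebesgue. x \<in> X \<longrightarrow> g x = 0" unfolding X by (rule cbox0)
  qed
  then have "AE x in lebesgue. x \<in> \<Omega> \<longrightarrow> d x = 0"
    using dg
  proof eventually_elim
    case (elim x)
    show ?case
    proof
      assume "x \<in> \<Omega>"
      then obtain X where "X \<in> D" "x \<in> X" using D(4) by (metis UnionE)
      then have "g x = 0" using elim(1) by blast
      then show "d x = 0" using elim(2) \<open>x \<in> \<Omega>\<close> by simp
    qed
  qed
  then show ?thesis
    by (subst AE_restrict_space_iff) (use \<Omega> in simp_all)
qed

subsection \<open>The space $L^2$\<close>

text \<open>The quadratic is evaluated at its minimizer t = -b/c; if c = 0, a nonnegative affine
  function must be constant. It yields the Cauchy-Schwarz inequality and, later, the residual bound
  for almost minimizers of the energy.\<close>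

lemma quadratic_nonneg_imp_discriminant:
  fixes a b c :: real
  assumes nn: "\<And>t. 0 \<le> a + 2 * t * b + t\<^sup>2 * c" and "0 \<le> c"
  shows "b\<^sup>2 \<le> a * c"
proof (cases "c = 0")
  case True
  have "b = 0"
  proof (rule ccontr)
    assume "b \<noteq> 0"
    \<comment> \<open>The value of t is chosen so that the affine function equals -1 there.\<close>
    then have "a + 2 * (- (a + 1) / (2 * b)) * b = -1" by (simp add: field_simps)
    then show False using nn[of "- (a + 1) / (2 * b)"] True by simp
  qed
  then show ?thesis using True by simp
next
  case False
  then have "a + 2 * (- b / c) * b + (- b / c)\<^sup>2 * c = a - b\<^sup>2 / c"
    by (simp add: field_simps power2_eq_square)
  then have "b\<^sup>2 / c \<le> a" using nn[of "- b / c"] by simp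
  then show ?thesis using False \<open>0 \<le> c\<close> by (simp add: field_simps)
qed

definition L2_inner :: "'a::euclidean_space set \<Rightarrow> ('a \<Rightarrow> 'b::euclidean_space) \<Rightarrow> ('a \<Rightarrow> 'b) \<Rightarrow> real" where
  "L2_inner \<Omega> u v = (LINT x|lebesgue_on \<Omega>. u x \<bullet> v x)"

lemma L2_space_measurable: "u \<in> L2_space \<Omega> \<Longrightarrow> u \<in> borel_measurable (lebesgue_on \<Omega>)"
  by (simp add: L2_space_def)

lemma L2_integrable_inner:
  assumes u: "u \<in> L2_space \<Omega>" and v: "v \<in> L2_space \<Omega>"
  shows "integrable (lebesgue_on \<Omega>) (\<lambda>x. u x \<bullet> v x)"
proof (rule Bochner_Integration.integrable_bound)
  show "integrable (lebesgue_on \<Omega>) (\<lambda>x. (norm (u x))\<^sup>2 + (norm (v x))\<^sup>2)"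
    using u v by (auto simp: L2_space_def)
  show "(\<lambda>x. u x \<bullet> v x) \<in> borel_measurable (lebesgue_on \<Omega>)"
    by (intro borel_measurable_inner L2_space_measurable u v)
  have "\<bar>u x \<bullet> v x\<bar> \<le> (norm (u x))\<^sup>2 + (norm (v x))\<^sup>2" for x
  proof -
    have "\<bar>u x \<bullet> v x\<bar> \<le> norm (u x) * norm (v x)" by (rule Cauchy_Schwarz_ineq2)
    also have "\<dots> \<le> (norm (u x))\<^sup>2 + (norm (v x))\<^sup>2"
    proof -
      have "0 \<le> norm (u x) * norm (v x)" by simp
      then show ?thesis using sum_squares_bound[of "norm (u x)" "norm (v x)"] by linarith
    qed
    finally show ?thesis .
  qed
  then show "AE x in lebesgue_on \<Omega>. norm (u x \<bullet> v x) \<le> norm ((norm (u x))\<^sup>2 + (norm (v x))\<^sup>2)"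
    by (intro AE_I2) (simp add: abs_of_nonneg)
qed

lemma L2_spaceI:
  "u \<in> borel_measurable (lebesgue_on \<Omega>) \<Longrightarrow> integrable (lebesgue_on \<Omega>) (\<lambda>x. u x \<bullet> u x) \<Longrightarrow> u \<in> L2_space \<Omega>"
  by (simp add: L2_space_def dot_square_norm)

lemma L2_space_add:
  assumes "u \<in> L2_space \<Omega>" "v \<in> L2_space \<Omega>"
  shows "(\<lambda>x. u x + v x) \<in> L2_space \<Omega>"
proof (rule L2_spaceI)
  show "(\<lambda>x. u x + v x) \<in> borel_measurable (lebesgue_on \<Omega>)"
    using assms by (intro borel_measurable_add L2_space_measurable)
  have "integrable (lebesgue_on \<Omega>) (\<lambda>x. u x \<bullet> u x + v x \<bullet> v x + 2 * (u x \<bullet> v x))"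
    using assms by (intro Bochner_Integration.integrable_add integrable_mult_right L2_integrable_inner)
  then show "integrable (lebesgue_on \<Omega>) (\<lambda>x. (u x + v x) \<bullet> (u x + v x))"
    by (rule Bochner_Integration.integrable_cong[THEN iffD1, rotated 2])
      (auto simp: inner_add_left inner_add_right inner_commute)
qed

text \<open>The factor varies with x because the diffusion coefficient acts on gradients in this
  way.\<close>

lemma L2_space_bounded_scaleR:
  assumes u: "u \<in> L2_space \<Omega>" and c: "c \<in> borel_measurable (lebesgue_on \<Omega>)"
    "\<And>x. x \<in> \<Omega> \<Longrightarrow> \<bar>c x\<bar> \<le> B"
  shows "(\<lambda>x. c x *\<^sub>R u x) \<in> L2_space \<Omega>"
proof (rule L2_spaceI)
  show m: "(\<lambda>x. c x *\<^sub>R u x) \<in> borel_measurable (lebesgue_on \<Omega>)"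
    by (intro borel_measurable_scaleR c(1) L2_space_measurable[OF u])
  show "integrable (lebesgue_on \<Omega>) (\<lambda>x. c x *\<^sub>R u x \<bullet> c x *\<^sub>R u x)"
  proof (rule Bochner_Integration.integrable_bound)
    show "integrable (lebesgue_on \<Omega>) (\<lambda>x. B\<^sup>2 * (u x \<bullet> u x))"
      using u by (intro integrable_mult_right L2_integrable_inner)
    have "\<bar>c x *\<^sub>R u x \<bullet> c x *\<^sub>R u x\<bar> \<le> \<bar>B\<^sup>2 * (u x \<bullet> u x)\<bar>" if "x \<in> \<Omega>" for x
    proof -
      have "(c x)\<^sup>2 \<le> B\<^sup>2" using power_mono[OF c(2)[OF that], of 2] by simp
      then have "(c x)\<^sup>2 * (u x \<bullet> u x) \<le> B\<^sup>2 * (u x \<bullet> u x)" by (rule mult_right_mono) simp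
      moreover have "c x *\<^sub>R u x \<bullet> c x *\<^sub>R u x = (c x)\<^sup>2 * (u x \<bullet> u x)"
        by (simp add: power2_eq_square)
      moreover have "0 \<le> (c x)\<^sup>2 * (u x \<bullet> u x)" by simp
      ultimately show ?thesis by linarith
    qed
    then show "AE x in lebesgue_on \<Omega>. norm (c x *\<^sub>R u x \<bullet> c x *\<^sub>R u x) \<le> norm (B\<^sup>2 * (u x \<bullet> u x))"
      by (intro AE_I2) simp
  qed (intro borel_measurable_inner m)
qed

lemma L2_space_scaleR: "u \<in> L2_space \<Omega> \<Longrightarrow> (\<lambda>x. c *\<^sub>R u x) \<in> L2_space \<Omega>"
  by (rule L2_space_bounded_scaleR[of _ _ _ "\<bar>c\<bar>"]) auto

lemma L2_space_cmult: "u \<in> L2_space \<Omega> \<Longrightarrow> (\<lambda>x. c * u x) \<in> L2_space \<Omega>" for c :: real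
  using L2_space_scaleR[of u \<Omega> c] by simp

lemma L2_space_diff:
  assumes "u \<in> L2_space \<Omega>" "v \<in> L2_space \<Omega>"
  shows "(\<lambda>x. u x - v x) \<in> L2_space \<Omega>"
  using L2_space_add[OF assms(1) L2_space_scaleR[OF assms(2), of "-1"]] by simp

lemma L2_space_minus: "u \<in> L2_space \<Omega> \<Longrightarrow> (\<lambda>x. - u x) \<in> L2_space \<Omega>"
  using L2_space_scaleR[of u \<Omega> "-1"] by simp

lemmas L2_space_intros =
  L2_space_add L2_space_scaleR L2_space_cmult L2_space_diff L2_space_minus

lemma L2_inner_commute: "L2_inner \<Omega> u v = L2_inner \<Omega> v u"
  by (simp add: L2_inner_def inner_commute)

lemma L2_inner_add_left:
  "u \<in> L2_space \<Omega> \<Longrightarrow> v \<in> L2_space \<Omega> \<Longrightarrow> w \<in> L2_space \<Omega> \<Longrightarrow>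
    L2_inner \<Omega> (\<lambda>x. u x + v x) w = L2_inner \<Omega> u w + L2_inner \<Omega> v w"
  by (simp add: L2_inner_def inner_add_left L2_integrable_inner)

lemma L2_inner_diff_left:
  "u \<in> L2_space \<Omega> \<Longrightarrow> v \<in> L2_space \<Omega> \<Longrightarrow> w \<in> L2_space \<Omega> \<Longrightarrow>
    L2_inner \<Omega> (\<lambda>x. u x - v x) w = L2_inner \<Omega> u w - L2_inner \<Omega> v w"
  by (simp add: L2_inner_def inner_diff_left L2_integrable_inner)

lemma L2_inner_scaleR_left: "L2_inner \<Omega> (\<lambda>x. c *\<^sub>R u x) w = c * L2_inner \<Omega> u w"
  by (simp add: L2_inner_def)

lemma L2_inner_cmult_left: "L2_inner \<Omega> (\<lambda>x. c * u x) w = c * L2_inner \<Omega> u w" for c :: real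
  using L2_inner_scaleR_left[of \<Omega> c u w] by simp

lemma L2_inner_add_right:
  "u \<in> L2_space \<Omega> \<Longrightarrow> v \<in> L2_space \<Omega> \<Longrightarrow> w \<in> L2_space \<Omega> \<Longrightarrow>
    L2_inner \<Omega> w (\<lambda>x. u x + v x) = L2_inner \<Omega> w u + L2_inner \<Omega> w v"
  by (simp add: L2_inner_def inner_add_right L2_integrable_inner)

lemma L2_inner_diff_right:
  "u \<in> L2_space \<Omega> \<Longrightarrow> v \<in> L2_space \<Omega> \<Longrightarrow> w \<in> L2_space \<Omega> \<Longrightarrow>
    L2_inner \<Omega> w (\<lambda>x. u x - v x) = L2_inner \<Omega> w u - L2_inner \<Omega> w v"
  by (simp add: L2_inner_def inner_diff_right L2_integrable_inner)

lemma L2_inner_scaleR_right: "L2_inner \<Omega> w (\<lambda>x. c *\<^sub>R u x) = c * L2_inner \<Omega> w u"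
  by (simp add: L2_inner_def)

lemma L2_inner_cmult_right: "L2_inner \<Omega> w (\<lambda>x. c * u x) = c * L2_inner \<Omega> w u" for c :: real
  using L2_inner_scaleR_right[of \<Omega> w c u] by simp

lemmas L2_inner_simps =
  L2_inner_add_left L2_inner_diff_left L2_inner_scaleR_left L2_inner_cmult_left
  L2_inner_add_right L2_inner_diff_right L2_inner_scaleR_right L2_inner_cmult_right

lemma L2_inner_cong_AE:
  assumes "u \<in> L2_space \<Omega>" "u' \<in> L2_space \<Omega>" "v \<in> L2_space \<Omega>" "v' \<in> L2_space \<Omega>"
    and "AE x in lebesgue_on \<Omega>. u x = u' x" "AE x in lebesgue_on \<Omega>. v x = v' x"
  shows "L2_inner \<Omega> u v = L2_inner \<Omega> u' v'"
  unfolding L2_inner_def using assms(5,6)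
  by (intro integral_cong_AE borel_measurable_inner L2_space_measurable assms(1-4)) auto

lemma L2_norm_nonneg [simp]: "0 \<le> L2_norm \<Omega> u"
  by (simp add: L2_norm_def)

lemma L2_norm_square: "(L2_norm \<Omega> u)\<^sup>2 = L2_inner \<Omega> u u"
  by (simp add: L2_norm_def L2_inner_def dot_square_norm)

lemma L2_inner_self_nonneg [simp]: "0 \<le> L2_inner \<Omega> u u"
  using L2_norm_square[of \<Omega> u] by (metis zero_le_power2)

lemma L2_norm_minus_commute: "L2_norm \<Omega> (\<lambda>x. u x - v x) = L2_norm \<Omega> (\<lambda>x. v x - u x)"
  by (simp add: L2_norm_def norm_minus_commute)

lemma L2_Cauchy_Schwarz:
  assumes u: "u \<in> L2_space \<Omega>" and v: "v \<in> L2_space \<Omega>"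
  shows "\<bar>L2_inner \<Omega> u v\<bar> \<le> L2_norm \<Omega> u * L2_norm \<Omega> v"
proof -
  have "(L2_inner \<Omega> u v)\<^sup>2 \<le> L2_inner \<Omega> u u * L2_inner \<Omega> v v"
  proof (rule quadratic_nonneg_imp_discriminant)
    fix t :: real
    have "L2_inner \<Omega> (\<lambda>x. u x + t *\<^sub>R v x) (\<lambda>x. u x + t *\<^sub>R v x)
        = L2_inner \<Omega> u u + 2 * t * L2_inner \<Omega> u v + t\<^sup>2 * L2_inner \<Omega> v v"
      using u v by (simp add: L2_inner_simps L2_space_intros L2_inner_commute[of \<Omega> v u]
          power2_eq_square algebra_simps)
    then show "0 \<le> L2_inner \<Omega> u u + 2 * t * L2_inner \<Omega> u v + t\<^sup>2 * L2_inner \<Omega> v v"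
      by (metis L2_inner_self_nonneg)
  qed simp
  then have "\<bar>L2_inner \<Omega> u v\<bar>\<^sup>2 \<le> (L2_norm \<Omega> u * L2_norm \<Omega> v)\<^sup>2"
    by (simp add: L2_norm_square power_mult_distrib)
  then show ?thesis by (rule power2_le_imp_le) simp
qed

lemma L2_norm_triangle:
  assumes u: "u \<in> L2_space \<Omega>" and v: "v \<in> L2_space \<Omega>"
  shows "L2_norm \<Omega> (\<lambda>x. u x + v x) \<le> L2_norm \<Omega> u + L2_norm \<Omega> v"
proof (rule power2_le_imp_le)
  have "(L2_norm \<Omega> (\<lambda>x. u x + v x))\<^sup>2 = (L2_norm \<Omega> u)\<^sup>2 + 2 * L2_inner \<Omega> u v + (L2_norm \<Omega> v)\<^sup>2"
    using u v by (simp add: L2_norm_square L2_inner_simps L2_space_intros L2_inner_commute[of \<Omega> v u])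
  also have "\<dots> \<le> (L2_norm \<Omega> u + L2_norm \<Omega> v)\<^sup>2"
    using L2_Cauchy_Schwarz[OF u v] by (simp add: power2_sum)
  finally show "(L2_norm \<Omega> (\<lambda>x. u x + v x))\<^sup>2 \<le> (L2_norm \<Omega> u + L2_norm \<Omega> v)\<^sup>2" .
qed simp

lemma L2_norm_scaleR: "L2_norm \<Omega> (\<lambda>x. c *\<^sub>R u x) = \<bar>c\<bar> * L2_norm \<Omega> u"
  by (simp add: L2_norm_def power_mult_distrib real_sqrt_mult)

lemma L2_norm_cong_AE:
  assumes "u \<in> L2_space \<Omega>" "v \<in> L2_space \<Omega>" "AE x in lebesgue_on \<Omega>. u x = v x"
  shows "L2_norm \<Omega> u = L2_norm \<Omega> v"
  using L2_inner_cong_AE[OF assms(1,2) assms(1,2) assms(3,3)]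
  by (metis L2_norm_nonneg L2_norm_square power2_eq_iff_nonneg)

lemma L2_norm_eq_0_AE:
  assumes "u \<in> L2_space \<Omega>" "AE x in lebesgue_on \<Omega>. u x = 0"
  shows "L2_norm \<Omega> u = 0"
  using L2_norm_cong_AE[OF assms(1) L2_space_scaleR[OF assms(1), of 0]] assms(2)
  by (simp add: L2_norm_def)

lemma L2_inner_self_eq_0_imp_AE:
  assumes u: "u \<in> L2_space \<Omega>" and "L2_inner \<Omega> u u = 0"
  shows "AE x in lebesgue_on \<Omega>. u x = 0"
  using assms integral_nonneg_eq_0_iff_AE[OF L2_integrable_inner[OF u u]]
  by (simp add: L2_inner_def)

section \<open>Limits in L2 and completeness\<close>

lemma L2_inner_tendsto:
  assumes u: "\<And>n. u n \<in> L2_space \<Omega>" "u' \<in> L2_space \<Omega>" and v: "v \<in> L2_space \<Omega>"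
    and lim: "(\<lambda>n. L2_norm \<Omega> (\<lambda>x. u n x - u' x)) \<longlonglongrightarrow> 0"
  shows "(\<lambda>n. L2_inner \<Omega> (u n) v) \<longlonglongrightarrow> L2_inner \<Omega> u' v"
proof (rule LIM_zero_cancel, rule Lim_null_comparison)
  show "\<forall>\<^sub>F n in sequentially. norm (L2_inner \<Omega> (u n) v - L2_inner \<Omega> u' v)
      \<le> L2_norm \<Omega> (\<lambda>x. u n x - u' x) * L2_norm \<Omega> v"
    using L2_Cauchy_Schwarz[OF L2_space_diff[OF u(1) u(2)] v] u v
    by (simp add: L2_inner_diff_left)
  show "(\<lambda>n. L2_norm \<Omega> (\<lambda>x. u n x - u' x) * L2_norm \<Omega> v) \<longlonglongrightarrow> 0"
    using tendsto_mult_right[OF lim, of "L2_norm \<Omega> v"] by simp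
qed

text \<open>Fatou's lemma delivers its bound as a nonnegative integral, before integrability of the
  limit is known; membership in L2 and the norm bound are both read off from it.\<close>

lemma L2_norm_le_nn_integral:
  assumes m: "w \<in> borel_measurable (lebesgue_on \<Omega>)" and "0 \<le> e"
    and le: "(\<integral>\<^sup>+x. ennreal ((norm (w x))\<^sup>2) \<partial>lebesgue_on \<Omega>) \<le> ennreal (e\<^sup>2)"
  shows "w \<in> L2_space \<Omega>" "L2_norm \<Omega> w \<le> e"
proof -
  have int: "integrable (lebesgue_on \<Omega>) (\<lambda>x. (norm (w x))\<^sup>2)"
    using m le by (intro integrableI_bounded) (auto simp: le_less_trans)
  then show "w \<in> L2_space \<Omega>" using m by (simp add: L2_space_def)
  have "ennreal (LINT x|lebesgue_on \<Omega>. (norm (w x))\<^sup>2) \<le> ennreal (e\<^sup>2)"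
    using le nn_integral_eq_integral[OF int] by simp
  then have "(LINT x|lebesgue_on \<Omega>. (norm (w x))\<^sup>2) \<le> e\<^sup>2" by simp
  then show "L2_norm \<Omega> w \<le> e" unfolding L2_norm_def by (rule real_le_lsqrt[OF \<open>0 \<le> e\<close>])
qed

text \<open>On a set of finite measure, Cauchy-Schwarz against the constant 1 turns the L2 bounds on
  the increments into L1 bounds. These are summable, so the sum of the increments is finite almost
  everywhere and the telescoping series converges absolutely there.\<close>

lemma L2_fast_Cauchy_AE_convergent:
  fixes v :: "nat \<Rightarrow> 'a::euclidean_space \<Rightarrow> 'b::euclidean_space"
  assumes \<Omega>: "\<Omega> \<in> lmeasurable" and v: "\<And>n. v n \<in> L2_space \<Omega>"
    and fast: "\<And>n. L2_norm \<Omega> (\<lambda>x. v (Suc n) x - v n x) \<le> (1 / 2) ^ n"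
  shows "AE x in lebesgue_on \<Omega>. convergent (\<lambda>n. v n x)"
proof -
  let ?M = "lebesgue_on \<Omega>"
  interpret finite_measure ?M using \<Omega> by (rule finite_measure_lebesgue_on)
  define C where "C = L2_norm \<Omega> (\<lambda>x. 1 :: real)"
  have one: "(\<lambda>x. 1 :: real) \<in> L2_space \<Omega>" by (simp add: L2_space_def)
  let ?d = "\<lambda>n x. norm (v (Suc n) x - v n x)"
  have d: "?d n \<in> L2_space \<Omega>" for n
    using L2_space_diff[OF v v, of "Suc n" n] by (auto simp: L2_space_def)
  have int: "integrable ?M (?d n)" for n
    using L2_integrable_inner[OF d one, of n] by simp
  have bound: "(LINT x|?M. ?d n x) \<le> (1 / 2) ^ n * C" for n
  proof -
    have "(LINT x|?M. ?d n x) = L2_inner \<Omega> (?d n) (\<lambda>x. 1)" by (simp add: L2_inner_def)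
    also have "\<dots> \<le> L2_norm \<Omega> (?d n) * C"
      using L2_Cauchy_Schwarz[OF d one, of n] unfolding C_def by linarith
    also have "L2_norm \<Omega> (?d n) = L2_norm \<Omega> (\<lambda>x. v (Suc n) x - v n x)" by (simp add: L2_norm_def)
    also have "\<dots> * C \<le> (1 / 2) ^ n * C" by (intro mult_right_mono fast) (simp add: C_def)
    finally show ?thesis .
  qed
  have [measurable]: "?d n \<in> borel_measurable ?M" for n using d by (rule L2_space_measurable)
  have "(\<integral>\<^sup>+x. (\<Sum>n. ennreal (?d n x)) \<partial>?M) = (\<Sum>n. \<integral>\<^sup>+x. ennreal (?d n x) \<partial>?M)"
    by (rule nn_integral_suminf) measurable
  also have "\<dots> = (\<Sum>n. ennreal (LINT x|?M. ?d n x))"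
    by (simp add: nn_integral_eq_integral[OF int])
  also have "\<dots> \<le> (\<Sum>n. ennreal ((1 / 2) ^ n * C))"
    by (intro suminf_le ennreal_leI bound) auto
  also have "\<dots> < \<infinity>"
  proof -
    have "summable (\<lambda>n. (1 / 2) ^ n * C)" by (intro summable_mult2 summable_geometric) simp
    then show ?thesis by (simp add: suminf_ennreal2 C_def less_top[symmetric])
  qed
  finally have "AE x in ?M. (\<Sum>n. ennreal (?d n x)) \<noteq> \<infinity>"
    by (intro nn_integral_noteq_infinite) (auto simp: top_unique)
  then show ?thesis
  proof eventually_elim
    case (elim x)
    then have "summable (\<lambda>n. ?d n x)" by (intro summable_suminf_not_top) auto
    then have "summable (\<lambda>n. v (Suc n) x - v n x)" by (rule summable_norm_cancel)
    then have "convergent (\<lambda>n. \<Sum>i<n. v (Suc i) x - v i x)" by (simp add: summable_iff_convergent)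
    then have "convergent (\<lambda>n. v n x - v 0 x)" by (simp only: sum_lessThan_telescope[of "\<lambda>n. v n x"])
    from convergent_add[OF this convergent_const[of "v 0 x"]] show ?case by simp
  qed
qed

text \<open>Riesz-Fischer: a subsequence with geometrically small increments converges almost
  everywhere, and Fatou's lemma bounds the distance of its limit to the original sequence.\<close>

theorem L2_complete:
  fixes u :: "nat \<Rightarrow> 'a::euclidean_space \<Rightarrow> 'b::euclidean_space"
  assumes \<Omega>: "\<Omega> \<in> lmeasurable" and u: "\<And>n. u n \<in> L2_space \<Omega>"
    and Cauchy: "\<And>e. 0 < e \<Longrightarrow> \<exists>N. \<forall>m\<ge>N. \<forall>n\<ge>N. L2_norm \<Omega> (\<lambda>x. u m x - u n x) \<le> e"
  obtains w where "w \<in> L2_space \<Omega>" "(\<lambda>n. L2_norm \<Omega> (\<lambda>x. u n x - w x)) \<longlonglongrightarrow> 0"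
proof -
  let ?M = "lebesgue_on \<Omega>"
  have "\<forall>k. \<exists>N. \<forall>m\<ge>N. \<forall>n\<ge>N. L2_norm \<Omega> (\<lambda>x. u m x - u n x) \<le> (1 / 2) ^ k"
    by (intro allI Cauchy) simp
  then obtain N where N: "\<And>k m n. N k \<le> m \<Longrightarrow> N k \<le> n \<Longrightarrow> L2_norm \<Omega> (\<lambda>x. u m x - u n x) \<le> (1 / 2) ^ k"
    by metis
  \<comment> \<open>The partial sums dominate each earlier threshold \<open>N j\<close>, so
    consecutive indices \<open>r n\<close> and \<open>r (Suc n)\<close> both lie beyond
    \<open>N n\<close>.\<close>
  define r where "r k = (\<Sum>i\<le>k. N i)" for k
  have r: "N j \<le> r k" if "j \<le> k" for j k
    unfolding r_def using that by (intro member_le_sum) auto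
  define v where "v k = u (r k)" for k
  have vm [measurable]: "v k \<in> borel_measurable ?M" for k
    unfolding v_def using u by (rule L2_space_measurable)
  have um [measurable]: "u k \<in> borel_measurable ?M" for k
    using u by (rule L2_space_measurable)
  \<comment> \<open>Where the sequence diverges, \<open>lim\<close> has an arbitrary value, but
    \<open>w\<close> is measurable all the same.\<close>
  define w where "w x = lim (\<lambda>k. v k x)" for x
  have wm [measurable]: "w \<in> borel_measurable ?M"
    unfolding w_def by (rule borel_measurable_lim_metric) measurable
  have "AE x in ?M. convergent (\<lambda>n. v n x)"
    by (rule L2_fast_Cauchy_AE_convergent[OF \<Omega>]) (auto simp: v_def intro!: u N r)
  then have conv: "AE x in ?M. (\<lambda>n. v n x) \<longlonglongrightarrow> w x"
    by eventually_elim (simp add: w_def convergent_LIMSEQ_iff)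
  \<comment> \<open>Almost everywhere the integrand for \<open>w\<close> is the limit over k of
    those for \<open>v k\<close>, so Fatou's lemma applies with \<open>m\<close> fixed. The bound
    covers every late index \<open>m\<close>, not only those of the subsequence.\<close>
  have tail: "(\<lambda>x. w x - u m x) \<in> L2_space \<Omega>" "L2_norm \<Omega> (\<lambda>x. w x - u m x) \<le> (1 / 2) ^ j"
    if m: "N j \<le> m" for m j
  proof -
    let ?f = "\<lambda>k x. ennreal ((norm (v k x - u m x))\<^sup>2)"
    have "(\<integral>\<^sup>+x. ennreal ((norm (w x - u m x))\<^sup>2) \<partial>?M) = (\<integral>\<^sup>+x. liminf (\<lambda>k. ?f k x) \<partial>?M)"
      using conv
    proof (intro nn_integral_cong_AE, eventually_elim)
      case (elim x)
      have "(\<lambda>k. ?f k x) \<longlonglongrightarrow> ennreal ((norm (w x - u m x))\<^sup>2)"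
        by (intro tendsto_intros elim)
      from lim_imp_Liminf[OF _ this] show ?case by simp
    qed
    also have "\<dots> \<le> liminf (\<lambda>k. \<integral>\<^sup>+x. ?f k x \<partial>?M)"
      by (rule nn_integral_liminf) measurable
    also have "\<dots> \<le> ennreal (((1 / 2) ^ j)\<^sup>2)"
    proof (rule Liminf_le)
      have "(\<integral>\<^sup>+x. ?f k x \<partial>?M) \<le> ennreal (((1 / 2) ^ j)\<^sup>2)" if k: "j \<le> k" for k
      proof -
        have "integrable ?M (\<lambda>x. (norm (v k x - u m x))\<^sup>2)"
          using L2_space_diff[OF u u, of "r k" m] by (simp add: L2_space_def v_def)
        then have "(\<integral>\<^sup>+x. ?f k x \<partial>?M) = ennreal ((L2_norm \<Omega> (\<lambda>x. v k x - u m x))\<^sup>2)"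
          by (subst nn_integral_eq_integral) (auto simp: L2_norm_def)
        also have "\<dots> \<le> ennreal (((1 / 2) ^ j)\<^sup>2)"
          unfolding v_def by (intro ennreal_leI power_mono N r k m L2_norm_nonneg)
        finally show ?thesis .
      qed
      then show "\<forall>\<^sub>F k in sequentially. (\<integral>\<^sup>+x. ?f k x \<partial>?M) \<le> ennreal (((1 / 2) ^ j)\<^sup>2)"
        by (intro eventually_sequentiallyI)
    qed simp
    finally show "(\<lambda>x. w x - u m x) \<in> L2_space \<Omega>" "L2_norm \<Omega> (\<lambda>x. w x - u m x) \<le> (1 / 2) ^ j"
      by (intro L2_norm_le_nn_integral; simp)+
  qed
  show thesis
  proof
    show "w \<in> L2_space \<Omega>"
      using L2_space_add[OF tail(1)[OF order_refl, of 0] u[of "N 0"]] by simp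
    show "(\<lambda>n. L2_norm \<Omega> (\<lambda>x. u n x - w x)) \<longlonglongrightarrow> 0"
    proof (rule LIMSEQ_I)
      fix e :: real assume "0 < e"
      then obtain j where "(1 / 2) ^ j < e" using real_arch_pow_inv[of e "1 / 2"] by auto
      then show "\<exists>n0. \<forall>n\<ge>n0. norm (L2_norm \<Omega> (\<lambda>x. u n x - w x) - 0) < e"
        using tail(2)[of j] by (intro exI[of _ "N j"])
          (auto simp: L2_norm_minus_commute[of \<Omega> w] intro: le_less_trans)
    qed
  qed
qed

subsection \<open>Test functions, weak derivatives and $H^1_0$\<close>

lemma frechet_derivative_eq_inner_classical_grad:
  assumes "\<phi> differentiable (at x)"
  shows "frechet_derivative \<phi> (at x) h = classical_grad \<phi> x \<bullet> h"
proof -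
  interpret linear "frechet_derivative \<phi> (at x)"
    by (rule linear_frechet_derivative[OF assms])
  have "frechet_derivative \<phi> (at x) h = frechet_derivative \<phi> (at x) (\<Sum>i\<in>Basis. (h \<bullet> i) *\<^sub>R i)"
    by (simp add: euclidean_representation)
  also have "\<dots> = (\<Sum>i\<in>Basis. (h \<bullet> i) * frechet_derivative \<phi> (at x) i)"
    by (simp add: sum scaleR)
  also have "\<dots> = classical_grad \<phi> x \<bullet> h"
    by (simp add: classical_grad_def inner_sum_left inner_commute[of h] mult.commute)
  finally show ?thesis .
qed

lemma classical_grad_eqI:
  assumes "(\<phi> has_derivative (\<lambda>h. g \<bullet> h)) (at x)"
  shows "classical_grad \<phi> x = g"
  unfolding classical_grad_def frechet_derivative_at[OF assms, symmetric]
  by (rule euclidean_representation)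

lemma test_functions_differentiable: "\<phi> \<in> test_functions \<Omega> \<Longrightarrow> \<phi> differentiable (at x)"
  by (auto simp: test_functions_def differentiable_on_def dest: spec[of _ "Suc 0"])

lemma test_functions_has_derivative:
  assumes "\<phi> \<in> test_functions \<Omega>"
  shows "(\<phi> has_derivative (\<lambda>h. classical_grad \<phi> x \<bullet> h)) (at x)"
proof -
  note d = test_functions_differentiable[OF assms, of x]
  have "frechet_derivative \<phi> (at x) = (\<lambda>h. classical_grad \<phi> x \<bullet> h)"
    using frechet_derivative_eq_inner_classical_grad[OF d] by (rule ext)
  then show ?thesis using d frechet_derivative_works by metis
qed

lemma test_functions_continuous_grad:
  assumes "\<phi> \<in> test_functions \<Omega>"
  shows "continuous_on UNIV (classical_grad \<phi>)"
proof -
  have "C_diff (Suc 0) \<phi>" using assms by (simp add: test_functions_def)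
  then have "continuous_on UNIV (\<lambda>x. \<Sum>i\<in>Basis. frechet_derivative \<phi> (at x) i *\<^sub>R i)"
    by (intro continuous_intros) auto
  then show ?thesis by (simp add: classical_grad_def[abs_def])
qed

text \<open>This one form serves both the differences, with c = -1, and the variations along which
  the energy is expanded.\<close>

lemma test_functions_lincomb:
  assumes "\<phi> \<in> test_functions \<Omega>" "\<psi> \<in> test_functions \<Omega>"
  shows "(\<lambda>x. \<phi> x + c * \<psi> x) \<in> test_functions \<Omega>"
proof (rule test_functionsI)
  show "compact (closure {x. \<phi> x \<noteq> 0} \<union> closure {x. \<psi> x \<noteq> 0})"
    "closure {x. \<phi> x \<noteq> 0} \<union> closure {x. \<psi> x \<noteq> 0} \<subseteq> \<Omega>"
    using assms by (auto simp: test_functions_def)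
  show "C_diff k (\<lambda>x. \<phi> x + c * \<psi> x)" for k
    using assms by (intro C_diff_add C_diff_mult C_diff_const) (auto simp: test_functions_def)
  fix x assume x: "x \<notin> closure {x. \<phi> x \<noteq> 0} \<union> closure {x. \<psi> x \<noteq> 0}"
  then have "x \<notin> {x. \<phi> x \<noteq> 0}" "x \<notin> {x. \<psi> x \<noteq> 0}"
    using closure_subset by (meson UnI1 UnI2 subsetD)+
  then show "\<phi> x + c * \<psi> x = 0" by simp
qed

lemma classical_grad_lincomb:
  assumes "\<phi> \<in> test_functions \<Omega>" "\<psi> \<in> test_functions \<Omega>"
  shows "classical_grad (\<lambda>x. \<phi> x + c * \<psi> x) x = classical_grad \<phi> x + c *\<^sub>R classical_grad \<psi> x"
proof (rule classical_grad_eqI)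
  have "((\<lambda>x. \<phi> x + c * \<psi> x) has_derivative
      (\<lambda>h. classical_grad \<phi> x \<bullet> h + c * (classical_grad \<psi> x \<bullet> h))) (at x)"
    by (intro has_derivative_add has_derivative_mult_right test_functions_has_derivative[OF assms(1)]
        test_functions_has_derivative[OF assms(2)])
  then show "((\<lambda>x. \<phi> x + c * \<psi> x) has_derivative
      (\<lambda>h. (classical_grad \<phi> x + c *\<^sub>R classical_grad \<psi> x) \<bullet> h)) (at x)"
    by (simp add: inner_add_left)
qed

section \<open>Integrals of derivatives of compactly supported functions\<close>

lemma continuous_compact_support_integrable:
  fixes f :: "'a::euclidean_space \<Rightarrow> real"
  assumes "compact K" "\<And>x. x \<notin> K \<Longrightarrow> f x = 0" "continuous_on UNIV f"
  shows "integrable lborel f"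
proof -
  have "integrable lborel (\<lambda>x. indicator K x *\<^sub>R f x)"
    using assms by (intro borel_integrable_compact) (auto intro: continuous_on_subset)
  moreover have "(\<lambda>x. indicator K x *\<^sub>R f x) = f"
    using assms(2) by (fastforce simp: indicator_def)
  ultimately show ?thesis by simp
qed

lemma lborel_integral_translate:
  fixes f :: "'a::euclidean_space \<Rightarrow> real"
  assumes "f \<in> borel_measurable borel"
  shows "(LINT x|lborel. f (c + x)) = (LINT x|lborel. f x)"
  using integral_distr[of "(+) c" lborel borel f] assms by (simp add: lborel_distr_plus)

text \<open>Difference quotients have integral zero by translation invariance, and they converge
  boundedly to the directional derivative.\<close>

lemma integral_directional_derivative_eq_0:
  fixes f :: "'a::euclidean_space \<Rightarrow> real"
  assumes K: "compact K" and supp: "\<And>x. x \<notin> K \<Longrightarrow> f x = 0"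
    and der: "\<And>x. (f has_derivative (\<lambda>h. G x \<bullet> h)) (at x)" and G: "continuous_on UNIV G"
  shows "(LINT x|lborel. G x \<bullet> e) = 0"
proof -
  have contf: "continuous_on UNIV f"
    by (intro continuous_at_imp_continuous_on ballI has_derivative_continuous[OF der])
  have [measurable]: "f \<in> borel_measurable borel" "G \<in> borel_measurable borel"
    using contf G by (auto intro: borel_measurable_continuous_onI)
  have intf: "integrable lborel f"
    by (rule continuous_compact_support_integrable[OF K supp contf])
  obtain R where R: "\<And>x. x \<in> K \<Longrightarrow> norm x \<le> R"
    using compact_imp_bounded[OF K] by (auto simp: bounded_iff)
  \<comment> \<open>As the steps \<open>h n\<close> are at most 1, a difference quotient can be
    nonzero only at points of \<open>?T\<close>. From such a point the segment to the shifted point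
    stays in the convex set \<open>?S\<close>, where the mean value inequality with the bound
    \<open>B\<close> on the gradient applies.\<close>
  let ?S = "cball (0::'a) (R + 2 * norm e)" and ?T = "cball (0::'a) (R + norm e)"
  have "bounded (G ` ?S)"
    by (intro compact_imp_bounded compact_continuous_image continuous_on_subset[OF G]) auto
  then obtain B where "0 < B" "\<forall>y\<in>G ` ?S. norm y \<le> B"
    unfolding bounded_pos by blast
  then have B: "\<And>x. x \<in> ?S \<Longrightarrow> norm (G x) \<le> B" "0 \<le> B" by auto
  define h where "h n = inverse (real (Suc n))" for n
  have h: "0 < h n" "h n \<le> 1" for n by (auto simp: h_def inverse_le_1_iff)
  define F where "F n x = (f (h n *\<^sub>R e + x) - f x) / h n" for n x
  have F0: "(LINT x|lborel. F n x) = 0" for n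
  proof -
    have "integrable lborel (\<lambda>x. f (h n *\<^sub>R e + x))"
    proof -
      have "integrable (distr lborel borel ((+) (h n *\<^sub>R e))) f"
        using intf by (simp add: lborel_distr_plus)
      then show ?thesis by (subst (asm) integrable_distr_eq) auto
    qed
    then show ?thesis
      using intf lborel_integral_translate[of f "h n *\<^sub>R e"] by (simp add: F_def)
  qed
  have "(\<lambda>n. LINT x|lborel. F n x) \<longlonglongrightarrow> (LINT x|lborel. G x \<bullet> e)"
  proof (rule integral_dominated_convergence[where w = "\<lambda>x. indicator ?T x *\<^sub>R (B * norm e)"])
    show "integrable lborel (\<lambda>x. indicator ?T x *\<^sub>R (B * norm e))"
      by (intro borel_integrable_compact) auto
    have "(\<lambda>n. F n x) \<longlonglongrightarrow> G x \<bullet> e" for x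
    proof -
      have "((\<lambda>t. f (t *\<^sub>R e + x)) has_real_derivative G x \<bullet> e) (at 0)"
      proof -
        have "((\<lambda>t::real. t *\<^sub>R e + x) has_derivative (\<lambda>t. t *\<^sub>R e)) (at 0)"
          by (auto intro!: derivative_eq_intros)
        from has_derivative_compose[OF this, of f "\<lambda>h. G x \<bullet> h"] der[of x] show ?thesis
          by (simp add: has_field_derivative_def mult_commute_abs)
      qed
      then have "((\<lambda>t. (f (t *\<^sub>R e + x) - f x) / t) \<longlongrightarrow> G x \<bullet> e) (at 0)"
        by (simp add: DERIV_def)
      moreover have "filterlim h (at 0) sequentially"
        unfolding h_def using LIMSEQ_inverse_real_of_nat by (intro filterlim_atI) auto
      ultimately show ?thesis unfolding F_def by (rule filterlim_compose)
    qed
    then show "AE x in lborel. (\<lambda>n. F n x) \<longlonglongrightarrow> G x \<bullet> e" by simp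
    have "norm (F n x) \<le> indicator ?T x *\<^sub>R (B * norm e)" for n x
    proof (cases "x \<in> ?T")
      case True
      have he: "norm (h n *\<^sub>R e) \<le> norm e"
        using h[of n] by (simp add: mult_left_le_one_le)
      have "norm (f (h n *\<^sub>R e + x) - f x) \<le> B * norm ((h n *\<^sub>R e + x) - x)"
      proof (rule differentiable_bound[of ?S])
        show "(f has_derivative (\<lambda>h. G y \<bullet> h)) (at y within ?S)" for y
          using der has_derivative_at_withinI by blast
        show "onorm (\<lambda>h. G y \<bullet> h) \<le> B" if "y \<in> ?S" for y
        proof (rule onorm_bound[OF B(2)])
          fix k
          have "norm (G y \<bullet> k) \<le> norm (G y) * norm k" by (simp add: Cauchy_Schwarz_ineq2)
          also have "\<dots> \<le> B * norm k" by (intro mult_right_mono B that) simp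
          finally show "norm (G y \<bullet> k) \<le> B * norm k" .
        qed
        have nx: "norm x \<le> R + norm e" using True by simp
        then have "norm (h n *\<^sub>R e + x) \<le> R + 2 * norm e"
          using norm_triangle_ineq[of "h n *\<^sub>R e" x] he by linarith
        then show "h n *\<^sub>R e + x \<in> ?S" by simp
        have "norm x \<le> R + 2 * norm e" using nx norm_ge_zero[of e] by linarith
        then show "x \<in> ?S" by simp
      qed simp
      then have "\<bar>f (h n *\<^sub>R e + x) - f x\<bar> \<le> h n * (B * norm e)"
        using h[of n] by (simp add: mult.left_commute)
      then have "\<bar>f (h n *\<^sub>R e + x) - f x\<bar> / h n \<le> B * norm e"
        using h(1)[of n] by (simp add: divide_le_eq mult.commute)
      then show ?thesis using True h(1)[of n] by (simp add: F_def)
    next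
      case False
      then have x: "norm x > R + norm e" by simp
      have "norm (h n *\<^sub>R e) \<le> norm e"
        using h[of n] by (simp add: mult_left_le_one_le)
      moreover have "norm x \<le> norm (h n *\<^sub>R e + x) + norm (h n *\<^sub>R e)"
        using norm_triangle_ineq4[of "h n *\<^sub>R e + x" "h n *\<^sub>R e"] by simp
      ultimately have "norm (h n *\<^sub>R e + x) > R" "norm x > R"
        using x norm_ge_zero[of e] by linarith+
      then have "h n *\<^sub>R e + x \<notin> K" "x \<notin> K"
        using R[of x] R[of "h n *\<^sub>R e + x"] by linarith+
      then show ?thesis using supp B(2) by (simp add: F_def)
    qed
    then show "AE x in lborel. norm (F n x) \<le> indicator ?T x *\<^sub>R (B * norm e)" for n by simp
  qed (auto simp: F_def)
  then show ?thesis by (simp add: F0 LIMSEQ_const_iff)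
qed

lemma lebesgue_on_integral_eq_lborel:
  fixes f :: "'a::euclidean_space \<Rightarrow> real"
  assumes "open \<Omega>" "f \<in> borel_measurable borel" "\<And>x. x \<notin> \<Omega> \<Longrightarrow> f x = 0"
  shows "(LINT x|lebesgue_on \<Omega>. f x) = (LINT x|lborel. f x)"
proof -
  have "(LINT x|lebesgue_on \<Omega>. f x) = (LINT x|lebesgue. indicator \<Omega> x *\<^sub>R f x)"
    using assms(1) by (intro integral_restrict_space) simp
  also have "(\<lambda>x. indicator \<Omega> x *\<^sub>R f x) = f"
    using assms(3) by (fastforce simp: indicator_def)
  also have "integral\<^sup>L lebesgue f = (LINT x|lborel. f x)"
    using assms(2) by (intro integral_completion) simp
  finally show ?thesis .
qed

lemma tendsto_0_squeeze:
  fixes f g :: "nat \<Rightarrow> real"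
  assumes "g \<longlonglongrightarrow> 0" "\<And>n. f n \<le> g n" "\<And>n. 0 \<le> f n"
  shows "f \<longlonglongrightarrow> 0"
  by (rule tendsto_sandwich[OF _ _ tendsto_const assms(1)]) (use assms in auto)

lemma L2_norm_lincomb_diff_le:
  assumes "a \<in> L2_space \<Omega>" "a' \<in> L2_space \<Omega>" "b \<in> L2_space \<Omega>" "b' \<in> L2_space \<Omega>"
  shows "L2_norm \<Omega> (\<lambda>x. (a x + c *\<^sub>R b x) - (a' x + c *\<^sub>R b' x))
      \<le> L2_norm \<Omega> (\<lambda>x. a x - a' x) + \<bar>c\<bar> * L2_norm \<Omega> (\<lambda>x. b x - b' x)"
proof -
  have "(\<lambda>x. (a x + c *\<^sub>R b x) - (a' x + c *\<^sub>R b' x)) = (\<lambda>x. (a x - a' x) + c *\<^sub>R (b x - b' x))"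
    by (simp add: algebra_simps)
  then show ?thesis
    using L2_norm_triangle[OF L2_space_diff[OF assms(1,2)]
        L2_space_scaleR[OF L2_space_diff[OF assms(3,4)], of c]]
    by (simp only: L2_norm_scaleR)
qed

text \<open>Boundedness makes the measure finite, so that continuous functions on the whole space
  belong to L2 and L2 functions are integrable; openness is what the fundamental lemma asks
  for.\<close>

locale bounded_open_set =
  fixes \<Omega> :: "'a::euclidean_space set"
  assumes open_set: "open \<Omega>" and bounded_set: "bounded \<Omega>"
begin

lemma lmeasurable: "\<Omega> \<in> lmeasurable"
  using open_set bounded_set by (rule lmeasurable_open[rotated])

sublocale finite_measure "lebesgue_on \<Omega>"
  using lmeasurable by (rule finite_measure_lebesgue_on)

lemma borel_measurable_lebesgue_on: "g \<in> borel_measurable borel \<Longrightarrow> g \<in> borel_measurable (lebesgue_on \<Omega>)"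
  by (intro measurable_restrict_space1 measurable_completion) simp

lemma bounded_L2_space:
  assumes "g \<in> borel_measurable (lebesgue_on \<Omega>)" "\<And>x. x \<in> \<Omega> \<Longrightarrow> norm (g x) \<le> B"
  shows "g \<in> L2_space \<Omega>"
proof -
  have "integrable (lebesgue_on \<Omega>) (\<lambda>x. (norm (g x))\<^sup>2)"
    using assms by (intro integrable_const_bound[of _ "B\<^sup>2"]) (auto intro!: AE_I2 power_mono)
  then show ?thesis using assms(1) by (simp add: L2_space_def)
qed

lemma continuous_L2_space:
  assumes "continuous_on UNIV g"
  shows "g \<in> L2_space \<Omega>"
proof -
  have "bounded (g ` closure \<Omega>)"
    using bounded_set
    by (intro compact_imp_bounded compact_continuous_image continuous_on_subset[OF assms]) auto
  then obtain B where "\<forall>x\<in>closure \<Omega>. norm (g x) \<le> B" by (auto simp: bounded_iff)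
  then show ?thesis
    using closure_subset[of \<Omega>] assms
    by (intro bounded_L2_space[of _ B] borel_measurable_lebesgue_on borel_measurable_continuous_onI) auto
qed

lemma test_functions_L2: "\<phi> \<in> test_functions \<Omega> \<Longrightarrow> \<phi> \<in> L2_space \<Omega>"
  by (intro continuous_L2_space test_functions_continuous)

lemma test_functions_grad_L2: "\<phi> \<in> test_functions \<Omega> \<Longrightarrow> classical_grad \<phi> \<in> L2_space \<Omega>"
  by (intro continuous_L2_space test_functions_continuous_grad)

lemma L2_integrable: "u \<in> L2_space \<Omega> \<Longrightarrow> integrable (lebesgue_on \<Omega>) u" for u :: "'a \<Rightarrow> real"
  using L2_integrable_inner[OF _ continuous_L2_space[of "\<lambda>x. 1 :: real"], of u] by simp

lemma L2_space_inner_const: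
  assumes u: "u \<in> L2_space \<Omega>"
  shows "(\<lambda>x. u x \<bullet> i) \<in> L2_space \<Omega>"
proof (rule L2_spaceI)
  show m: "(\<lambda>x. u x \<bullet> i) \<in> borel_measurable (lebesgue_on \<Omega>)"
    by (intro borel_measurable_inner L2_space_measurable[OF u]) simp
  show "integrable (lebesgue_on \<Omega>) (\<lambda>x. (u x \<bullet> i) \<bullet> (u x \<bullet> i))"
  proof (rule Bochner_Integration.integrable_bound)
    show "integrable (lebesgue_on \<Omega>) (\<lambda>x. (norm i)\<^sup>2 * (u x \<bullet> u x))"
      by (intro integrable_mult_right L2_integrable_inner u)
    have "\<bar>(u x \<bullet> i) * (u x \<bullet> i)\<bar> \<le> (norm i)\<^sup>2 * (u x \<bullet> u x)" for x
      using Cauchy_Schwarz_ineq[of "u x" i] by (simp add: power2_eq_square dot_square_norm mult.commute)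
    then show "AE x in lebesgue_on \<Omega>. norm ((u x \<bullet> i) \<bullet> (u x \<bullet> i)) \<le> norm ((norm i)\<^sup>2 * (u x \<bullet> u x))"
      by (intro AE_I2) (simp add: order_trans[OF _ abs_ge_self])
  qed (use m in measurable)
qed

lemma L2_fundamental_lemma:
  fixes d d' :: "'a \<Rightarrow> real"
  assumes d: "d \<in> L2_space \<Omega>" "d' \<in> L2_space \<Omega>"
    and eq: "\<And>\<phi>. \<phi> \<in> test_functions \<Omega> \<Longrightarrow>
      (LINT x|lebesgue_on \<Omega>. d x * \<phi> x) = (LINT x|lebesgue_on \<Omega>. d' x * \<phi> x)"
  shows "AE x in lebesgue_on \<Omega>. d x = d' x"
proof -
  have "AE x in lebesgue_on \<Omega>. d x - d' x = 0"
  proof (rule fundamental_lemma_calculus_of_variations[OF open_set])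
    show "integrable (lebesgue_on \<Omega>) (\<lambda>x. d x - d' x)"
      by (intro L2_integrable L2_space_diff d)
    fix \<phi> assume \<phi>: "\<phi> \<in> test_functions \<Omega>"
    show "(LINT x|lebesgue_on \<Omega>. (d x - d' x) * \<phi> x) = 0"
      using L2_inner_diff_left[OF d test_functions_L2[OF \<phi>]] eq[OF \<phi>] by (simp add: L2_inner_def)
  qed
  then show ?thesis by simp
qed

text \<open>The scalar fundamental lemma is applied to each component; the exceptional null sets are
  finitely many.\<close>

lemma weak_grad_unique:
  assumes g: "is_weak_grad \<Omega> w g" "is_weak_grad \<Omega> w g'"
  shows "AE x in lebesgue_on \<Omega>. g x = g' x"
proof -
  have "AE x in lebesgue_on \<Omega>. g x \<bullet> i = g' x \<bullet> i" if i: "i \<in> Basis" for i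
  proof (rule L2_fundamental_lemma)
    show "(\<lambda>x. g x \<bullet> i) \<in> L2_space \<Omega>" "(\<lambda>x. g' x \<bullet> i) \<in> L2_space \<Omega>"
      using g by (auto intro: L2_space_inner_const simp: is_weak_grad_def)
    fix \<phi> assume "\<phi> \<in> test_functions \<Omega>"
    then have "- (LINT x|lebesgue_on \<Omega>. (g x \<bullet> i) * \<phi> x) = - (LINT x|lebesgue_on \<Omega>. (g' x \<bullet> i) * \<phi> x)"
      using g i unfolding is_weak_grad_def by (metis (lifting))
    then show "(LINT x|lebesgue_on \<Omega>. (g x \<bullet> i) * \<phi> x) = (LINT x|lebesgue_on \<Omega>. (g' x \<bullet> i) * \<phi> x)"
      by (rule neg_equal_iff_equal[THEN iffD1])
  qed
  then have "AE x in lebesgue_on \<Omega>. \<forall>i\<in>Basis. g x \<bullet> i = g' x \<bullet> i"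
    by (intro AE_finite_allI) auto
  then show ?thesis by eventually_elim (auto intro: euclidean_eqI)
qed

lemma weak_div_unique:
  assumes "is_weak_div \<Omega> \<tau> h" "is_weak_div \<Omega> \<tau> h'"
  shows "AE x in lebesgue_on \<Omega>. h x = h' x"
proof (rule L2_fundamental_lemma)
  fix \<phi> assume "\<phi> \<in> test_functions \<Omega>"
  then have "- (LINT x|lebesgue_on \<Omega>. h x * \<phi> x) = - (LINT x|lebesgue_on \<Omega>. h' x * \<phi> x)"
    using assms unfolding is_weak_div_def by (metis (lifting))
  then show "(LINT x|lebesgue_on \<Omega>. h x * \<phi> x) = (LINT x|lebesgue_on \<Omega>. h' x * \<phi> x)"
    by (rule neg_equal_iff_equal[THEN iffD1])
qed (use assms in \<open>simp_all add: is_weak_div_def\<close>)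

section \<open>The chosen weak gradient and weak divergence\<close>

lemma is_weak_grad_wgrad: "is_weak_grad \<Omega> w g \<Longrightarrow> is_weak_grad \<Omega> w (wgrad \<Omega> w)"
  unfolding wgrad_def by (rule someI[of "is_weak_grad \<Omega> w"])

lemma H1_is_weak_grad: "w \<in> H1_space \<Omega> \<Longrightarrow> is_weak_grad \<Omega> w (wgrad \<Omega> w)"
  by (auto simp: H1_space_def dest: is_weak_grad_wgrad)

lemma wgrad_eq_AE:
  assumes "is_weak_grad \<Omega> w g"
  shows "AE x in lebesgue_on \<Omega>. wgrad \<Omega> w x = g x"
  by (rule weak_grad_unique[OF is_weak_grad_wgrad[OF assms] assms])

lemma wgrad_L2: "w \<in> H1_space \<Omega> \<Longrightarrow> wgrad \<Omega> w \<in> L2_space \<Omega>"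
  using H1_is_weak_grad by (simp add: is_weak_grad_def)

lemma is_weak_div_wdiv: "is_weak_div \<Omega> \<tau> h \<Longrightarrow> is_weak_div \<Omega> \<tau> (wdiv \<Omega> \<tau>)"
  unfolding wdiv_def by (rule someI[of "is_weak_div \<Omega> \<tau>"])

lemma Hdiv_is_weak_div: "\<tau> \<in> Hdiv_space \<Omega> \<Longrightarrow> is_weak_div \<Omega> \<tau> (wdiv \<Omega> \<tau>)"
  by (auto simp: Hdiv_space_def dest: is_weak_div_wdiv)

lemma wdiv_eq_AE:
  assumes "is_weak_div \<Omega> \<tau> h"
  shows "AE x in lebesgue_on \<Omega>. wdiv \<Omega> \<tau> x = h x"
  by (rule weak_div_unique[OF is_weak_div_wdiv[OF assms] assms])

lemma wdiv_L2: "\<tau> \<in> Hdiv_space \<Omega> \<Longrightarrow> wdiv \<Omega> \<tau> \<in> L2_space \<Omega>"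
  using Hdiv_is_weak_div by (simp add: is_weak_div_def)

lemma H10_H1: "w \<in> H10_space \<Omega> \<Longrightarrow> w \<in> H1_space \<Omega>"
  by (simp add: H10_space_def)

lemma H10_L2: "w \<in> H10_space \<Omega> \<Longrightarrow> w \<in> L2_space \<Omega>"
  by (simp add: H10_space_def H1_space_def)

lemma H10_wgrad_L2: "w \<in> H10_space \<Omega> \<Longrightarrow> wgrad \<Omega> w \<in> L2_space \<Omega>"
  by (intro wgrad_L2 H10_H1)

lemma Hdiv_L2: "\<tau> \<in> Hdiv_space \<Omega> \<Longrightarrow> \<tau> \<in> L2_space \<Omega>"
  by (simp add: Hdiv_space_def)

text \<open>The product of the two functions is continuously differentiable with compact support, so
  each directional derivative of it integrates to 0 over the whole space. Both functions vanish
  outside \<Omega>, hence so does \<open>?G\<close>.\<close>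

lemma test_functions_integration_by_parts:
  assumes \<phi>: "\<phi> \<in> test_functions \<Omega>" and \<psi>: "\<psi> \<in> test_functions \<Omega>"
  shows "(LINT x|lebesgue_on \<Omega>. \<phi> x * (classical_grad \<psi> x \<bullet> i)) =
    - (LINT x|lebesgue_on \<Omega>. (classical_grad \<phi> x \<bullet> i) * \<psi> x)"
proof -
  let ?G = "\<lambda>x. \<phi> x *\<^sub>R classical_grad \<psi> x + \<psi> x *\<^sub>R classical_grad \<phi> x"
  have contG: "continuous_on UNIV ?G"
    using \<phi> \<psi> by (intro continuous_intros test_functions_continuous test_functions_continuous_grad)
  have "(LINT x|lborel. ?G x \<bullet> i) = 0"
  proof (rule integral_directional_derivative_eq_0)
    show "compact (closure {x. \<phi> x \<noteq> 0})" using \<phi> by (simp add: test_functions_def)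
    show "\<phi> x * \<psi> x = 0" if "x \<notin> closure {x. \<phi> x \<noteq> 0}" for x
    proof -
      have "x \<notin> {x. \<phi> x \<noteq> 0}" using that closure_subset by (meson subsetD)
      then show ?thesis by simp
    qed
    show "((\<lambda>x. \<phi> x * \<psi> x) has_derivative (\<lambda>h. ?G x \<bullet> h)) (at x)" for x
      using has_derivative_mult[OF test_functions_has_derivative[OF \<phi>, of x]
          test_functions_has_derivative[OF \<psi>, of x]]
      by (simp add: inner_add_left mult.commute)
  qed (rule contG)
  moreover have "(LINT x|lborel. ?G x \<bullet> i) = (LINT x|lebesgue_on \<Omega>. ?G x \<bullet> i)"
    using contG test_functions_zero[OF \<phi>] test_functions_zero[OF \<psi>]
    by (intro lebesgue_on_integral_eq_lborel[OF open_set, symmetric] borel_measurable_inner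
        borel_measurable_continuous_onI) auto
  moreover have "(LINT x|lebesgue_on \<Omega>. ?G x \<bullet> i) = (LINT x|lebesgue_on \<Omega>. \<phi> x * (classical_grad \<psi> x \<bullet> i))
      + (LINT x|lebesgue_on \<Omega>. (classical_grad \<phi> x \<bullet> i) * \<psi> x)"
    using L2_integrable_inner[OF test_functions_L2[OF \<phi>]
        L2_space_inner_const[OF test_functions_grad_L2[OF \<psi>]], of i]
      L2_integrable_inner[OF test_functions_L2[OF \<psi>]
        L2_space_inner_const[OF test_functions_grad_L2[OF \<phi>]], of i]
    by (simp add: inner_add_left mult.commute[of "_ \<bullet> i" "\<psi> _"])
  ultimately show ?thesis by simp
qed

text \<open>The weak gradient is a closed operator: against a fixed test function, both sides of the
  integration by parts are continuous in the L2 norm.\<close>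

lemma test_functions_limit_weak_grad:
  assumes w: "w \<in> L2_space \<Omega>" and G: "G \<in> L2_space \<Omega>"
    and \<phi>: "\<And>n. \<phi> n \<in> test_functions \<Omega>"
    and lim: "(\<lambda>n. L2_norm \<Omega> (\<lambda>x. \<phi> n x - w x)) \<longlonglongrightarrow> 0"
      "(\<lambda>n. L2_norm \<Omega> (\<lambda>x. classical_grad (\<phi> n) x - G x)) \<longlonglongrightarrow> 0"
  shows "is_weak_grad \<Omega> w G"
  unfolding is_weak_grad_def
proof (intro conjI ballI G)
  fix \<psi> :: "'a \<Rightarrow> real" and i :: 'a
  assume \<psi>: "\<psi> \<in> test_functions \<Omega>"
  have \<psi>i: "(\<lambda>x. \<psi> x *\<^sub>R i) \<in> L2_space \<Omega>"
    by (intro continuous_L2_space continuous_intros test_functions_continuous[OF \<psi>])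
  have eq: "L2_inner \<Omega> (\<phi> n) (\<lambda>x. classical_grad \<psi> x \<bullet> i) =
      - L2_inner \<Omega> (classical_grad (\<phi> n)) (\<lambda>x. \<psi> x *\<^sub>R i)" for n
    using test_functions_integration_by_parts[OF \<phi> \<psi>, of n i]
    by (simp add: L2_inner_def mult.commute)
  have "(\<lambda>n. L2_inner \<Omega> (\<phi> n) (\<lambda>x. classical_grad \<psi> x \<bullet> i)) \<longlonglongrightarrow>
      L2_inner \<Omega> w (\<lambda>x. classical_grad \<psi> x \<bullet> i)"
    by (intro L2_inner_tendsto test_functions_L2 \<phi> w lim L2_space_inner_const
        test_functions_grad_L2 \<psi>)
  moreover have "(\<lambda>n. L2_inner \<Omega> (\<phi> n) (\<lambda>x. classical_grad \<psi> x \<bullet> i)) \<longlonglongrightarrow>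
      - L2_inner \<Omega> G (\<lambda>x. \<psi> x *\<^sub>R i)"
    unfolding eq by (intro tendsto_minus L2_inner_tendsto test_functions_grad_L2 \<phi> G lim \<psi>i)
  ultimately have "L2_inner \<Omega> w (\<lambda>x. classical_grad \<psi> x \<bullet> i) = - L2_inner \<Omega> G (\<lambda>x. \<psi> x *\<^sub>R i)"
    by (rule LIMSEQ_unique)
  then show "(LINT x|lebesgue_on \<Omega>. w x * (classical_grad \<psi> x \<bullet> i)) =
      - (LINT x|lebesgue_on \<Omega>. (G x \<bullet> i) * \<psi> x)"
    by (simp add: L2_inner_def mult.commute)
qed

text \<open>The definition of \<open>H10_space\<close> measures convergence against the chosen
  \<open>wgrad\<close> of a function already known to lie in H1. Here any L2 limit \<open>G\<close>
  of the gradients suffices, because by closedness it is a weak gradient.\<close>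

lemma H10_limitI:
  assumes w: "w \<in> L2_space \<Omega>" and G: "G \<in> L2_space \<Omega>"
    and \<phi>: "\<And>n. \<phi> n \<in> test_functions \<Omega>"
    and lim: "(\<lambda>n. L2_norm \<Omega> (\<lambda>x. \<phi> n x - w x)) \<longlonglongrightarrow> 0"
      "(\<lambda>n. L2_norm \<Omega> (\<lambda>x. classical_grad (\<phi> n) x - G x)) \<longlonglongrightarrow> 0"
  shows "w \<in> H10_space \<Omega>" "AE x in lebesgue_on \<Omega>. wgrad \<Omega> w x = G x"
proof -
  have wg: "is_weak_grad \<Omega> w G" by (rule test_functions_limit_weak_grad[OF assms])
  then have H1: "w \<in> H1_space \<Omega>" using w by (auto simp: H1_space_def)
  show AE: "AE x in lebesgue_on \<Omega>. wgrad \<Omega> w x = G x" by (rule wgrad_eq_AE[OF wg])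
  have "L2_norm \<Omega> (\<lambda>x. classical_grad (\<phi> n) x - wgrad \<Omega> w x) =
      L2_norm \<Omega> (\<lambda>x. classical_grad (\<phi> n) x - G x)" for n
    using AE by (intro L2_norm_cong_AE L2_space_diff test_functions_grad_L2 \<phi> G wgrad_L2 H1) auto
  then show "w \<in> H10_space \<Omega>"
    using H1 \<phi> lim by (auto simp: H10_space_def intro!: exI[of _ \<phi>])
qed

section \<open>Linear structure of \<open>H10_space\<close> and integration by parts\<close>

lemma H10_approx:
  assumes "w \<in> H10_space \<Omega>"
  obtains \<phi> where "\<And>n. \<phi> n \<in> test_functions \<Omega>"
    "(\<lambda>n. L2_norm \<Omega> (\<lambda>x. \<phi> n x - w x)) \<longlonglongrightarrow> 0"
    "(\<lambda>n. L2_norm \<Omega> (\<lambda>x. classical_grad (\<phi> n) x - wgrad \<Omega> w x)) \<longlonglongrightarrow> 0"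
  using assms by (auto simp: H10_space_def)

lemma test_functions_H10:
  assumes \<phi>: "\<phi> \<in> test_functions \<Omega>"
  shows "\<phi> \<in> H10_space \<Omega>" "AE x in lebesgue_on \<Omega>. wgrad \<Omega> \<phi> x = classical_grad \<phi> x"
  by (rule H10_limitI[OF test_functions_L2[OF \<phi>] test_functions_grad_L2[OF \<phi>], of "\<lambda>_. \<phi>"];
      simp add: \<phi> L2_norm_def)+

text \<open>Linear combinations of the approximating sequences converge to the linear combination of
  the limits. As \<open>wgrad\<close> is a choice, it is linear only up to null sets.\<close>

lemma H10_lincomb:
  assumes w: "w \<in> H10_space \<Omega>" and z: "z \<in> H10_space \<Omega>"
  shows "(\<lambda>x. w x + c * z x) \<in> H10_space \<Omega>"
    "AE x in lebesgue_on \<Omega>. wgrad \<Omega> (\<lambda>x. w x + c * z x) x = wgrad \<Omega> w x + c *\<^sub>R wgrad \<Omega> z x"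
proof -
  obtain \<phi> where \<phi>: "\<And>n. \<phi> n \<in> test_functions \<Omega>"
    "(\<lambda>n. L2_norm \<Omega> (\<lambda>x. \<phi> n x - w x)) \<longlonglongrightarrow> 0"
    "(\<lambda>n. L2_norm \<Omega> (\<lambda>x. classical_grad (\<phi> n) x - wgrad \<Omega> w x)) \<longlonglongrightarrow> 0"
    using H10_approx[OF w] by blast
  obtain \<psi> where \<psi>: "\<And>n. \<psi> n \<in> test_functions \<Omega>"
    "(\<lambda>n. L2_norm \<Omega> (\<lambda>x. \<psi> n x - z x)) \<longlonglongrightarrow> 0"
    "(\<lambda>n. L2_norm \<Omega> (\<lambda>x. classical_grad (\<psi> n) x - wgrad \<Omega> z x)) \<longlonglongrightarrow> 0"
    using H10_approx[OF z] by blast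
  note L2 = test_functions_L2[OF \<phi>(1)] test_functions_L2[OF \<psi>(1)]
    test_functions_grad_L2[OF \<phi>(1)] test_functions_grad_L2[OF \<psi>(1)]
    H10_L2[OF w] H10_L2[OF z] H10_wgrad_L2[OF w] H10_wgrad_L2[OF z]
  have "(\<lambda>n. L2_norm \<Omega> (\<lambda>x. \<phi> n x - w x) + \<bar>c\<bar> * L2_norm \<Omega> (\<lambda>x. \<psi> n x - z x)) \<longlonglongrightarrow> 0"
    using tendsto_add[OF \<phi>(2) tendsto_mult_left[OF \<psi>(2), of "\<bar>c\<bar>"]] by simp
  moreover have "L2_norm \<Omega> (\<lambda>x. (\<phi> n x + c * \<psi> n x) - (w x + c * z x))
      \<le> L2_norm \<Omega> (\<lambda>x. \<phi> n x - w x) + \<bar>c\<bar> * L2_norm \<Omega> (\<lambda>x. \<psi> n x - z x)" for n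
    using L2_norm_lincomb_diff_le[OF L2(1)[of n] L2(5) L2(2)[of n] L2(6), where c = c]
    unfolding real_scaleR_def .
  ultimately have lim1: "(\<lambda>n. L2_norm \<Omega> (\<lambda>x. (\<phi> n x + c * \<psi> n x) - (w x + c * z x))) \<longlonglongrightarrow> 0"
    by (rule tendsto_0_squeeze) simp
  have "(\<lambda>n. L2_norm \<Omega> (\<lambda>x. classical_grad (\<phi> n) x - wgrad \<Omega> w x) +
      \<bar>c\<bar> * L2_norm \<Omega> (\<lambda>x. classical_grad (\<psi> n) x - wgrad \<Omega> z x)) \<longlonglongrightarrow> 0"
    using tendsto_add[OF \<phi>(3) tendsto_mult_left[OF \<psi>(3), of "\<bar>c\<bar>"]] by simp
  moreover have "L2_norm \<Omega> (\<lambda>x. classical_grad (\<lambda>x. \<phi> n x + c * \<psi> n x) x -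
        (wgrad \<Omega> w x + c *\<^sub>R wgrad \<Omega> z x))
      \<le> L2_norm \<Omega> (\<lambda>x. classical_grad (\<phi> n) x - wgrad \<Omega> w x) +
        \<bar>c\<bar> * L2_norm \<Omega> (\<lambda>x. classical_grad (\<psi> n) x - wgrad \<Omega> z x)" for n
    unfolding classical_grad_lincomb[OF \<phi>(1)[of n] \<psi>(1)[of n]]
    by (rule L2_norm_lincomb_diff_le[OF L2(3)[of n] L2(7) L2(4)[of n] L2(8)])
  ultimately have lim2: "(\<lambda>n. L2_norm \<Omega> (\<lambda>x. classical_grad (\<lambda>x. \<phi> n x + c * \<psi> n x) x -
      (wgrad \<Omega> w x + c *\<^sub>R wgrad \<Omega> z x))) \<longlonglongrightarrow> 0"
    by (rule tendsto_0_squeeze) simp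
  note lim = H10_limitI[OF L2_space_add[OF L2(5) L2_space_cmult[OF L2(6)]]
      L2_space_add[OF L2(7) L2_space_scaleR[OF L2(8)]] test_functions_lincomb[OF \<phi>(1) \<psi>(1)] lim1 lim2]
  show "(\<lambda>x. w x + c * z x) \<in> H10_space \<Omega>" by (rule lim(1))
  show "AE x in lebesgue_on \<Omega>. wgrad \<Omega> (\<lambda>x. w x + c * z x) x = wgrad \<Omega> w x + c *\<^sub>R wgrad \<Omega> z x"
    by (rule lim(2))
qed

lemma H10_diff:
  assumes "w \<in> H10_space \<Omega>" "z \<in> H10_space \<Omega>"
  shows "(\<lambda>x. w x - z x) \<in> H10_space \<Omega>"
    "AE x in lebesgue_on \<Omega>. wgrad \<Omega> (\<lambda>x. w x - z x) x = wgrad \<Omega> w x - wgrad \<Omega> z x"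
  using H10_lincomb[OF assms, of "-1"] by simp_all

text \<open>For test functions this is the definition of the weak divergence; both sides pass to
  limits in the H1 norm, and there is no boundary term because \<open>w\<close> is such a
  limit.\<close>

lemma Hdiv_integration_by_parts:
  assumes \<tau>: "\<tau> \<in> Hdiv_space \<Omega>" and w: "w \<in> H10_space \<Omega>"
  shows "L2_inner \<Omega> \<tau> (wgrad \<Omega> w) = - L2_inner \<Omega> (wdiv \<Omega> \<tau>) w"
proof -
  obtain \<phi> where \<phi>: "\<And>n. \<phi> n \<in> test_functions \<Omega>"
    "(\<lambda>n. L2_norm \<Omega> (\<lambda>x. \<phi> n x - w x)) \<longlonglongrightarrow> 0"
    "(\<lambda>n. L2_norm \<Omega> (\<lambda>x. classical_grad (\<phi> n) x - wgrad \<Omega> w x)) \<longlonglongrightarrow> 0"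
    using H10_approx[OF w] by blast
  have eq: "L2_inner \<Omega> (classical_grad (\<phi> n)) \<tau> = - L2_inner \<Omega> (\<phi> n) (wdiv \<Omega> \<tau>)" for n
    using Hdiv_is_weak_div[OF \<tau>] \<phi>(1)
    by (simp add: is_weak_div_def L2_inner_def inner_commute mult.commute)
  have "(\<lambda>n. L2_inner \<Omega> (classical_grad (\<phi> n)) \<tau>) \<longlonglongrightarrow> L2_inner \<Omega> (wgrad \<Omega> w) \<tau>"
    by (intro L2_inner_tendsto test_functions_grad_L2 \<phi> H10_wgrad_L2 w Hdiv_L2 \<tau>)
  moreover have "(\<lambda>n. L2_inner \<Omega> (classical_grad (\<phi> n)) \<tau>) \<longlonglongrightarrow> - L2_inner \<Omega> w (wdiv \<Omega> \<tau>)"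
    unfolding eq by (intro tendsto_minus L2_inner_tendsto test_functions_L2 \<phi> H10_L2 w wdiv_L2 \<tau>)
  ultimately have "L2_inner \<Omega> (wgrad \<Omega> w) \<tau> = - L2_inner \<Omega> w (wdiv \<Omega> \<tau>)"
    by (rule LIMSEQ_unique)
  then show ?thesis by (simp add: L2_inner_commute[of \<Omega> \<tau>] L2_inner_commute[of \<Omega> "wdiv \<Omega> \<tau>"])
qed

end

subsection \<open>Weak solutions\<close>

locale diffusion_problem = bounded_open_set \<Omega> for \<Omega> :: "'a::euclidean_space set" +
  fixes \<nu> :: "'a \<Rightarrow> real" and \<nu>l \<nu>u CF :: real
  assumes nu_measurable: "\<nu> \<in> borel_measurable (lebesgue_on \<Omega>)"
    and nu_lower_pos: "0 < \<nu>l"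
    and nu_bounds: "\<And>x. x \<in> \<Omega> \<Longrightarrow> \<nu>l \<le> \<nu> x \<and> \<nu> x \<le> \<nu>u"
    and CF_pos: "0 < CF"
    and Friedrichs: "\<And>w. w \<in> H10_space \<Omega> \<Longrightarrow> L2_norm \<Omega> w \<le> CF * L2_norm \<Omega> (wgrad \<Omega> w)"
begin

text \<open>The bilinear form takes vector fields rather than functions, so that an L2 limit of
  gradients can be inserted before it is known to be a gradient.\<close>

definition energy :: "('a \<Rightarrow> 'a) \<Rightarrow> ('a \<Rightarrow> 'a) \<Rightarrow> real" where
  "energy G H = L2_inner \<Omega> (\<lambda>x. \<nu> x *\<^sub>R G x) H"

lemma nu_scaleR_L2: "G \<in> L2_space \<Omega> \<Longrightarrow> (\<lambda>x. \<nu> x *\<^sub>R G x) \<in> L2_space \<Omega>" for G :: "'a \<Rightarrow> 'a"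
proof (rule L2_space_bounded_scaleR[OF _ nu_measurable])
  show "\<bar>\<nu> x\<bar> \<le> \<nu>u" if "x \<in> \<Omega>" for x
    using nu_bounds[OF that] nu_lower_pos by simp
qed

lemma energy_commute: "energy G H = energy H G"
  by (simp add: energy_def L2_inner_def inner_commute)

lemma energy_eq_right: "energy G H = L2_inner \<Omega> G (\<lambda>x. \<nu> x *\<^sub>R H x)"
  by (simp add: energy_def L2_inner_def)

lemma energy_add_right:
  "G \<in> L2_space \<Omega> \<Longrightarrow> H \<in> L2_space \<Omega> \<Longrightarrow> K \<in> L2_space \<Omega> \<Longrightarrow>
    energy G (\<lambda>x. H x + c *\<^sub>R K x) = energy G H + c * energy G K"
  by (simp add: energy_def L2_inner_add_right L2_inner_scaleR_right L2_space_scaleR nu_scaleR_L2)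

lemma energy_add_left:
  "G \<in> L2_space \<Omega> \<Longrightarrow> H \<in> L2_space \<Omega> \<Longrightarrow> K \<in> L2_space \<Omega> \<Longrightarrow>
    energy (\<lambda>x. H x + c *\<^sub>R K x) G = energy H G + c * energy K G"
  using energy_add_right[of G H K c] by (simp only: energy_commute[of G])

lemma energy_diff_left:
  "G \<in> L2_space \<Omega> \<Longrightarrow> H \<in> L2_space \<Omega> \<Longrightarrow> K \<in> L2_space \<Omega> \<Longrightarrow>
    energy (\<lambda>x. H x - K x) G = energy H G - energy K G"
  using energy_add_left[of G H K "-1"] by simp

lemma energy_coercive:
  assumes G: "G \<in> L2_space \<Omega>"
  shows "\<nu>l * (L2_norm \<Omega> G)\<^sup>2 \<le> energy G G"
proof -
  have "(LINT x|lebesgue_on \<Omega>. \<nu>l * (G x \<bullet> G x)) \<le> (LINT x|lebesgue_on \<Omega>. (\<nu> x *\<^sub>R G x) \<bullet> G x)"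
  proof (rule integral_mono)
    show "\<nu>l * (G x \<bullet> G x) \<le> (\<nu> x *\<^sub>R G x) \<bullet> G x" if "x \<in> space (lebesgue_on \<Omega>)" for x
      using nu_bounds[of x] that by (simp add: mult_right_mono)
  qed (intro integrable_mult_right L2_integrable_inner G nu_scaleR_L2)+
  then show ?thesis by (simp add: L2_norm_square energy_def L2_inner_def)
qed

lemma energy_nonneg:
  assumes "G \<in> L2_space \<Omega>"
  shows "0 \<le> energy G G"
proof -
  have "0 \<le> \<nu>l * (L2_norm \<Omega> G)\<^sup>2" using nu_lower_pos by simp
  then show ?thesis using energy_coercive[OF assms] by linarith
qed

lemma Friedrichs_test_functions:
  assumes "\<phi> \<in> test_functions \<Omega>"
  shows "L2_norm \<Omega> \<phi> \<le> CF * L2_norm \<Omega> (classical_grad \<phi>)"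
  using Friedrichs[OF test_functions_H10(1)[OF assms]]
    L2_norm_cong_AE[OF H10_wgrad_L2[OF test_functions_H10(1)[OF assms]]
      test_functions_grad_L2[OF assms] test_functions_H10(2)[OF assms]] by simp

lemma is_weak_solution_iff:
  "is_weak_solution \<Omega> \<nu> g z \<longleftrightarrow> z \<in> H10_space \<Omega> \<and>
    (\<forall>w\<in>H10_space \<Omega>. energy (wgrad \<Omega> z) (wgrad \<Omega> w) = L2_inner \<Omega> g w)"
  by (simp add: is_weak_solution_def energy_def L2_inner_def)

text \<open>Let E be the energy functional and m its infimum over test functions;
  \<open>\<phi> n\<close> is chosen with E below m + 1/(n+1). In every direction
  \<open>\<psi>\<close> the quadratic t |-> E(\<open>\<phi> n\<close> + t \<open>\<psi>\<close>) - m
  is nonnegative, and its discriminant bounds the residual of the weak equation at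
  \<open>\<phi> n\<close>.\<close>

lemma energy_minimizing_sequence:
  assumes g: "g \<in> L2_space \<Omega>"
  obtains \<phi> where "\<And>n. \<phi> n \<in> test_functions \<Omega>"
    "\<And>n \<psi>. \<psi> \<in> test_functions \<Omega> \<Longrightarrow>
      (energy (classical_grad (\<phi> n)) (classical_grad \<psi>) - L2_inner \<Omega> g \<psi>)\<^sup>2
        \<le> 2 / real (Suc n) * energy (classical_grad \<psi>) (classical_grad \<psi>)"
proof -
  define E where "E \<phi> = energy (classical_grad \<phi>) (classical_grad \<phi>) / 2 - L2_inner \<Omega> g \<phi>" for \<phi>
  have zero: "(\<lambda>x. 0) \<in> test_functions \<Omega>"
    by (rule test_functionsI[of _ "{}"]) auto
  \<comment> \<open>The minimum over N of \<open>\<nu>l\<close> N^2 / 2 - b N with b =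
    \<open>L2_norm \<Omega> g * CF\<close>. Coercivity and the Friedrichs inequality bound the
    functional from below by this expression.\<close>
  define B where "B = - (L2_norm \<Omega> g * CF)\<^sup>2 / (2 * \<nu>l)"
  have below: "B \<le> E \<phi>" if \<phi>: "\<phi> \<in> test_functions \<Omega>" for \<phi>
  proof -
    define N where "N = L2_norm \<Omega> (classical_grad \<phi>)"
    define b where "b = L2_norm \<Omega> g * CF"
    have "L2_inner \<Omega> g \<phi> \<le> L2_norm \<Omega> g * L2_norm \<Omega> \<phi>"
      using L2_Cauchy_Schwarz[OF g test_functions_L2[OF \<phi>]] by linarith
    also have "\<dots> \<le> L2_norm \<Omega> g * (CF * N)"
      unfolding N_def by (intro mult_left_mono Friedrichs_test_functions \<phi>) simp
    finally have "L2_inner \<Omega> g \<phi> \<le> b * N" by (simp add: b_def)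
    moreover have "\<nu>l * N\<^sup>2 \<le> energy (classical_grad \<phi>) (classical_grad \<phi>)"
      unfolding N_def by (intro energy_coercive test_functions_grad_L2 \<phi>)
    moreover have "\<nu>l * N\<^sup>2 / 2 - b * N = (\<nu>l * N - b)\<^sup>2 / (2 * \<nu>l) + - b\<^sup>2 / (2 * \<nu>l)"
      using nu_lower_pos by (simp add: field_simps power2_eq_square)
    moreover have "0 \<le> (\<nu>l * N - b)\<^sup>2 / (2 * \<nu>l)" using nu_lower_pos by simp
    ultimately show ?thesis by (simp add: E_def B_def b_def)
  qed
  define m where "m = (INF \<phi>\<in>test_functions \<Omega>. E \<phi>)"
  have bdd: "bdd_below (E ` test_functions \<Omega>)" by (intro bdd_belowI2[of _ B] below)
  have m_le: "m \<le> E \<phi>" if "\<phi> \<in> test_functions \<Omega>" for \<phi>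
    unfolding m_def by (rule cINF_lower[OF bdd that])
  have "\<exists>\<phi>. \<phi> \<in> test_functions \<Omega> \<and> E \<phi> < m + 1 / real (Suc n)" for n
  proof -
    have "m < m + 1 / real (Suc n)" by simp
    then have "\<exists>\<phi>\<in>test_functions \<Omega>. E \<phi> < m + 1 / real (Suc n)"
      unfolding m_def using zero by (subst (asm) cINF_less_iff[OF _ bdd]) auto
    then show ?thesis by blast
  qed
  then obtain \<phi> where \<phi>: "\<And>n. \<phi> n \<in> test_functions \<Omega>" "\<And>n. E (\<phi> n) < m + 1 / real (Suc n)"
    by metis
  show thesis
  proof (rule that[OF \<phi>(1)])
    fix n \<psi> assume \<psi>: "\<psi> \<in> test_functions \<Omega>"
    define r where "r = energy (classical_grad (\<phi> n)) (classical_grad \<psi>) - L2_inner \<Omega> g \<psi>"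
    define q where "q = energy (classical_grad \<psi>) (classical_grad \<psi>)"
    note L2 = test_functions_L2[OF \<phi>(1)[of n]] test_functions_L2[OF \<psi>]
      test_functions_grad_L2[OF \<phi>(1)[of n]] test_functions_grad_L2[OF \<psi>]
    have "r\<^sup>2 \<le> (2 * (E (\<phi> n) - m)) * q"
    proof (rule quadratic_nonneg_imp_discriminant)
      fix t :: real
      have grad: "classical_grad (\<lambda>x. \<phi> n x + t * \<psi> x) =
          (\<lambda>x. classical_grad (\<phi> n) x + t *\<^sub>R classical_grad \<psi> x)"
        by (rule ext) (rule classical_grad_lincomb[OF \<phi>(1) \<psi>])
      have "E (\<lambda>x. \<phi> n x + t * \<psi> x) = E (\<phi> n) + t * r + t\<^sup>2 / 2 * q"
        unfolding E_def grad r_def q_def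
        using L2 g
        by (simp add: energy_add_right energy_add_left L2_space_add L2_space_scaleR
            energy_commute[of "classical_grad \<psi>" "classical_grad (\<phi> n)"]
            L2_inner_add_right L2_inner_cmult_right L2_space_cmult)
          (simp add: field_simps power2_eq_square)
      moreover have "m \<le> E (\<lambda>x. \<phi> n x + t * \<psi> x)"
        by (intro m_le test_functions_lincomb \<phi>(1) \<psi>)
      ultimately show "0 \<le> 2 * (E (\<phi> n) - m) + 2 * t * r + t\<^sup>2 * q" by simp
    qed (simp add: q_def energy_nonneg L2)
    also have "\<dots> \<le> (2 * (1 / real (Suc n))) * q"
      using \<phi>(2)[of n] by (intro mult_right_mono) (simp_all add: q_def energy_nonneg L2)
    finally show "(energy (classical_grad (\<phi> n)) (classical_grad \<psi>) - L2_inner \<Omega> g \<psi>)\<^sup>2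
        \<le> 2 / real (Suc n) * energy (classical_grad \<psi>) (classical_grad \<psi>)"
      by (simp add: r_def q_def)
  qed
qed

text \<open>The residual bound with \<open>\<psi>\<close> equal to the difference of two almost
  minimizers makes their gradients Cauchy, and the Friedrichs inequality carries this over to the
  functions. The limit satisfies the equation against test functions because the residuals tend to
  0, and then against all of \<open>H10_space\<close> by density.\<close>

theorem weak_solution_exists:
  assumes g: "g \<in> L2_space \<Omega>"
  shows "\<exists>z. is_weak_solution \<Omega> \<nu> g z"
proof -
  obtain \<phi> where \<phi>: "\<And>n. \<phi> n \<in> test_functions \<Omega>"
    and res: "\<And>n \<psi>. \<psi> \<in> test_functions \<Omega> \<Longrightarrow>
      (energy (classical_grad (\<phi> n)) (classical_grad \<psi>) - L2_inner \<Omega> g \<psi>)\<^sup>2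
        \<le> 2 / real (Suc n) * energy (classical_grad \<psi>) (classical_grad \<psi>)"
    by (rule energy_minimizing_sequence[OF g]) (rule that)
  note \<phi>L2 = test_functions_L2[OF \<phi>] and gradL2 = test_functions_grad_L2[OF \<phi>]
  have grad_diff: "(L2_norm \<Omega> (\<lambda>x. classical_grad (\<phi> m) x - classical_grad (\<phi> n) x))\<^sup>2
        \<le> 8 / (\<nu>l * real (Suc N))"
    and diff: "L2_norm \<Omega> (\<lambda>x. \<phi> m x - \<phi> n x)
        \<le> CF * L2_norm \<Omega> (\<lambda>x. classical_grad (\<phi> m) x - classical_grad (\<phi> n) x)"
    if "N \<le> m" "N \<le> n" for m n N
  proof -
    define \<psi> where "\<psi> x = \<phi> m x + (-1) * \<phi> n x" for x
    have \<psi>: "\<psi> \<in> test_functions \<Omega>"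
      unfolding \<psi>_def by (rule test_functions_lincomb[OF \<phi> \<phi>])
    have grad: "classical_grad \<psi> = (\<lambda>x. classical_grad (\<phi> m) x - classical_grad (\<phi> n) x)"
      unfolding \<psi>_def using classical_grad_lincomb[OF \<phi>[of m] \<phi>[of n], of "-1"] by auto
    have \<psi>L2: "classical_grad \<psi> \<in> L2_space \<Omega>" by (rule test_functions_grad_L2[OF \<psi>])
    show "L2_norm \<Omega> (\<lambda>x. \<phi> m x - \<phi> n x)
        \<le> CF * L2_norm \<Omega> (\<lambda>x. classical_grad (\<phi> m) x - classical_grad (\<phi> n) x)"
      using Friedrichs_test_functions[OF \<psi>] unfolding grad by (simp add: \<psi>_def[abs_def])
    define q where "q = energy (classical_grad \<psi>) (classical_grad \<psi>)"
    define r where "r k = energy (classical_grad (\<phi> k)) (classical_grad \<psi>) - L2_inner \<Omega> g \<psi>" for k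
    have q0: "0 \<le> q" unfolding q_def by (rule energy_nonneg[OF \<psi>L2])
    have q: "q = r m - r n"
      unfolding q_def r_def
      using energy_diff_left[OF \<psi>L2 gradL2[of m] gradL2[of n]] by (simp add: grad[symmetric])
    have rk: "(r k)\<^sup>2 \<le> 2 / real (Suc N) * q" if "N \<le> k" for k
    proof -
      have "(r k)\<^sup>2 \<le> 2 / real (Suc k) * q" unfolding r_def q_def by (rule res[OF \<psi>])
      also have "\<dots> \<le> 2 / real (Suc N) * q"
        using that q0 by (intro mult_right_mono divide_left_mono) auto
      finally show ?thesis .
    qed
    \<comment> \<open>As q = r m - r n, its square is at most twice the sum of the two squares, each
      of which is at most 2/(N+1) times q. This yields the constant 8, and one factor q
      cancels.\<close>
    have "q\<^sup>2 \<le> 2 * (r m)\<^sup>2 + 2 * (r n)\<^sup>2"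
      using zero_le_power2[of "r m + r n"] unfolding q by (simp add: power2_eq_square algebra_simps)
    also have "\<dots> \<le> 8 / real (Suc N) * q" using rk[OF that(1)] rk[OF that(2)] by simp
    finally have "q * q \<le> 8 / real (Suc N) * q" by (simp add: power2_eq_square)
    then have "q \<le> 8 / real (Suc N)"
      using q0 by (cases "q = 0") (auto simp only: mult_le_cancel_right, auto)
    then have "\<nu>l * (L2_norm \<Omega> (classical_grad \<psi>))\<^sup>2 \<le> 8 / real (Suc N)"
      using energy_coercive[OF \<psi>L2] unfolding q_def by linarith
    then have "(L2_norm \<Omega> (classical_grad \<psi>))\<^sup>2 \<le> 8 / real (Suc N) / \<nu>l"
      using nu_lower_pos by (simp only: pos_le_divide_eq mult.commute)
    then show "(L2_norm \<Omega> (\<lambda>x. classical_grad (\<phi> m) x - classical_grad (\<phi> n) x))\<^sup>2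
        \<le> 8 / (\<nu>l * real (Suc N))"
      unfolding grad by (simp only: divide_divide_eq_left mult.commute)
  qed
  have Cauchy: "\<exists>N. \<forall>m\<ge>N. \<forall>n\<ge>N.
      L2_norm \<Omega> (\<lambda>x. classical_grad (\<phi> m) x - classical_grad (\<phi> n) x) \<le> e" if e: "0 < e" for e
  proof -
    have "0 < \<nu>l * e\<^sup>2 / 8" using e nu_lower_pos by simp
    then obtain N where N: "inverse (real (Suc N)) < \<nu>l * e\<^sup>2 / 8"
      using reals_Archimedean by blast
    have "8 / (\<nu>l * real (Suc N)) = 8 / \<nu>l * inverse (real (Suc N))"
      by (simp add: field_simps)
    also have "\<dots> \<le> 8 / \<nu>l * (\<nu>l * e\<^sup>2 / 8)"
      using N nu_lower_pos by (intro mult_left_mono) auto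
    also have "\<dots> = e\<^sup>2" using nu_lower_pos by simp
    finally have "8 / (\<nu>l * real (Suc N)) \<le> e\<^sup>2" .
    then have "L2_norm \<Omega> (\<lambda>x. classical_grad (\<phi> m) x - classical_grad (\<phi> n) x) \<le> e"
      if "N \<le> m" "N \<le> n" for m n
      by (rule power2_le_imp_le[OF order_trans[OF grad_diff[OF that]]]) (use e in simp_all)
    then show ?thesis by blast
  qed
  obtain G where G: "G \<in> L2_space \<Omega>"
    "(\<lambda>n. L2_norm \<Omega> (\<lambda>x. classical_grad (\<phi> n) x - G x)) \<longlonglongrightarrow> 0"
    by (rule L2_complete[OF lmeasurable gradL2 Cauchy]) (assumption, rule that)
  have Cauchy0: "\<exists>N. \<forall>m\<ge>N. \<forall>n\<ge>N. L2_norm \<Omega> (\<lambda>x. \<phi> m x - \<phi> n x) \<le> e" if e: "0 < e" for e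
  proof -
    have "0 < e / CF" using e CF_pos by simp
    from Cauchy[OF this] obtain N where N: "\<And>m n. N \<le> m \<Longrightarrow> N \<le> n \<Longrightarrow>
        L2_norm \<Omega> (\<lambda>x. classical_grad (\<phi> m) x - classical_grad (\<phi> n) x) \<le> e / CF"
      by blast
    have "L2_norm \<Omega> (\<lambda>x. \<phi> m x - \<phi> n x) \<le> e" if "N \<le> m" "N \<le> n" for m n
    proof -
      have "L2_norm \<Omega> (\<lambda>x. \<phi> m x - \<phi> n x) \<le> CF * (e / CF)"
        using CF_pos by (intro order_trans[OF diff[OF that]] mult_left_mono N that) simp
      then show ?thesis using CF_pos by simp
    qed
    then show ?thesis by blast
  qed
  obtain z where z: "z \<in> L2_space \<Omega>" "(\<lambda>n. L2_norm \<Omega> (\<lambda>x. \<phi> n x - z x)) \<longlonglongrightarrow> 0"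
    by (rule L2_complete[OF lmeasurable \<phi>L2 Cauchy0]) (assumption, rule that)
  note zH = H10_limitI[OF z(1) G(1) \<phi> z(2) G(2)]
  \<comment> \<open>The residual at a fixed \<open>\<psi>\<close> has two limits: the one with
    \<open>G\<close> inserted, by L2 continuity, and 0, by the residual bound.\<close>
  have test: "energy G (classical_grad \<psi>) = L2_inner \<Omega> g \<psi>" if \<psi>: "\<psi> \<in> test_functions \<Omega>" for \<psi>
  proof -
    note \<psi>L2 = test_functions_grad_L2[OF \<psi>]
    let ?r = "\<lambda>n. energy (classical_grad (\<phi> n)) (classical_grad \<psi>) - L2_inner \<Omega> g \<psi>"
    have "?r \<longlonglongrightarrow> energy G (classical_grad \<psi>) - L2_inner \<Omega> g \<psi>"
      unfolding energy_eq_right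
      by (intro tendsto_diff tendsto_const L2_inner_tendsto gradL2 G nu_scaleR_L2 \<psi>L2)
    then have "(\<lambda>n. (?r n)\<^sup>2) \<longlonglongrightarrow> (energy G (classical_grad \<psi>) - L2_inner \<Omega> g \<psi>)\<^sup>2"
      by (rule tendsto_power)
    moreover have "(\<lambda>n. (?r n)\<^sup>2) \<longlonglongrightarrow> 0"
    proof (rule tendsto_0_squeeze)
      have "(\<lambda>n. 2 * energy (classical_grad \<psi>) (classical_grad \<psi>) * inverse (real (Suc n))) \<longlonglongrightarrow> 
          2 * energy (classical_grad \<psi>) (classical_grad \<psi>) * 0"
        by (rule tendsto_mult_left[OF LIMSEQ_inverse_real_of_nat])
      then show "(\<lambda>n. 2 / real (Suc n) * energy (classical_grad \<psi>) (classical_grad \<psi>)) \<longlonglongrightarrow> 0"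
        by (simp add: field_simps)
    qed (use res[OF \<psi>] in simp_all)
    ultimately have "(energy G (classical_grad \<psi>) - L2_inner \<Omega> g \<psi>)\<^sup>2 = 0"
      by (rule LIMSEQ_unique)
    then show ?thesis by simp
  qed
  have "energy (wgrad \<Omega> z) (wgrad \<Omega> w) = L2_inner \<Omega> g w" if w: "w \<in> H10_space \<Omega>" for w
  proof -
    obtain \<psi> where \<psi>: "\<And>n. \<psi> n \<in> test_functions \<Omega>"
      "(\<lambda>n. L2_norm \<Omega> (\<lambda>x. \<psi> n x - w x)) \<longlonglongrightarrow> 0"
      "(\<lambda>n. L2_norm \<Omega> (\<lambda>x. classical_grad (\<psi> n) x - wgrad \<Omega> w x)) \<longlonglongrightarrow> 0"
      using H10_approx[OF w] by blast
    have "(\<lambda>n. L2_inner \<Omega> (classical_grad (\<psi> n)) (\<lambda>x. \<nu> x *\<^sub>R G x)) \<longlonglongrightarrow>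
        L2_inner \<Omega> (wgrad \<Omega> w) (\<lambda>x. \<nu> x *\<^sub>R G x)"
      by (intro L2_inner_tendsto test_functions_grad_L2 \<psi> H10_wgrad_L2 w nu_scaleR_L2 G)
    moreover have "L2_inner \<Omega> (classical_grad (\<psi> n)) (\<lambda>x. \<nu> x *\<^sub>R G x) = L2_inner \<Omega> (\<psi> n) g" for n
      using test[OF \<psi>(1)[of n]]
      by (simp add: energy_def L2_inner_commute[of \<Omega> "classical_grad (\<psi> n)"] L2_inner_commute[of \<Omega> "\<psi> n"])
    ultimately have "(\<lambda>n. L2_inner \<Omega> (\<psi> n) g) \<longlonglongrightarrow> L2_inner \<Omega> (wgrad \<Omega> w) (\<lambda>x. \<nu> x *\<^sub>R G x)"
      by simp
    moreover have "(\<lambda>n. L2_inner \<Omega> (\<psi> n) g) \<longlonglongrightarrow> L2_inner \<Omega> w g"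
      by (intro L2_inner_tendsto test_functions_L2 \<psi> H10_L2 w g)
    ultimately have "L2_inner \<Omega> (wgrad \<Omega> w) (\<lambda>x. \<nu> x *\<^sub>R G x) = L2_inner \<Omega> w g"
      by (rule LIMSEQ_unique)
    moreover have "energy (wgrad \<Omega> z) (wgrad \<Omega> w) = energy (wgrad \<Omega> w) G"
      unfolding energy_commute[of "wgrad \<Omega> z"] unfolding energy_def using zH(2)
      by (intro L2_inner_cong_AE nu_scaleR_L2 H10_wgrad_L2 w zH(1) G(1)) auto
    ultimately show ?thesis
      by (simp add: energy_eq_right L2_inner_commute[of \<Omega> w])
  qed
  then have "is_weak_solution \<Omega> \<nu> g z" using zH(1) by (simp add: is_weak_solution_iff)
  then show ?thesis by (rule exI[of _ z])
qed

end

subsection \<open>The minorant\<close>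

context bounded_open_set begin

text \<open>The sign of \<open>v x\<close> decides which of the two bounds dominates it in absolute
  value; the sum of their squares works in both cases.\<close>

lemma AE_between_L2_space:
  fixes a b v :: "'a \<Rightarrow> real"
  assumes ab: "a \<in> L2_space \<Omega>" "b \<in> L2_space \<Omega>" and v: "v \<in> borel_measurable (lebesgue_on \<Omega>)"
    and AE: "AE x in lebesgue_on \<Omega>. a x \<le> v x \<and> v x \<le> b x"
  shows "v \<in> L2_space \<Omega>"
proof (rule L2_spaceI[OF v])
  show "integrable (lebesgue_on \<Omega>) (\<lambda>x. v x \<bullet> v x)"
  proof (rule Bochner_Integration.integrable_bound)
    show "integrable (lebesgue_on \<Omega>) (\<lambda>x. a x \<bullet> a x + b x \<bullet> b x)"
      by (intro Bochner_Integration.integrable_add L2_integrable_inner ab)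
    show "(\<lambda>x. v x \<bullet> v x) \<in> borel_measurable (lebesgue_on \<Omega>)"
      by (intro borel_measurable_inner v)
    show "AE x in lebesgue_on \<Omega>. norm (v x \<bullet> v x) \<le> norm (a x \<bullet> a x + b x \<bullet> b x)"
      using AE
    proof eventually_elim
      case (elim x)
      have "(v x)\<^sup>2 \<le> (a x)\<^sup>2 + (b x)\<^sup>2"
      proof (cases "0 \<le> v x")
        case True
        then have "(v x)\<^sup>2 \<le> (b x)\<^sup>2" using elim by (intro power_mono) auto
        then show ?thesis using zero_le_power2[of "a x"] by linarith
      next
        case False
        then have "(- v x)\<^sup>2 \<le> (- a x)\<^sup>2" using elim by (intro power_mono) auto
        then show ?thesis using zero_le_power2[of "b x"] by (simp only: power2_minus)
      qed
      then show ?case by (simp add: power2_eq_square)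
    qed
  qed
qed

lemma projected_control_admissible:
  assumes "ud \<in> L2_space \<Omega>" "ua \<in> L2_space \<Omega>" "ub \<in> L2_space \<Omega>" "\<zeta> \<in> L2_space \<Omega>"
    and le: "AE x in lebesgue_on \<Omega>. ua x \<le> ub x"
  shows "projected_control lam ud ua ub \<zeta> \<in> admissible_controls \<Omega> ua ub"
proof -
  have AE: "AE x in lebesgue_on \<Omega>. ua x \<le> projected_control lam ud ua ub \<zeta> x \<and>
      projected_control lam ud ua ub \<zeta> x \<le> ub x"
    using le by eventually_elim (simp add: projected_control_def)
  have "projected_control lam ud ua ub \<zeta> \<in> borel_measurable (lebesgue_on \<Omega>)"
    unfolding projected_control_def[abs_def]
    by (intro borel_measurable_min borel_measurable_max borel_measurable_diff borel_measurable_times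
        borel_measurable_const L2_space_measurable assms)
  from AE_between_L2_space[OF assms(2,3) this AE] show ?thesis
    using AE by (simp add: admissible_controls_def)
qed

text \<open>The projected control minimizes \<open>v \<mapsto> lam/2 (v - ud)\<^sup>2 + v \<zeta>\<close> pointwise over
  \<open>[ua, ub]\<close>; this is the corresponding variational inequality.\<close>

lemma projected_control_variational_inequality:
  assumes lam: "lam > 0"
    and L2: "ud \<in> L2_space \<Omega>" "ua \<in> L2_space \<Omega>" "ub \<in> L2_space \<Omega>" "\<zeta> \<in> L2_space \<Omega>"
    and v: "v \<in> admissible_controls \<Omega> ua ub"
  defines "vz \<equiv> projected_control lam ud ua ub \<zeta>"
  shows "0 \<le> L2_inner \<Omega> (\<lambda>x. lam * (vz x - ud x) + \<zeta> x) (\<lambda>x. v x - vz x)"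
  unfolding L2_inner_def
proof (rule integral_nonneg_AE)
  have "AE x in lebesgue_on \<Omega>. ua x \<le> v x \<and> v x \<le> ub x"
    using v by (simp add: admissible_controls_def)
  then show "AE x in lebesgue_on \<Omega>. 0 \<le> (lam * (vz x - ud x) + \<zeta> x) \<bullet> (v x - vz x)"
  proof eventually_elim
    case (elim x)
    define s where "s = ud x - 1 / lam * \<zeta> x"
    have lin: "lam * (vz x - ud x) + \<zeta> x = lam * (vz x - s)"
      using lam by (simp add: s_def field_simps)
    have "0 \<le> (vz x - s) * (v x - vz x)"
    proof -
      have "vz x = min (ub x) (max (ua x) s)"
        by (simp add: vz_def projected_control_def s_def)
      \<comment> \<open>Either the truncation is inactive, or \<open>vz x\<close> is one of the
        bounds with s beyond it and \<open>v x\<close> on the other side; the two factors then have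
        equal signs.\<close>
      then consider "vz x = s" | "vz x = ua x" "s \<le> vz x" | "vz x = ub x" "vz x \<le> s"
        using elim by (auto simp: min_def max_def split: if_splits)
      then show ?thesis
        by cases (use elim in \<open>auto intro: mult_nonneg_nonneg mult_nonpos_nonpos\<close>)
    qed
    then show ?case using lam unfolding lin by (simp add: mult.assoc)
  qed
qed

end

context diffusion_problem begin

section \<open>Residual estimates and the lower bound\<close>

lemma energy_diff_right:
  "G \<in> L2_space \<Omega> \<Longrightarrow> H \<in> L2_space \<Omega> \<Longrightarrow> K \<in> L2_space \<Omega> \<Longrightarrow>
    energy G (\<lambda>x. H x - K x) = energy G H - energy G K"
  using energy_diff_left[of G H K] by (simp only: energy_commute[of G])

lemma energy_wgrad_diff_right:
  assumes G: "G \<in> L2_space \<Omega>" and w: "w \<in> H10_space \<Omega>" and z: "z \<in> H10_space \<Omega>"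
  shows "energy G (wgrad \<Omega> (\<lambda>x. w x - z x)) = energy G (\<lambda>x. wgrad \<Omega> w x - wgrad \<Omega> z x)"
  unfolding energy_def using H10_diff(2)[OF w z]
  by (intro L2_inner_cong_AE nu_scaleR_L2 G H10_wgrad_L2 H10_diff(1) w z L2_space_diff) auto

lemma L2_norm_H10_diff_le:
  assumes w: "w \<in> H10_space \<Omega>" and z: "z \<in> H10_space \<Omega>"
  shows "L2_norm \<Omega> (\<lambda>x. w x - z x) \<le> CF * L2_norm \<Omega> (\<lambda>x. wgrad \<Omega> w x - wgrad \<Omega> z x)"
proof -
  have "L2_norm \<Omega> (wgrad \<Omega> (\<lambda>x. w x - z x)) = L2_norm \<Omega> (\<lambda>x. wgrad \<Omega> w x - wgrad \<Omega> z x)"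
    using H10_diff(2)[OF w z]
    by (intro L2_norm_cong_AE L2_space_diff H10_wgrad_L2 H10_diff(1) w z)
  then show ?thesis using Friedrichs[OF H10_diff(1)[OF w z]] by simp
qed

lemma Hdiv_integration_by_parts_diff:
  assumes \<tau>: "\<tau> \<in> Hdiv_space \<Omega>" and w: "w \<in> H10_space \<Omega>" and z: "z \<in> H10_space \<Omega>"
  shows "L2_inner \<Omega> \<tau> (\<lambda>x. wgrad \<Omega> w x - wgrad \<Omega> z x) = - L2_inner \<Omega> (wdiv \<Omega> \<tau>) (\<lambda>x. w x - z x)"
  using Hdiv_integration_by_parts[OF \<tau> w] Hdiv_integration_by_parts[OF \<tau> z]
  by (simp add: L2_inner_diff_right Hdiv_L2[OF \<tau>] wdiv_L2[OF \<tau>] H10_wgrad_L2 H10_L2 w z)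

text \<open>Integration by parts allows any \<open>\<tau>\<close> to be added to the weak residual
  at no cost. This splits it into an equilibrium residual, paired with w - z, and a flux residual,
  paired with the gradient; the factor \<open>CF\<close> comes from the Friedrichs inequality in the
  first pairing. It is applied to the state equation at \<eta> and to the adjoint equation at
  \<zeta>.\<close>

lemma residual_bound:
  assumes \<tau>: "\<tau> \<in> Hdiv_space \<Omega>" and g: "g \<in> L2_space \<Omega>" and G: "G \<in> L2_space \<Omega>"
    and w: "w \<in> H10_space \<Omega>" and z: "z \<in> H10_space \<Omega>"
  defines "W \<equiv> \<lambda>x. wgrad \<Omega> w x - wgrad \<Omega> z x"
  shows "\<bar>L2_inner \<Omega> g (\<lambda>x. w x - z x) - energy G W\<bar> \<le>
    (CF * L2_norm \<Omega> (\<lambda>x. g x + wdiv \<Omega> \<tau> x) + L2_norm \<Omega> (\<lambda>x. \<tau> x - \<nu> x *\<^sub>R G x)) * L2_norm \<Omega> W"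
proof -
  let ?w = "\<lambda>x. w x - z x" and ?r = "\<lambda>x. g x + wdiv \<Omega> \<tau> x" and ?q = "\<lambda>x. \<tau> x - \<nu> x *\<^sub>R G x"
  have L2: "?w \<in> L2_space \<Omega>" "W \<in> L2_space \<Omega>" "?r \<in> L2_space \<Omega>" "?q \<in> L2_space \<Omega>"
    unfolding W_def
    by (intro L2_space_diff L2_space_add H10_L2 H10_wgrad_L2 w z g wdiv_L2 Hdiv_L2 \<tau> nu_scaleR_L2 G)+
  have "L2_inner \<Omega> g ?w - energy G W = L2_inner \<Omega> ?r ?w + L2_inner \<Omega> ?q W"
    using Hdiv_integration_by_parts_diff[OF \<tau> w z] unfolding W_def[symmetric]
    by (simp add: energy_def L2_inner_add_left[OF g wdiv_L2[OF \<tau>] L2(1)]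
        L2_inner_diff_left[OF Hdiv_L2[OF \<tau>] nu_scaleR_L2[OF G] L2(2)])
  moreover have "\<bar>L2_inner \<Omega> ?r ?w\<bar> \<le> L2_norm \<Omega> ?r * (CF * L2_norm \<Omega> W)"
    using L2_norm_H10_diff_le[OF w z] unfolding W_def[symmetric]
    by (intro order_trans[OF L2_Cauchy_Schwarz[OF L2(3,1)]] mult_left_mono) simp_all
  moreover have "\<bar>L2_inner \<Omega> ?q W\<bar> \<le> L2_norm \<Omega> ?q * L2_norm \<Omega> W"
    by (rule L2_Cauchy_Schwarz[OF L2(4,2)])
  ultimately show ?thesis by (simp add: algebra_simps)
qed

text \<open>The first two terms of the last bracket are a multiple of the factor in front of it.
  Thus the correction depends only on two residual majorants, named \<open>A\<close> for the adjoint
  and \<open>D\<close> for the state equation in the next proof.\<close>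

lemma minorant_eq:
  "minorant \<Omega> \<nu> \<nu>l CF lam f yd ud \<eta> \<zeta> \<tau> \<rho> v =
    1 / 2 * L2_inner \<Omega> (\<lambda>x. \<eta> x - yd x) (\<lambda>x. \<eta> x - yd x) +
    lam / 2 * L2_inner \<Omega> (\<lambda>x. v x - ud x) (\<lambda>x. v x - ud x) +
    L2_inner \<Omega> (\<lambda>x. f x + v x + wdiv \<Omega> \<tau> x) \<zeta> +
    L2_inner \<Omega> (\<lambda>x. \<tau> x - \<nu> x *\<^sub>R wgrad \<Omega> \<eta> x) (wgrad \<Omega> \<zeta>) -
    1 / \<nu>l * (CF * L2_norm \<Omega> (\<lambda>x. \<eta> x - yd x + wdiv \<Omega> \<rho> x) + L2_norm \<Omega> (\<lambda>x. \<rho> x - \<nu> x *\<^sub>R wgrad \<Omega> \<zeta> x)) *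
    (CF\<^sup>2 / (lam * \<nu>l) * (CF * L2_norm \<Omega> (\<lambda>x. \<eta> x - yd x + wdiv \<Omega> \<rho> x) + L2_norm \<Omega> (\<lambda>x. \<rho> x - \<nu> x *\<^sub>R wgrad \<Omega> \<zeta> x)) +
     (CF * L2_norm \<Omega> (\<lambda>x. f x + v x + wdiv \<Omega> \<tau> x) + L2_norm \<Omega> (\<lambda>x. \<tau> x - \<nu> x *\<^sub>R wgrad \<Omega> \<eta> x)))"
proof -
  have "CF ^ 3 / (lam * \<nu>l) * r1 + CF\<^sup>2 / (lam * \<nu>l) * r2 + CF * r3 + r4 =
      CF\<^sup>2 / (lam * \<nu>l) * (CF * r1 + r2) + (CF * r3 + r4)" for r1 r2 r3 r4 :: real
    by (simp add: power2_eq_square power3_eq_cube distrib_left)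
  then show ?thesis
    by (simp only: minorant_def Let_def L2_norm_square) (simp add: L2_inner_def)
qed

theorem minorant_le_cost:
  assumes lam: "lam > 0"
    and data: "yd \<in> L2_space \<Omega>" "ud \<in> L2_space \<Omega>" "f \<in> L2_space \<Omega>"
    and bounds: "ua \<in> L2_space \<Omega>" "ub \<in> L2_space \<Omega>" "AE x in lebesgue_on \<Omega>. ua x \<le> ub x"
    and v: "v \<in> admissible_controls \<Omega> ua ub"
    and y: "is_weak_solution \<Omega> \<nu> (\<lambda>x. f x + v x) y"
    and \<eta>: "\<eta> \<in> H10_space \<Omega>" and \<zeta>: "\<zeta> \<in> H10_space \<Omega>"
    and \<tau>: "\<tau> \<in> Hdiv_space \<Omega>" and \<rho>: "\<rho> \<in> Hdiv_space \<Omega>"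
  shows "minorant \<Omega> \<nu> \<nu>l CF lam f yd ud \<eta> \<zeta> \<tau> \<rho> (projected_control lam ud ua ub \<zeta>) \<le> cost \<Omega> lam yd ud y v"
proof -
  define vz where "vz = projected_control lam ud ua ub \<zeta>"
  have vL2: "v \<in> L2_space \<Omega>" using v by (simp add: admissible_controls_def)
  have vzL2: "vz \<in> L2_space \<Omega>"
    using projected_control_admissible[OF data(2) bounds(1,2) H10_L2[OF \<zeta>] bounds(3)]
    by (simp add: admissible_controls_def vz_def)
  have yH: "y \<in> H10_space \<Omega>" using y by (simp add: is_weak_solution_iff)
  have weak: "energy (wgrad \<Omega> y) (wgrad \<Omega> w) = L2_inner \<Omega> (\<lambda>x. f x + v x) w"
    if "w \<in> H10_space \<Omega>" for w using y that by (simp add: is_weak_solution_iff)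
  define W where "W = (\<lambda>x. wgrad \<Omega> y x - wgrad \<Omega> \<eta> x)"
  let ?w = "\<lambda>x. y x - \<eta> x"
  define s where "s = L2_norm \<Omega> (\<lambda>x. v x - vz x)"
  define A where "A = CF * L2_norm \<Omega> (\<lambda>x. \<eta> x - yd x + wdiv \<Omega> \<rho> x) + L2_norm \<Omega> (\<lambda>x. \<rho> x - \<nu> x *\<^sub>R wgrad \<Omega> \<zeta> x)"
  define D where "D = CF * L2_norm \<Omega> (\<lambda>x. f x + vz x + wdiv \<Omega> \<tau> x) + L2_norm \<Omega> (\<lambda>x. \<tau> x - \<nu> x *\<^sub>R wgrad \<Omega> \<eta> x)"
  define N where "N = L2_norm \<Omega> W"
  note L2 = data vL2 vzL2 H10_L2[OF yH] H10_L2[OF \<eta>] H10_L2[OF \<zeta>]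
    H10_wgrad_L2[OF yH] H10_wgrad_L2[OF \<eta>] H10_wgrad_L2[OF \<zeta>]
    nu_scaleR_L2[OF H10_wgrad_L2[OF \<eta>]] nu_scaleR_L2[OF H10_wgrad_L2[OF \<zeta>]]
    wdiv_L2[OF \<tau>] wdiv_L2[OF \<rho>] Hdiv_L2[OF \<tau>] Hdiv_L2[OF \<rho>]
  have WL2: "W \<in> L2_space \<Omega>" unfolding W_def by (intro L2_space_diff L2)
  have wL2: "?w \<in> L2_space \<Omega>" by (intro L2_space_diff L2)
  have fvL2: "(\<lambda>x. f x + v x) \<in> L2_space \<Omega>" "(\<lambda>x. f x + vz x) \<in> L2_space \<Omega>"
    by (intro L2_space_add L2)+
  have dL2: "(\<lambda>x. v x - vz x) \<in> L2_space \<Omega>" by (intro L2_space_diff L2)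
  have s0: "0 \<le> s" "0 \<le> N" "0 \<le> A" "0 \<le> D"
    using CF_pos by (simp_all add: s_def N_def A_def D_def)
  have wN: "L2_norm \<Omega> ?w \<le> CF * N"
    unfolding N_def W_def by (rule L2_norm_H10_diff_le[OF yH \<eta>])

  \<comment> \<open>The state equation is tested with y - \<eta>. Coercivity gives N squared on the
    left, and each term on the right carries one factor N, which cancels unless N = 0; in that case
    the right-hand side only has to be nonnegative.\<close>
  have energy_error: "\<nu>l * N \<le> CF * s + D"
  proof -
    have "energy W W = energy (wgrad \<Omega> y) W - energy (wgrad \<Omega> \<eta>) W"
      unfolding W_def by (intro energy_diff_left L2_space_diff L2)
    also have "energy (wgrad \<Omega> y) W = L2_inner \<Omega> (\<lambda>x. f x + v x) ?w"
      unfolding W_def energy_wgrad_diff_right[OF H10_wgrad_L2[OF yH] yH \<eta>, symmetric]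
      by (rule weak[OF H10_diff(1)[OF yH \<eta>]])
    also have "\<dots> = L2_inner \<Omega> (\<lambda>x. v x - vz x) ?w + L2_inner \<Omega> (\<lambda>x. f x + vz x) ?w"
      by (simp add: L2_inner_add_left L2_inner_diff_left L2 wL2)
    finally have "energy W W = L2_inner \<Omega> (\<lambda>x. v x - vz x) ?w +
        (L2_inner \<Omega> (\<lambda>x. f x + vz x) ?w - energy (wgrad \<Omega> \<eta>) W)" by simp
    moreover have "\<bar>L2_inner \<Omega> (\<lambda>x. f x + vz x) ?w - energy (wgrad \<Omega> \<eta>) W\<bar> \<le> D * N"
      using residual_bound[OF \<tau> fvL2(2) H10_wgrad_L2[OF \<eta>] yH \<eta>] unfolding D_def N_def W_def .
    moreover have "\<bar>L2_inner \<Omega> (\<lambda>x. v x - vz x) ?w\<bar> \<le> s * (CF * N)"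
      unfolding s_def by (intro order_trans[OF L2_Cauchy_Schwarz[OF dL2 wL2]] mult_left_mono wN) simp
    moreover have "\<nu>l * N\<^sup>2 \<le> energy W W" unfolding N_def by (rule energy_coercive[OF WL2])
    ultimately have "\<nu>l * N\<^sup>2 \<le> s * (CF * N) + D * N" by linarith
    then have "(\<nu>l * N) * N \<le> (CF * s + D) * N" by (simp add: power2_eq_square algebra_simps)
    then show ?thesis
      using s0 CF_pos by (cases "N = 0") (simp_all add: mult_le_cancel_right)
  qed

  have R: "\<bar>L2_inner \<Omega> (\<lambda>x. \<eta> x - yd x) ?w - energy (wgrad \<Omega> \<zeta>) W\<bar> \<le> A * N"
    using residual_bound[OF \<rho> L2_space_diff[OF H10_L2[OF \<eta>] data(1)] H10_wgrad_L2[OF \<zeta>] yH \<eta>]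
    unfolding A_def N_def W_def .
  \<comment> \<open>Testing the state equation with \<zeta> replaces the unknown y in this term by
    the data and the control \<open>v\<close>.\<close>
  have "energy (wgrad \<Omega> \<zeta>) W = energy (wgrad \<Omega> \<zeta>) (wgrad \<Omega> y) - energy (wgrad \<Omega> \<zeta>) (wgrad \<Omega> \<eta>)"
    unfolding W_def by (intro energy_diff_right L2)
  also have "energy (wgrad \<Omega> \<zeta>) (wgrad \<Omega> y) = L2_inner \<Omega> (\<lambda>x. f x + v x) \<zeta>"
    using weak[OF \<zeta>] by (simp only: energy_commute)
  finally have en\<zeta>: "energy (wgrad \<Omega> \<zeta>) W = L2_inner \<Omega> f \<zeta> + L2_inner \<Omega> v \<zeta> - energy (wgrad \<Omega> \<eta>) (wgrad \<Omega> \<zeta>)"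
    by (simp add: L2_inner_add_left L2 energy_commute[of "wgrad \<Omega> \<zeta>"])

  \<comment> \<open>The square is expanded around \<open>vz\<close>. Together with the increment of
    the linear term, the cross term is nonnegative by the variational inequality, and lam/2 s^2
    remains.\<close>
  have control: "lam / 2 * L2_inner \<Omega> (\<lambda>x. v x - ud x) (\<lambda>x. v x - ud x) + L2_inner \<Omega> v \<zeta> \<ge>
      lam / 2 * L2_inner \<Omega> (\<lambda>x. vz x - ud x) (\<lambda>x. vz x - ud x) + L2_inner \<Omega> vz \<zeta> + lam / 2 * s\<^sup>2"
  proof -
    let ?e = "\<lambda>x. vz x - ud x" and ?d = "\<lambda>x. v x - vz x"
    have eL2: "?e \<in> L2_space \<Omega>" by (intro L2_space_diff L2)
    have VI: "0 \<le> lam * L2_inner \<Omega> ?e ?d + L2_inner \<Omega> \<zeta> ?d"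
      using projected_control_variational_inequality[OF lam data(2) bounds(1,2) H10_L2[OF \<zeta>] v]
      unfolding vz_def[symmetric]
      by (simp only: L2_inner_add_left[OF L2_space_cmult[OF eL2] H10_L2[OF \<zeta>] dL2] L2_inner_cmult_left)
    have "(\<lambda>x. v x - ud x) = (\<lambda>x. ?e x + ?d x)" by auto
    then have "L2_inner \<Omega> (\<lambda>x. v x - ud x) (\<lambda>x. v x - ud x) =
        L2_inner \<Omega> (\<lambda>x. ?e x + ?d x) (\<lambda>x. ?e x + ?d x)" by simp
    also have "\<dots> = L2_inner \<Omega> ?e ?e + 2 * L2_inner \<Omega> ?e ?d + s\<^sup>2"
      using L2_inner_add_left[OF eL2 dL2 L2_space_add[OF eL2 dL2]]
        L2_inner_add_right[OF eL2 dL2 eL2] L2_inner_add_right[OF eL2 dL2 dL2]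
        L2_inner_commute[of \<Omega> ?d ?e] by (simp only: s_def L2_norm_square)
    finally have sq: "L2_inner \<Omega> (\<lambda>x. v x - ud x) (\<lambda>x. v x - ud x) =
        L2_inner \<Omega> ?e ?e + 2 * L2_inner \<Omega> ?e ?d + s\<^sup>2" .
    have "L2_inner \<Omega> \<zeta> ?d = L2_inner \<Omega> v \<zeta> - L2_inner \<Omega> vz \<zeta>"
      using L2_inner_diff_left[OF vL2 vzL2 H10_L2[OF \<zeta>]] by (simp only: L2_inner_commute[of \<Omega> \<zeta>])
    with VI show ?thesis unfolding sq by (simp add: algebra_simps)
  qed

  have "L2_inner \<Omega> (\<lambda>x. y x - yd x) (\<lambda>x. y x - yd x) =
      L2_inner \<Omega> (\<lambda>x. (\<eta> x - yd x) + ?w x) (\<lambda>x. (\<eta> x - yd x) + ?w x)" by simp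
  also have "\<dots> = L2_inner \<Omega> (\<lambda>x. \<eta> x - yd x) (\<lambda>x. \<eta> x - yd x) + 2 * L2_inner \<Omega> (\<lambda>x. \<eta> x - yd x) ?w
      + L2_inner \<Omega> ?w ?w"
  proof -
    let ?e = "\<lambda>x. \<eta> x - yd x"
    have eL2: "?e \<in> L2_space \<Omega>" by (intro L2_space_diff L2)
    show ?thesis
      using L2_inner_add_left[OF eL2 wL2 L2_space_add[OF eL2 wL2]]
        L2_inner_add_right[OF eL2 wL2 eL2] L2_inner_add_right[OF eL2 wL2 wL2]
        L2_inner_commute[of \<Omega> ?w ?e] by linarith
  qed
  \<comment> \<open>The square of the norm of y - \<eta> is dropped.\<close>
  finally have state: "L2_inner \<Omega> (\<lambda>x. \<eta> x - yd x) (\<lambda>x. \<eta> x - yd x) + 2 * L2_inner \<Omega> (\<lambda>x. \<eta> x - yd x) ?w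
      \<le> L2_inner \<Omega> (\<lambda>x. y x - yd x) (\<lambda>x. y x - yd x)"
    using L2_inner_self_nonneg[of \<Omega> ?w] by linarith

  \<comment> \<open>The two terms containing \<open>\<tau>\<close> cancel by integration by parts
    with \<zeta>, so \<open>\<tau>\<close> enters the minorant only through
    \<open>D\<close>.\<close>
  have "L2_inner \<Omega> (\<lambda>x. f x + vz x + wdiv \<Omega> \<tau> x) \<zeta> +
      L2_inner \<Omega> (\<lambda>x. \<tau> x - \<nu> x *\<^sub>R wgrad \<Omega> \<eta> x) (wgrad \<Omega> \<zeta>) =
      L2_inner \<Omega> f \<zeta> + L2_inner \<Omega> vz \<zeta> - energy (wgrad \<Omega> \<eta>) (wgrad \<Omega> \<zeta>)"
    using Hdiv_integration_by_parts[OF \<tau> \<zeta>]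
    by (simp add: L2_inner_add_left L2_inner_diff_left L2 fvL2 energy_def)
  then have min: "minorant \<Omega> \<nu> \<nu>l CF lam f yd ud \<eta> \<zeta> \<tau> \<rho> vz =
      1 / 2 * L2_inner \<Omega> (\<lambda>x. \<eta> x - yd x) (\<lambda>x. \<eta> x - yd x) +
      lam / 2 * L2_inner \<Omega> (\<lambda>x. vz x - ud x) (\<lambda>x. vz x - ud x) +
      L2_inner \<Omega> f \<zeta> + L2_inner \<Omega> vz \<zeta> - energy (wgrad \<Omega> \<eta>) (wgrad \<Omega> \<zeta>) -
      1 / \<nu>l * A * (CF\<^sup>2 / (lam * \<nu>l) * A + D)"
    unfolding minorant_eq A_def D_def by linarith

  have "0 \<le> lam / 2 * s\<^sup>2 - A * N + 1 / \<nu>l * A * (CF\<^sup>2 / (lam * \<nu>l) * A + D)"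
  proof -
    \<comment> \<open>With the bound on N, the loss A N is at most k s + A D /
      \<open>\<nu>l\<close>. The correction in the minorant is k^2/lam + A D /
      \<open>\<nu>l\<close>, so it remains to absorb k s: completing the square in s consumes k^2/(2
      lam) and leaves a surplus of the same size.\<close>
    define k where "k = A * CF / \<nu>l"
    have "N \<le> (CF * s + D) / \<nu>l"
      using energy_error nu_lower_pos by (simp add: pos_le_divide_eq mult.commute)
    then have "A * N \<le> A * ((CF * s + D) / \<nu>l)" using s0 by (intro mult_left_mono)
    also have "\<dots> = k * s + 1 / \<nu>l * A * D" by (simp add: k_def add_divide_distrib algebra_simps)
    finally have AN: "A * N \<le> k * s + 1 / \<nu>l * A * D" .
    have "1 / \<nu>l * A * (CF\<^sup>2 / (lam * \<nu>l) * A + D) = k\<^sup>2 / lam + 1 / \<nu>l * A * D"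
      by (simp add: k_def power2_eq_square algebra_simps)
    moreover have "lam / 2 * s\<^sup>2 - k * s + k\<^sup>2 / lam = (lam * s - k)\<^sup>2 / (2 * lam) + k\<^sup>2 / (2 * lam)"
      using lam by (simp add: field_simps power2_eq_square)
    moreover have "0 \<le> (lam * s - k)\<^sup>2 / (2 * lam) + k\<^sup>2 / (2 * lam)" using lam by simp
    ultimately show ?thesis using AN by linarith
  qed
  then have "minorant \<Omega> \<nu> \<nu>l CF lam f yd ud \<eta> \<zeta> \<tau> \<rho> vz \<le> cost \<Omega> lam yd ud y v"
    unfolding min cost_def L2_norm_square using R en\<zeta> control state by (simp only: abs_le_iff) linarith
  then show ?thesis by (simp add: vz_def)
qed

end

subsection \<open>The optimality system\<close>

context diffusion_problem begin

text \<open>Both controls satisfy a variational inequality with the same \<open>p\<close>. Testing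
  each inequality with the other control and subtracting leaves lam times the squared distance,
  which must be at most 0.\<close>

lemma optimality_system_projected_control:
  assumes lam: "lam > 0"
    and L2: "ud \<in> L2_space \<Omega>" "ua \<in> L2_space \<Omega>" "ub \<in> L2_space \<Omega>"
    and le: "AE x in lebesgue_on \<Omega>. ua x \<le> ub x"
    and os: "optimality_system \<Omega> \<nu> lam f yd ud ua ub y u p"
  shows "AE x in lebesgue_on \<Omega>. projected_control lam ud ua ub p x = u x"
proof -
  define vz where "vz = projected_control lam ud ua ub p"
  have u: "u \<in> admissible_controls \<Omega> ua ub" and pH: "p \<in> H10_space \<Omega>"
    using os by (simp_all add: optimality_system_def is_weak_solution_def)
  note pL2 = H10_L2[OF pH]
  have vz: "vz \<in> admissible_controls \<Omega> ua ub"
    unfolding vz_def by (rule projected_control_admissible[OF L2 pL2 le])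
  have uL2: "u \<in> L2_space \<Omega>" and vzL2: "vz \<in> L2_space \<Omega>"
    using u vz by (simp_all add: admissible_controls_def)
  let ?d = "\<lambda>x. u x - vz x"
  have dL2: "?d \<in> L2_space \<Omega>" by (intro L2_space_diff uL2 vzL2)
  have gL2: "(\<lambda>x. lam * (vz x - ud x) + p x) \<in> L2_space \<Omega>"
    "(\<lambda>x. p x + lam * (u x - ud x)) \<in> L2_space \<Omega>"
    by (intro L2_space_add L2_space_cmult L2_space_diff uL2 vzL2 pL2 L2)+
  have 1: "0 \<le> L2_inner \<Omega> (\<lambda>x. lam * (vz x - ud x) + p x) ?d"
    unfolding vz_def by (rule projected_control_variational_inequality[OF lam L2 pL2 u])
  have "0 \<le> L2_inner \<Omega> (\<lambda>x. p x + lam * (u x - ud x)) (\<lambda>x. vz x - u x)"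
    using os vz by (simp add: optimality_system_def L2_inner_def)
  also have "(\<lambda>x. vz x - u x) = (\<lambda>x. (-1) * ?d x)" by auto
  finally have 2: "L2_inner \<Omega> (\<lambda>x. p x + lam * (u x - ud x)) ?d \<le> 0"
    unfolding L2_inner_cmult_right by simp
  have "L2_inner \<Omega> (\<lambda>x. p x + lam * (u x - ud x)) ?d - L2_inner \<Omega> (\<lambda>x. lam * (vz x - ud x) + p x) ?d =
      L2_inner \<Omega> (\<lambda>x. (p x + lam * (u x - ud x)) - (lam * (vz x - ud x) + p x)) ?d"
    by (rule L2_inner_diff_left[OF gL2(2,1) dL2, symmetric])
  also have "(\<lambda>x. (p x + lam * (u x - ud x)) - (lam * (vz x - ud x) + p x)) = (\<lambda>x. lam * ?d x)"
    by (simp add: algebra_simps)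
  also have "L2_inner \<Omega> (\<lambda>x. lam * ?d x) ?d = lam * L2_inner \<Omega> ?d ?d" by (rule L2_inner_cmult_left)
  finally have "lam * L2_inner \<Omega> ?d ?d \<le> 0" using 1 2 by linarith
  then have "L2_inner \<Omega> ?d ?d = 0"
    using lam L2_inner_self_nonneg[of \<Omega> ?d] by (simp add: mult_le_0_iff)
  from L2_inner_self_eq_0_imp_AE[OF dL2 this] show ?thesis
    unfolding vz_def by eventually_elim simp
qed

text \<open>Restricted to test functions, the weak equation is the definition of the weak divergence
  of the flux. This supplies the fields that make the residuals vanish.\<close>

lemma flux_Hdiv:
  assumes g: "g \<in> L2_space \<Omega>" and z: "is_weak_solution \<Omega> \<nu> g z"
  shows "(\<lambda>x. \<nu> x *\<^sub>R wgrad \<Omega> z x) \<in> Hdiv_space \<Omega>"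
    "AE x in lebesgue_on \<Omega>. wdiv \<Omega> (\<lambda>x. \<nu> x *\<^sub>R wgrad \<Omega> z x) x = - g x"
proof -
  have zH: "z \<in> H10_space \<Omega>" using z by (simp add: is_weak_solution_def)
  note fL2 = nu_scaleR_L2[OF H10_wgrad_L2[OF zH]]
  have wd: "is_weak_div \<Omega> (\<lambda>x. \<nu> x *\<^sub>R wgrad \<Omega> z x) (\<lambda>x. - g x)"
    unfolding is_weak_div_def
  proof (intro conjI ballI L2_space_minus g)
    fix \<phi> assume \<phi>: "\<phi> \<in> test_functions \<Omega>"
    have "L2_inner \<Omega> (\<lambda>x. \<nu> x *\<^sub>R wgrad \<Omega> z x) (classical_grad \<phi>) = energy (wgrad \<Omega> z) (wgrad \<Omega> \<phi>)"
      unfolding energy_def using test_functions_H10(2)[OF \<phi>]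
      by (intro L2_inner_cong_AE fL2 test_functions_grad_L2 \<phi> H10_wgrad_L2 test_functions_H10(1)) auto
    also have "\<dots> = L2_inner \<Omega> g \<phi>"
      using z test_functions_H10(1)[OF \<phi>] by (simp add: is_weak_solution_iff)
    finally show "(LINT x|lebesgue_on \<Omega>. (\<nu> x *\<^sub>R wgrad \<Omega> z x) \<bullet> classical_grad \<phi> x) =
        - (LINT x|lebesgue_on \<Omega>. - g x * \<phi> x)"
      by (simp add: L2_inner_def)
  qed
  show "(\<lambda>x. \<nu> x *\<^sub>R wgrad \<Omega> z x) \<in> Hdiv_space \<Omega>"
    unfolding Hdiv_space_def using fL2 wd by blast
  show "AE x in lebesgue_on \<Omega>. wdiv \<Omega> (\<lambda>x. \<nu> x *\<^sub>R wgrad \<Omega> z x) x = - g x"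
    by (rule wdiv_eq_AE[OF wd])
qed

lemma minorant_optimality_system:
  assumes lam: "lam > 0"
    and data: "yd \<in> L2_space \<Omega>" "ud \<in> L2_space \<Omega>" "f \<in> L2_space \<Omega>"
    and bounds: "ua \<in> L2_space \<Omega>" "ub \<in> L2_space \<Omega>" "AE x in lebesgue_on \<Omega>. ua x \<le> ub x"
    and os: "optimality_system \<Omega> \<nu> lam f yd ud ua ub y u p"
  shows "minorant \<Omega> \<nu> \<nu>l CF lam f yd ud y p
      (\<lambda>x. \<nu> x *\<^sub>R wgrad \<Omega> y x) (\<lambda>x. \<nu> x *\<^sub>R wgrad \<Omega> p x) (projected_control lam ud ua ub p)
    = cost \<Omega> lam yd ud y u"
proof -
  let ?\<tau> = "\<lambda>x. \<nu> x *\<^sub>R wgrad \<Omega> y x" and ?\<rho> = "\<lambda>x. \<nu> x *\<^sub>R wgrad \<Omega> p x"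
  define vz where "vz = projected_control lam ud ua ub p"
  have u: "u \<in> admissible_controls \<Omega> ua ub"
    and y: "is_weak_solution \<Omega> \<nu> (\<lambda>x. f x + u x) y" and p: "is_weak_solution \<Omega> \<nu> (\<lambda>x. y x - yd x) p"
    using os by (simp_all add: optimality_system_def)
  have yH: "y \<in> H10_space \<Omega>" and pH: "p \<in> H10_space \<Omega>"
    using y p by (simp_all add: is_weak_solution_def)
  have uL2: "u \<in> L2_space \<Omega>" using u by (simp add: admissible_controls_def)
  have vzL2: "vz \<in> L2_space \<Omega>"
    using projected_control_admissible[OF data(2) bounds(1,2) H10_L2[OF pH] bounds(3)]
    by (simp add: admissible_controls_def vz_def)
  have fuL2: "(\<lambda>x. f x + u x) \<in> L2_space \<Omega>" and yydL2: "(\<lambda>x. y x - yd x) \<in> L2_space \<Omega>"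
    by (intro L2_space_add L2_space_diff data uL2 H10_L2[OF yH])+
  note \<tau> = flux_Hdiv[OF fuL2 y] and \<rho> = flux_Hdiv[OF yydL2 p]
  have vzu: "AE x in lebesgue_on \<Omega>. vz x = u x"
    unfolding vz_def by (rule optimality_system_projected_control[OF lam data(2) bounds os])
  have r1L2: "(\<lambda>x. y x - yd x + wdiv \<Omega> ?\<rho> x) \<in> L2_space \<Omega>"
    by (intro L2_space_add yydL2 wdiv_L2 \<rho>)
  have r1: "L2_norm \<Omega> (\<lambda>x. y x - yd x + wdiv \<Omega> ?\<rho> x) = 0"
  proof (rule L2_norm_eq_0_AE[OF r1L2])
    show "AE x in lebesgue_on \<Omega>. y x - yd x + wdiv \<Omega> ?\<rho> x = 0"
      using \<rho>(2) by eventually_elim simp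
  qed
  have r3L2: "(\<lambda>x. f x + vz x + wdiv \<Omega> ?\<tau> x) \<in> L2_space \<Omega>"
    by (intro L2_space_add data vzL2 wdiv_L2 \<tau>)
  have "AE x in lebesgue_on \<Omega>. f x + vz x + wdiv \<Omega> ?\<tau> x = 0"
    using \<tau>(2) vzu by eventually_elim simp
  then have r3: "L2_norm \<Omega> (\<lambda>x. f x + vz x + wdiv \<Omega> ?\<tau> x) = 0"
    by (rule L2_norm_eq_0_AE[OF r3L2])
  have r3': "L2_inner \<Omega> (\<lambda>x. f x + vz x + wdiv \<Omega> ?\<tau> x) p = 0"
    using L2_Cauchy_Schwarz[OF r3L2 H10_L2[OF pH]] r3 by simp
  have ctrl: "L2_inner \<Omega> (\<lambda>x. vz x - ud x) (\<lambda>x. vz x - ud x) = L2_inner \<Omega> (\<lambda>x. u x - ud x) (\<lambda>x. u x - ud x)"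
    using vzu by (intro L2_inner_cong_AE L2_space_diff vzL2 uL2 data) auto
  have "L2_norm \<Omega> (\<lambda>x. ?\<tau> x - \<nu> x *\<^sub>R wgrad \<Omega> y x) = 0"
    "L2_norm \<Omega> (\<lambda>x. ?\<rho> x - \<nu> x *\<^sub>R wgrad \<Omega> p x) = 0"
    "L2_inner \<Omega> (\<lambda>x. ?\<tau> x - \<nu> x *\<^sub>R wgrad \<Omega> y x) (wgrad \<Omega> p) = 0"
    by (simp_all add: L2_norm_def L2_inner_def)
  then show ?thesis
    unfolding vz_def[symmetric] minorant_eq cost_def L2_norm_square r1 r3 r3' ctrl by simp
qed

section \<open>First-order condition for the optimal control\<close>

lemma state_weak_solution:
  assumes "f \<in> L2_space \<Omega>" "v \<in> L2_space \<Omega>"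
  shows "is_weak_solution \<Omega> \<nu> (\<lambda>x. f x + v x) (state \<Omega> \<nu> f v)"
proof -
  obtain z where "is_weak_solution \<Omega> \<nu> (\<lambda>x. f x + v x) z"
    using weak_solution_exists[OF L2_space_add[OF assms]] ..
  then show ?thesis
    unfolding state_def by (rule someI[of "is_weak_solution \<Omega> \<nu> (\<lambda>x. f x + v x)"])
qed

text \<open>Along the admissible segment u + t (w - u), minimality gives 0 <= t (X + t M), where X
  is the directional derivative in the variational inequality and M does not depend on t. Dividing
  by t and letting t tend to 0 gives X >= 0.\<close>

lemma optimal_control_optimality_system:
  assumes lam: "lam > 0"
    and data: "yd \<in> L2_space \<Omega>" "ud \<in> L2_space \<Omega>" "f \<in> L2_space \<Omega>"
    and opt: "is_optimal_control \<Omega> \<nu> lam f yd ud ua ub u"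
  obtains p where "optimality_system \<Omega> \<nu> lam f yd ud ua ub (state \<Omega> \<nu> f u) u p"
proof -
  have u: "u \<in> admissible_controls \<Omega> ua ub"
    and least: "\<And>v. v \<in> admissible_controls \<Omega> ua ub \<Longrightarrow>
      cost \<Omega> lam yd ud (state \<Omega> \<nu> f u) u \<le> cost \<Omega> lam yd ud (state \<Omega> \<nu> f v) v"
    using opt by (auto simp: is_optimal_control_def is_arg_min_def not_less)
  have uL2: "u \<in> L2_space \<Omega>" using u by (simp add: admissible_controls_def)
  define y where "y = state \<Omega> \<nu> f u"
  have y: "is_weak_solution \<Omega> \<nu> (\<lambda>x. f x + u x) y"
    unfolding y_def by (rule state_weak_solution[OF data(3) uL2])
  have yH: "y \<in> H10_space \<Omega>" using y by (simp add: is_weak_solution_def)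
  let ?e = "\<lambda>x. y x - yd x" and ?c = "\<lambda>x. u x - ud x"
  have eL2: "?e \<in> L2_space \<Omega>" and cL2: "?c \<in> L2_space \<Omega>"
    by (intro L2_space_diff H10_L2[OF yH] data uL2)+
  obtain p where p: "is_weak_solution \<Omega> \<nu> ?e p"
    using weak_solution_exists[OF eL2] ..
  have pH: "p \<in> H10_space \<Omega>" using p by (simp add: is_weak_solution_def)
  have "0 \<le> L2_inner \<Omega> (\<lambda>x. p x + lam * (u x - ud x)) (\<lambda>x. w x - u x)"
    if w: "w \<in> admissible_controls \<Omega> ua ub" for w
  proof -
    let ?h = "\<lambda>x. w x - u x"
    have wL2: "w \<in> L2_space \<Omega>" using w by (simp add: admissible_controls_def)
    have hL2: "?h \<in> L2_space \<Omega>" by (intro L2_space_diff wL2 uL2)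
    define X where "X = L2_inner \<Omega> ?h p + lam * L2_inner \<Omega> ?c ?h"
    define H where "H = L2_norm \<Omega> ?h"
    \<comment> \<open>The energy estimate bounds the gradient of the state increment by t
      \<open>CF\<close> H / \<open>\<nu>l\<close>, and Friedrichs adds a factor \<open>CF\<close>;
      half the square of this gives the first term. The second is the quadratic part of the control
      cost.\<close>
    define M where "M = (CF * (CF * H / \<nu>l))\<^sup>2 / 2 + lam / 2 * H\<^sup>2"
    have M0: "0 \<le> M" using lam by (simp add: M_def)
    have XM: "0 \<le> X + t * M" if t: "0 < t" "t \<le> 1" for t
    proof -
      define v where "v = (\<lambda>x. u x + t * ?h x)"
      have vL2: "v \<in> L2_space \<Omega>" unfolding v_def by (intro L2_space_add L2_space_cmult uL2 hL2)
      have "AE x in lebesgue_on \<Omega>. ua x \<le> u x \<and> u x \<le> ub x" "AE x in lebesgue_on \<Omega>. ua x \<le> w x \<and> w x \<le> ub x"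
        using u w by (simp_all add: admissible_controls_def)
      then have "AE x in lebesgue_on \<Omega>. ua x \<le> v x \<and> v x \<le> ub x"
      proof eventually_elim
        case (elim x)
        have v: "v x = (1 - t) * u x + t * w x" by (simp add: v_def algebra_simps)
        have "ua x = (1 - t) * ua x + t * ua x" "ub x = (1 - t) * ub x + t * ub x"
          by (simp_all add: algebra_simps)
        moreover have "(1 - t) * ua x + t * ua x \<le> v x" "v x \<le> (1 - t) * ub x + t * ub x"
          unfolding v using elim t by (intro add_mono mult_left_mono; simp)+
        ultimately show ?case by linarith
      qed
      then have v: "v \<in> admissible_controls \<Omega> ua ub" using vL2 by (simp add: admissible_controls_def)
      define z where "z = state \<Omega> \<nu> f v"
      have z: "is_weak_solution \<Omega> \<nu> (\<lambda>x. f x + v x) z"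
        unfolding z_def by (rule state_weak_solution[OF data(3) vL2])
      have zH: "z \<in> H10_space \<Omega>" using z by (simp add: is_weak_solution_def)
      let ?d = "\<lambda>x. z x - y x"
      define W where "W = (\<lambda>x. wgrad \<Omega> z x - wgrad \<Omega> y x)"
      have dL2: "?d \<in> L2_space \<Omega>" and WL2: "W \<in> L2_space \<Omega>"
        unfolding W_def by (intro L2_space_diff H10_L2 H10_wgrad_L2 zH yH)+
      have dW: "L2_norm \<Omega> ?d \<le> CF * L2_norm \<Omega> W"
        unfolding W_def by (rule L2_norm_H10_diff_le[OF zH yH])
      have fvL2: "(\<lambda>x. f x + v x) \<in> L2_space \<Omega>" and fuL2: "(\<lambda>x. f x + u x) \<in> L2_space \<Omega>"
        by (intro L2_space_add data vL2 uL2)+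
      \<comment> \<open>The state equation is linear, so the increment of the state solves it with
        right-hand side t (w - u).\<close>
      have perturb: "energy W (wgrad \<Omega> q) = t * L2_inner \<Omega> ?h q" if q: "q \<in> H10_space \<Omega>" for q
      proof -
        have "energy W (wgrad \<Omega> q) = L2_inner \<Omega> (\<lambda>x. f x + v x) q - L2_inner \<Omega> (\<lambda>x. f x + u x) q"
          using energy_diff_left[OF H10_wgrad_L2[OF q] H10_wgrad_L2[OF zH] H10_wgrad_L2[OF yH]] y z q
          by (simp add: W_def is_weak_solution_iff)
        also have "\<dots> = L2_inner \<Omega> (\<lambda>x. (f x + v x) - (f x + u x)) q"
          by (rule L2_inner_diff_left[OF fvL2 fuL2 H10_L2[OF q], symmetric])
        also have "(\<lambda>x. (f x + v x) - (f x + u x)) = (\<lambda>x. t * ?h x)" by (auto simp: v_def)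
        also have "L2_inner \<Omega> (\<lambda>x. t * ?h x) q = t * L2_inner \<Omega> ?h q" by (rule L2_inner_cmult_left)
        finally show ?thesis .
      qed
      have "energy W W = t * L2_inner \<Omega> ?h ?d"
        using perturb[OF H10_diff(1)[OF zH yH]] energy_wgrad_diff_right[OF WL2 zH yH]
        unfolding W_def[symmetric] by simp
      also have "\<dots> \<le> t * (H * (CF * L2_norm \<Omega> W))"
      proof (intro mult_left_mono)
        have "L2_inner \<Omega> ?h ?d \<le> H * L2_norm \<Omega> ?d"
          using L2_Cauchy_Schwarz[OF hL2 dL2] unfolding H_def by linarith
        also have "\<dots> \<le> H * (CF * L2_norm \<Omega> W)" by (intro mult_left_mono dW) (simp add: H_def)
        finally show "L2_inner \<Omega> ?h ?d \<le> H * (CF * L2_norm \<Omega> W)" .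
      qed (use t in simp)
      finally have "\<nu>l * (L2_norm \<Omega> W)\<^sup>2 \<le> t * (H * (CF * L2_norm \<Omega> W))"
        using energy_coercive[OF WL2] by linarith
      then have "(\<nu>l * L2_norm \<Omega> W) * L2_norm \<Omega> W \<le> (t * (CF * H)) * L2_norm \<Omega> W"
        by (simp add: power2_eq_square algebra_simps)
      moreover have "0 \<le> t * (CF * H)" using t CF_pos by (simp add: H_def)
      moreover have "0 \<le> L2_norm \<Omega> W" by simp
      ultimately have "\<nu>l * L2_norm \<Omega> W \<le> t * (CF * H)"
        by (cases "L2_norm \<Omega> W = 0") (simp_all add: mult_le_cancel_right)
      then have "L2_norm \<Omega> W \<le> t * (CF * H) / \<nu>l"
        using nu_lower_pos by (simp add: pos_le_divide_eq mult.commute)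
      then have "L2_norm \<Omega> ?d \<le> CF * (t * (CF * H) / \<nu>l)"
        using CF_pos by (intro order_trans[OF dW] mult_left_mono) simp_all
      then have "(L2_norm \<Omega> ?d)\<^sup>2 \<le> (CF * (t * (CF * H) / \<nu>l))\<^sup>2"
        by (intro power_mono) simp_all
      also have "\<dots> = t\<^sup>2 * (CF * (CF * H / \<nu>l))\<^sup>2" by (simp add: power_mult_distrib power_divide)
      finally have dsq: "L2_inner \<Omega> ?d ?d \<le> t\<^sup>2 * (CF * (CF * H / \<nu>l))\<^sup>2" by (simp only: L2_norm_square)
      \<comment> \<open>Adjoint duality: the adjoint equation tested with the state increment equals
        the increment equation tested with \<open>p\<close>, as the energy is symmetric. The
        derivative of the tracking term thereby becomes explicit in w - u.\<close>
      have ed: "L2_inner \<Omega> ?e ?d = t * L2_inner \<Omega> ?h p"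
      proof -
        have "L2_inner \<Omega> ?e ?d = energy (wgrad \<Omega> p) (wgrad \<Omega> ?d)"
          using p H10_diff(1)[OF zH yH] by (simp add: is_weak_solution_iff)
        also have "\<dots> = energy W (wgrad \<Omega> p)"
          unfolding energy_wgrad_diff_right[OF H10_wgrad_L2[OF pH] zH yH] W_def by (rule energy_commute)
        finally show ?thesis using perturb[OF pH] by simp
      qed
      have expand: "L2_inner \<Omega> (\<lambda>x. a x + b x) (\<lambda>x. a x + b x) =
          L2_inner \<Omega> a a + 2 * L2_inner \<Omega> a b + L2_inner \<Omega> b b"
        if a: "a \<in> L2_space \<Omega>" and b: "b \<in> L2_space \<Omega>" for a b :: "'a \<Rightarrow> real"
        using L2_inner_add_left[OF a b L2_space_add[OF a b]] L2_inner_add_right[OF a b a]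
          L2_inner_add_right[OF a b b] L2_inner_commute[of \<Omega> b a] by linarith
      have zy: "(\<lambda>x. z x - yd x) = (\<lambda>x. ?e x + ?d x)" and vu: "(\<lambda>x. v x - ud x) = (\<lambda>x. ?c x + t * ?h x)"
        by (auto simp: v_def)
      have "cost \<Omega> lam yd ud y u \<le> cost \<Omega> lam yd ud z v"
        using least[OF v] by (simp add: y_def z_def)
      then have "1 / 2 * L2_inner \<Omega> ?e ?e + lam / 2 * L2_inner \<Omega> ?c ?c \<le>
          1 / 2 * (L2_inner \<Omega> ?e ?e + 2 * (t * L2_inner \<Omega> ?h p) + L2_inner \<Omega> ?d ?d) +
          lam / 2 * (L2_inner \<Omega> ?c ?c + 2 * (t * L2_inner \<Omega> ?c ?h) + t * (t * H\<^sup>2))"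
        unfolding cost_def L2_norm_square zy vu expand[OF eL2 dL2] expand[OF cL2 L2_space_cmult[OF hL2]]
          L2_inner_cmult_left L2_inner_cmult_right ed H_def .
      then have "0 \<le> t * L2_inner \<Omega> ?h p + 1 / 2 * L2_inner \<Omega> ?d ?d
          + lam * (t * L2_inner \<Omega> ?c ?h) + lam / 2 * (t * (t * H\<^sup>2))"
        by (simp add: algebra_simps)
      also have "\<dots> \<le> t * (X + t * M)"
        using dsq by (simp add: X_def M_def power2_eq_square algebra_simps)
      finally show ?thesis using t by (simp add: zero_le_mult_iff)
    qed
    have "0 \<le> X"
    proof (rule tendsto_lowerbound)
      have "(\<lambda>n. X + inverse (real (Suc n)) * M) \<longlonglongrightarrow> X + 0 * M"
        by (intro tendsto_add tendsto_mult tendsto_const LIMSEQ_inverse_real_of_nat)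
      then show "(\<lambda>n. X + inverse (real (Suc n)) * M) \<longlonglongrightarrow> X" by simp
      show "\<forall>\<^sub>F n in sequentially. 0 \<le> X + inverse (real (Suc n)) * M"
        by (intro always_eventually allI XM) (simp_all add: inverse_le_1_iff)
    qed simp
    also have "X = L2_inner \<Omega> (\<lambda>x. p x + lam * (u x - ud x)) ?h"
      unfolding X_def
      by (simp only: L2_inner_add_left[OF H10_L2[OF pH] L2_space_cmult[OF cL2] hL2] L2_inner_cmult_left
          L2_inner_commute[of \<Omega> ?h p])
    finally show ?thesis .
  qed
  then have "optimality_system \<Omega> \<nu> lam f yd ud ua ub y u p"
    using u y p by (simp add: optimality_system_def L2_inner_def)
  then show thesis using that by (simp add: y_def)
qed

end

theorem theorem2:
  fixes \<Omega> :: "'a::euclidean_space set"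
    and \<nu> f yd ud ua ub u :: "'a \<Rightarrow> real"
    and lam \<nu>l \<nu>u CF :: real
  assumes dim: "DIM('a) \<in> {1, 2, 3}"
    and dom: "bounded_lipschitz_domain \<Omega>"
    and data: "yd \<in> L2_space \<Omega>" "ud \<in> L2_space \<Omega>" "f \<in> L2_space \<Omega>"
    and lam_pos: "lam > 0"
    and nu_meas: "\<nu> \<in> borel_measurable (lebesgue_on \<Omega>)"
    and nu_bounds: "0 < \<nu>l" "\<And>x. x \<in> \<Omega> \<Longrightarrow> \<nu>l \<le> \<nu> x \<and> \<nu> x \<le> \<nu>u"
    and friedrichs: "CF > 0"
      "\<And>w. w \<in> H10_space \<Omega> \<Longrightarrow> L2_norm \<Omega> w \<le> CF * L2_norm \<Omega> (wgrad \<Omega> w)"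
    and bounds: "ua \<in> L2_space \<Omega>" "ub \<in> L2_space \<Omega>" "AE x in lebesgue_on \<Omega>. ua x \<le> ub x"
    and opt: "is_optimal_control \<Omega> \<nu> lam f yd ud ua ub u"
  shows "(SUP (\<eta>, \<zeta>, \<tau>, \<rho>) \<in> H10_space \<Omega> \<times> H10_space \<Omega> \<times> Hdiv_space \<Omega> \<times> Hdiv_space \<Omega>.
            ereal (minorant \<Omega> \<nu> \<nu>l CF lam f yd ud \<eta> \<zeta> \<tau> \<rho> (projected_control lam ud ua ub \<zeta>)))
         = ereal (cost \<Omega> lam yd ud (state \<Omega> \<nu> f u) u)
       \<and> (\<forall>y' u' p'. optimality_system \<Omega> \<nu> lam f yd ud ua ub y' u' p' \<longrightarrow>
            cost \<Omega> lam yd ud y' u' = cost \<Omega> lam yd ud (state \<Omega> \<nu> f u) u)"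
proof -
  interpret diffusion_problem \<Omega> \<nu> \<nu>l \<nu>u CF
    by standard (use dom nu_meas nu_bounds friedrichs in \<open>auto simp: bounded_lipschitz_domain_def\<close>)
  note le_cost = minorant_le_cost[OF lam_pos data bounds]
  let ?S = "H10_space \<Omega> \<times> H10_space \<Omega> \<times> Hdiv_space \<Omega> \<times> Hdiv_space \<Omega>"
  let ?m = "\<lambda>\<eta> \<zeta> \<tau> \<rho>. minorant \<Omega> \<nu> \<nu>l CF lam f yd ud \<eta> \<zeta> \<tau> \<rho> (projected_control lam ud ua ub \<zeta>)"
  have attained: "(y, p, \<lambda>x. \<nu> x *\<^sub>R wgrad \<Omega> y x, \<lambda>x. \<nu> x *\<^sub>R wgrad \<Omega> p x) \<in> ?S"
      "v \<in> admissible_controls \<Omega> ua ub" "is_weak_solution \<Omega> \<nu> (\<lambda>x. f x + v x) y"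
    if os: "optimality_system \<Omega> \<nu> lam f yd ud ua ub y v p" for y v p
  proof -
    show v: "v \<in> admissible_controls \<Omega> ua ub" and y: "is_weak_solution \<Omega> \<nu> (\<lambda>x. f x + v x) y"
      using os by (simp_all add: optimality_system_def)
    have p: "is_weak_solution \<Omega> \<nu> (\<lambda>x. y x - yd x) p"
      using os by (simp add: optimality_system_def)
    have yH: "y \<in> H10_space \<Omega>" and pH: "p \<in> H10_space \<Omega>"
      using y p by (simp_all add: is_weak_solution_def)
    have vL2: "v \<in> L2_space \<Omega>" using v by (simp add: admissible_controls_def)
    show "(y, p, \<lambda>x. \<nu> x *\<^sub>R wgrad \<Omega> y x, \<lambda>x. \<nu> x *\<^sub>R wgrad \<Omega> p x) \<in> ?S"
      using yH pH flux_Hdiv(1)[OF L2_space_add[OF data(3) vL2] y]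
        flux_Hdiv(1)[OF L2_space_diff[OF H10_L2[OF yH] data(1)] p] by simp
  qed
  \<comment> \<open>The minorant built from the first solution equals its cost and is at most the
    cost at the second; exchanging the roles gives equality.\<close>
  have cost_le: "cost \<Omega> lam yd ud y v \<le> cost \<Omega> lam yd ud y' v'"
    if os: "optimality_system \<Omega> \<nu> lam f yd ud ua ub y v p"
      and os': "optimality_system \<Omega> \<nu> lam f yd ud ua ub y' v' p'" for y v p y' v' p'
    using le_cost[OF attained(2,3)[OF os'], of y p "\<lambda>x. \<nu> x *\<^sub>R wgrad \<Omega> y x" "\<lambda>x. \<nu> x *\<^sub>R wgrad \<Omega> p x"]
      attained(1)[OF os] minorant_optimality_system[OF lam_pos data bounds os] by simp
  \<comment> \<open>An adjoint state for the given \<open>u\<close> completes the triple at which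
    the supremum is attained.\<close>
  obtain p where os: "optimality_system \<Omega> \<nu> lam f yd ud ua ub (state \<Omega> \<nu> f u) u p"
    by (rule optimal_control_optimality_system[OF lam_pos data opt])
  have "(SUP (\<eta>, \<zeta>, \<tau>, \<rho>) \<in> ?S. ereal (?m \<eta> \<zeta> \<tau> \<rho>)) = ereal (cost \<Omega> lam yd ud (state \<Omega> \<nu> f u) u)"
  proof (rule antisym)
    show "(SUP (\<eta>, \<zeta>, \<tau>, \<rho>) \<in> ?S. ereal (?m \<eta> \<zeta> \<tau> \<rho>)) \<le> ereal (cost \<Omega> lam yd ud (state \<Omega> \<nu> f u) u)"
      using le_cost[OF attained(2,3)[OF os]] by (intro SUP_least) auto
    show "ereal (cost \<Omega> lam yd ud (state \<Omega> \<nu> f u) u) \<le> (SUP (\<eta>, \<zeta>, \<tau>, \<rho>) \<in> ?S. ereal (?m \<eta> \<zeta> \<tau> \<rho>))"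
      by (rule SUP_upper2[OF attained(1)[OF os]])
        (simp add: minorant_optimality_system[OF lam_pos data bounds os])
  qed
  then show ?thesis using cost_le[OF os] cost_le[OF _ os] by (auto intro: antisym)
qed

end
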